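(* Let $\nu>0$, let $\rho:\mathbb{R}\to\mathbb{R}$ be globally Lipschitz continuous, let $\mu\in\mathcal{M}_H(\mathbb{R})$, and let $u$ be the random field solution of $$u(t,x)=(\mu*G_\nu(t,\cdot))(x)+\iint_{[0,t]\times\mathbb{R}}G_\nu(t-s,x-y)\,\rho(u(s,y))\,W(ds,dy).$$ Then for all $\phi\in C_c^\infty(\mathbb{R})$, $$\lim_{t\to0_+}\int_{\mathbb{R}}dx\,u(t,x)\phi(x)=\int_{\mathbb{R}}\mu(dx)\,\phi(x)\quad\text{in }L^2(\Omega).$$
   Context: Notation: $\mathbb{R}_+^*=\,]0,\infty[$; $\|\cdot\|_p$ is the $L^p(\Omega)$-norm; $C_c^\infty(\mathbb{R})$ is the set of smooth compactly supported functions. The heat kernel is $G_\nu(t,x)=\frac{1}{\sqrt{2\pi\nu t}}\exp(-\frac{x^2}{2\nu t})$ for $(t,x)\in\mathbb{R}_+^*\times\mathbb{R}$; $*$ denotes convolution in space and $\star$ simultaneous convolution in time and space, $(f\star g)(t,x)=\int_0^t ds\int_{\mathbb{R}}dy\,f(s,y)g(t-s,x-y)$. $W$ is a space-time white noise on $\mathbb{R}_+\times\mathbb{R}$ defined on a complete probability space: $W=\{W_t(A):t\ge0,\ A\subset\mathbb{R}\text{ Borel of finite Lebesgue measure}\}$ is centered Gaussian with covariance $E[W_t(A)W_s(B)]=\min(t,s)|A\cap B|$. $\{\mathcal{F}_t\}$ is the right-continuous version of its natural filtration augmented by null sets. Stochastic integrals against $W$ are in the sense of Walsh. $\mathcal{M}_H(\mathbb{R})$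 is the set of signed Borel measures $\mu$ on $\mathbb{R}$ such that $\int_{\mathbb{R}}e^{-ax^2}|\mu|(dx)<\infty$ for all $a>0$, where $|\mu|=\mu_++\mu_-$ (Jordan decomposition). Random field solution: a process $u=(u(t,x),(t,x)\in\mathbb{R}_+^*\times\mathbb{R})$ such that (i) $u(t,x)$ is $\mathcal{F}_t$-measurable for all $(t,x)$; (ii) $u$ is jointly measurable with respect to $\mathcal{B}(\mathbb{R}_+^*\times\mathbb{R})\times\mathcal{F}$; (iii) $(G_\nu^2\star\|\rho(u)\|_2^2)(t,x)<\infty$ for all $(t,x)\in\mathbb{R}_+^*\times\mathbb{R}$ and the stochastic integral term is, as a function of $(t,x)$, continuous from $\mathbb{R}_+^*\times\mathbb{R}$ into $L^2(\Omega)$; (iv) the integral equation holds a.s. for every $(t,x)\in\mathbb{R}_+^*\times\mathbb{R}$. For $\rho$ Lipschitz and $\mu\in\mathcal{M}_H(\mathbb{R})$ it is known that such a solution exists and is unique in the sense of versions. *)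

theory Defs
  imports "HOL-Probability.Probability"
begin

section \<open>Square-integrable random variables\<close>

text \<open>The squared norm takes values in the extended nonnegative reals, so that it is
  infinite (and not 0) if the random variable is not square integrable.\<close>

definition L2_norm_sq :: "'w measure \<Rightarrow> ('w \<Rightarrow> real) \<Rightarrow> ennreal" where
  "L2_norm_sq M X = (\<integral>\<^sup>+ \<omega>. ennreal ((X \<omega>)\<^sup>2) \<partial>M)"

definition L2_space :: "'w measure \<Rightarrow> ('w \<Rightarrow> real) set" where
  "L2_space M = {X \<in> borel_measurable M. L2_norm_sq M X < \<infinity>}"

definition tendsto_L2 ::
  "'w measure \<Rightarrow> ('i \<Rightarrow> 'w \<Rightarrow> real) \<Rightarrow> ('w \<Rightarrow> real) \<Rightarrow> 'i filter \<Rightarrow> bool" where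
  "tendsto_L2 M X Y F \<longleftrightarrow>
     (\<forall>\<^sub>F i in F. X i \<in> L2_space M) \<and> Y \<in> L2_space M \<and>
     ((\<lambda>i. L2_norm_sq M (\<lambda>\<omega>. X i \<omega> - Y \<omega>)) \<longlongrightarrow> 0) F"


section \<open>Space-time white noise and its filtration\<close>

definition finite_borel_sets :: "real set set" where
  "finite_borel_sets = {A \<in> sets borel. emeasure lborel A < \<infinity>}"

text \<open>The constant 0 counts as a (degenerate) centered Gaussian variable.\<close>

definition centered_gaussian :: "'w measure \<Rightarrow> ('w \<Rightarrow> real) \<Rightarrow> bool" where
  "centered_gaussian M X \<longleftrightarrow> X \<in> borel_measurable M \<and>
     ((AE \<omega> in M. X \<omega> = 0) \<or> (\<exists>\<sigma>>0. distributed M lborel X (normal_density 0 \<sigma>)))"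

definition centered_gaussian_process ::
  "'w measure \<Rightarrow> 'i set \<Rightarrow> ('i \<Rightarrow> 'w \<Rightarrow> real) \<Rightarrow> bool" where
  "centered_gaussian_process M T X \<longleftrightarrow>
     (\<forall>J c. finite J \<and> J \<subseteq> T \<longrightarrow> centered_gaussian M (\<lambda>\<omega>. \<Sum>i\<in>J. c i * X i \<omega>))"

definition space_time_white_noise ::
  "'w measure \<Rightarrow> (real \<Rightarrow> real set \<Rightarrow> 'w \<Rightarrow> real) \<Rightarrow> bool" where
  "space_time_white_noise M W \<longleftrightarrow>
     centered_gaussian_process M ({0..} \<times> finite_borel_sets) (\<lambda>(t, A). W t A) \<and>
     (\<forall>t\<ge>0. \<forall>s\<ge>0. \<forall>A\<in>finite_borel_sets. \<forall>B\<in>finite_borel_sets.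
        (\<integral>\<omega>. W t A \<omega> * W s B \<omega> \<partial>M) = min t s * measure lborel (A \<inter> B))"

definition natural_events ::
  "'w measure \<Rightarrow> (real \<Rightarrow> real set \<Rightarrow> 'w \<Rightarrow> real) \<Rightarrow> real \<Rightarrow> 'w set set" where
  "natural_events M W t = sigma_sets (space M)
     ({W s A -` B \<inter> space M | s A B. 0 \<le> s \<and> s \<le> t \<and> A \<in> finite_borel_sets \<and> B \<in> sets borel}
      \<union> null_sets M)"

text \<open>The intersection below is itself a sigma-algebra; \<open>sigma\<close> only packs it as a measure space.\<close>

definition noise_filtration ::
  "'w measure \<Rightarrow> (real \<Rightarrow> real set \<Rightarrow> 'w \<Rightarrow> real) \<Rightarrow> real \<Rightarrow> 'w measure" where
  "noise_filtration M W t = sigma (space M) (\<Inter>s\<in>{t<..}. natural_events M W s)"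


section \<open>The Walsh integral\<close>

definition spacetime :: "(real \<times> real) measure" where
  "spacetime = restrict_space lborel ({0<..} \<times> UNIV)"

text \<open>A list of tuples \<open>(X, a, b, A)\<close> encodes the elementary process
  that is the sum of the terms \<open>X(\<omega>) 1\<^bsub>(a,b]\<^esub>(s) 1\<^bsub>A\<^esub>(y)\<close>.\<close>

type_synonym 'w elementary = "(('w \<Rightarrow> real) \<times> real \<times> real \<times> real set) list"

definition elementary_process ::
  "'w measure \<Rightarrow> (real \<Rightarrow> real set \<Rightarrow> 'w \<Rightarrow> real) \<Rightarrow> 'w elementary \<Rightarrow> bool" where
  "elementary_process M W S \<longleftrightarrow>
     (\<forall>(X, a, b, A) \<in> set S. 0 \<le> a \<and> a < b \<and> A \<in> finite_borel_sets \<and>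
        X \<in> borel_measurable (noise_filtration M W a) \<and> (\<exists>K. \<forall>\<omega>\<in>space M. \<bar>X \<omega>\<bar> \<le> K))"

definition elementary_value :: "'w elementary \<Rightarrow> real \<Rightarrow> real \<Rightarrow> 'w \<Rightarrow> real" where
  "elementary_value S s y \<omega> =
     (\<Sum>(X, a, b, A) \<leftarrow> S. X \<omega> * indicator {a<..b} s * indicator A y)"

definition elementary_integral ::
  "(real \<Rightarrow> real set \<Rightarrow> 'w \<Rightarrow> real) \<Rightarrow> 'w elementary \<Rightarrow> 'w \<Rightarrow> real" where
  "elementary_integral W S \<omega> = (\<Sum>(X, a, b, A) \<leftarrow> S. X \<omega> * (W b A \<omega> - W a A \<omega>))"

text \<open>The Walsh integral over all positive times is the extension of the elementary integral to
  the closure of the elementary processes in \<open>L\<^sup>2(ds dy dP)\<close>. It is determined up to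
  almost sure equality, whence a relation rather than a function. Integration over
  \<open>[0,t] \<times> \<real>\<close> is integration of the integrand times the indicator of \<open>[0,t]\<close>.\<close>

definition has_walsh_integral ::
  "'w measure \<Rightarrow> (real \<Rightarrow> real set \<Rightarrow> 'w \<Rightarrow> real) \<Rightarrow>
   (real \<Rightarrow> real \<Rightarrow> 'w \<Rightarrow> real) \<Rightarrow> ('w \<Rightarrow> real) \<Rightarrow> bool" where
  "has_walsh_integral M W f I \<longleftrightarrow>
     (\<lambda>((s, y), \<omega>). f s y \<omega>) \<in> borel_measurable (spacetime \<Otimes>\<^sub>M M) \<and>
     (\<exists>S. (\<forall>n::nat. elementary_process M W (S n)) \<and>
        (\<lambda>n. L2_norm_sq (spacetime \<Otimes>\<^sub>M M)
               (\<lambda>((s, y), \<omega>). elementary_value (S n) s y \<omega> - f s y \<omega>)) \<longlonglongrightarrow> 0 \<and>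
        tendsto_L2 M (\<lambda>n. elementary_integral W (S n)) I sequentially)"


section \<open>Signed measures and test functions\<close>

text \<open>Positive and negative part may both have infinite mass, so a signed measure is a set function
  on the bounded Borel sets; its values elsewhere are irrelevant.\<close>

definition signed_borel_measure :: "(real set \<Rightarrow> real) \<Rightarrow> bool" where
  "signed_borel_measure \<mu> \<longleftrightarrow>
     (\<forall>A :: nat \<Rightarrow> real set. range A \<subseteq> sets borel \<and> disjoint_family A \<and> bounded (\<Union>n. A n) \<longrightarrow>
        (\<lambda>n. \<mu> (A n)) sums \<mu> (\<Union>n. A n))"

definition jordan_decomposition ::
  "(real set \<Rightarrow> real) \<Rightarrow> real measure \<Rightarrow> real measure \<Rightarrow> bool" where
  "jordan_decomposition \<mu> P N \<longleftrightarrow>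
     sets P = sets borel \<and> sets N = sets borel \<and>
     (\<forall>A\<in>sets borel. bounded A \<longrightarrow>
        emeasure P A < \<infinity> \<and> emeasure N A < \<infinity> \<and> \<mu> A = measure P A - measure N A) \<and>
     (\<exists>S\<in>sets borel. emeasure P (- S) = 0 \<and> emeasure N S = 0)"

text \<open>The Jordan decomposition is unique, so the choice is only apparent.\<close>

definition pos_measure :: "(real set \<Rightarrow> real) \<Rightarrow> real measure" where
  "pos_measure \<mu> = fst (SOME (P, N). jordan_decomposition \<mu> P N)"

definition neg_measure :: "(real set \<Rightarrow> real) \<Rightarrow> real measure" where
  "neg_measure \<mu> = snd (SOME (P, N). jordan_decomposition \<mu> P N)"

definition signed_integral :: "(real set \<Rightarrow> real) \<Rightarrow> (real \<Rightarrow> real) \<Rightarrow> real" where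
  "signed_integral \<mu> f = (\<integral>x. f x \<partial>pos_measure \<mu>) - (\<integral>x. f x \<partial>neg_measure \<mu>)"

text \<open>By the Hahn-Jordan theorem the second conjunct follows from the first.\<close>

definition M_H :: "(real set \<Rightarrow> real) set" where
  "M_H = {\<mu>. signed_borel_measure \<mu> \<and> (\<exists>P N. jordan_decomposition \<mu> P N) \<and>
     (\<forall>a>0. (\<integral>\<^sup>+ x. ennreal (exp (- a * x\<^sup>2)) \<partial>pos_measure \<mu>) +
            (\<integral>\<^sup>+ x. ennreal (exp (- a * x\<^sup>2)) \<partial>neg_measure \<mu>) < \<infinity>)}"

definition test_functions :: "(real \<Rightarrow> real) set" where
  "test_functions = {\<phi>. (\<forall>n x. (deriv ^^ n) \<phi> field_differentiable (at x)) \<and>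
     compact (closure {x. \<phi> x \<noteq> 0})}"


section \<open>The stochastic heat equation\<close>

definition heat_kernel :: "real \<Rightarrow> real \<Rightarrow> real \<Rightarrow> real" where
  "heat_kernel \<nu> t x = 1 / sqrt (2 * pi * \<nu> * t) * exp (- x\<^sup>2 / (2 * \<nu> * t))"

definition spacetime_conv ::
  "(real \<Rightarrow> real \<Rightarrow> ennreal) \<Rightarrow> (real \<Rightarrow> real \<Rightarrow> ennreal) \<Rightarrow> real \<Rightarrow> real \<Rightarrow> ennreal" where
  "spacetime_conv f g t x =
     (\<integral>\<^sup>+ s\<in>{0..t}. (\<integral>\<^sup>+ y. f s y * g (t - s) (x - y) \<partial>lborel) \<partial>lborel)"

text \<open>The existentially quantified \<open>I\<close> is the stochastic integral term. The values
  \<open>u 0 y\<close> and \<open>heat_kernel \<nu> 0 z\<close> only matter on Lebesgue null sets.\<close>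

definition random_field_solution ::
  "'w measure \<Rightarrow> (real \<Rightarrow> real set \<Rightarrow> 'w \<Rightarrow> real) \<Rightarrow> real \<Rightarrow> (real \<Rightarrow> real) \<Rightarrow>
   (real set \<Rightarrow> real) \<Rightarrow> (real \<Rightarrow> real \<Rightarrow> 'w \<Rightarrow> real) \<Rightarrow> bool" where
  "random_field_solution M W \<nu> \<rho> \<mu> u \<longleftrightarrow>
     (\<forall>t>0. \<forall>x. u t x \<in> borel_measurable (noise_filtration M W t)) \<and>
     (\<lambda>((t, x), \<omega>). u t x \<omega>)
        \<in> borel_measurable (restrict_space borel ({0<..} \<times> UNIV) \<Otimes>\<^sub>M M) \<and>
     (\<forall>t>0. \<forall>x. spacetime_conv (\<lambda>s y. ennreal ((heat_kernel \<nu> s y)\<^sup>2))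
                  (\<lambda>s y. L2_norm_sq M (\<lambda>\<omega>. \<rho> (u s y \<omega>))) t x < \<infinity>) \<and>
     (\<exists>I. (\<forall>t>0. \<forall>x. has_walsh_integral M W
              (\<lambda>s y \<omega>. indicator {0..t} s * heat_kernel \<nu> (t - s) (x - y) * \<rho> (u s y \<omega>)) (I t x)) \<and>
          (\<forall>t>0. \<forall>x. tendsto_L2 M (\<lambda>(s, y). I s y) (I t x) (at (t, x) within {0<..} \<times> UNIV)) \<and>
          (\<forall>t>0. \<forall>x. AE \<omega> in M.
              u t x \<omega> = signed_integral \<mu> (\<lambda>y. heat_kernel \<nu> t (x - y)) + I t x \<omega>))"

end

theory Submission
  imports Defs
begin

text \<open>The solution is the sum of a deterministic part \<open>\<mu> * G\<close> and a stochastic integral \<open>I\<close>. The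
  deterministic part, tested against \<open>\<phi>\<close>, is the integral of \<open>\<phi> * G(t, .)\<close> with respect to \<open>\<mu>\<close>, and
  converges by dominated convergence. For the stochastic part no stochastic Fubini theorem is needed:
  the second moment of \<open>\<integral> I(t,x) \<phi>(x) dx\<close> is the double integral of \<open>\<phi>(x) \<phi>(x') E[I(t,x) I(t,x')]\<close>,
  and the covariance is given by the polarized Ito isometry. Hence the second moment is at most
  \<open>\<integral>\<integral>\<^bsub>s \<le> t\<^esub> (|\<phi>| * G(t-s, .))\<^sup>2(y) E[\<rho>(u(s,y))\<^sup>2] ds dy\<close>. For \<open>t \<le> 1/8\<close> the square of \<open>|\<phi>| * G(t-s, .)\<close> is
  bounded by a multiple of \<open>G(1-s, y)\<^sup>2\<close>, and \<open>G(1-s, y)\<^sup>2 E[\<rho>(u(s,y))\<^sup>2]\<close> is integrable over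
  \<open>s \<le> 1\<close> because \<open>G\<^sup>2 \<star> E[\<rho>(u)\<^sup>2]\<close> is finite at \<open>(1, 0)\<close>. So no moment estimate for \<open>u\<close> is needed, and
  the integral over \<open>s \<le> t\<close> vanishes as \<open>t\<close> tends to 0.

  The Ito isometry rests on the independence of future increments of the noise from the past.
  For Gaussian variables it follows from orthogonality through characteristic functions.\<close>

section \<open>Uniqueness of measures via characteristic functions\<close>

text \<open>A stochastic integral is determined only up to a null set, for each point (t, x)
  separately, so the witness \<open>I\<close> of a random field solution need not be measurable in
  x. Integrals over x are therefore taken of \<open>u\<close> minus its deterministic part, which is
  jointly measurable and agrees with \<open>I\<close> almost surely at each point. This is enough,
  because the second moment of the tested process only sees pairs of points. The constant 1/8 turns
  the Gaussian majorant exp(-y^2 / (8 \<nu> t)) into exp(-y^2 / \<nu>). Its square exp(-2 y^2 /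
  \<nu>) decays at least as fast as exp(-y^2 / (\<nu> (1 - s))), the Gaussian factor of G(1 - s,
  y)^2, for s at most 1/8. The entries of an elementary process may overlap in time and space. The
  isometry is therefore proved for pairs of entries, and independence of the past is needed for two
  increments jointly. Linear combinations with free coefficients \<open>p\<close> and
  \<open>q\<close> encode the pair, so that only characteristic functions on the line occur.\<close>

lemma finite_borel_measure_eqI_char:
  assumes "finite_borel_measure m1" "finite_borel_measure m2" and eq: "char m1 = char m2"
  shows "m1 = m2"
proof -
  interpret m1: finite_borel_measure m1 by fact
  interpret m2: finite_borel_measure m2 by fact
  have sp: "space m1 = UNIV" "space m2 = UNIV" by (simp_all add: m1.borel_UNIV m2.borel_UNIV)
  \<comment> \<open>The characteristic function at 0 is the total mass, so both masses are
    \<open>c\<close>. \<open>Levy_uniqueness\<close> speaks of probability measures and applies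
    after division by \<open>c\<close>; mass 0 is a case of its own.\<close>
  define c where "c = measure m1 UNIV"
  have "char m1 0 = complex_of_real (measure m1 UNIV)" "char m2 0 = complex_of_real (measure m2 UNIV)"
    by (simp_all add: char_def sp scaleR_conv_of_real)
  with eq have c2: "measure m2 UNIV = c" by (simp add: c_def)
  have e1: "emeasure m1 UNIV = ennreal c" by (simp add: c_def m1.emeasure_eq_measure)
  have e2: "emeasure m2 UNIV = ennreal c" by (simp add: c2 m2.emeasure_eq_measure)
  show ?thesis
  proof (cases "c = 0")
    case True
    have z: "emeasure m A = 0" if "emeasure m (space m) = 0" for m :: "real measure" and A
      using emeasure_space[of m A] that by simp
    show ?thesis
      by (rule measure_eqI) (use e1 e2 True sp in \<open>auto simp: m1.M_is_borel m2.M_is_borel z\<close>)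
  next
    case False
    then have c: "c > 0" by (simp add: c_def less_le)
    define n where "n m = density m (\<lambda>_. ennreal (1 / c))" for m :: "real measure"
    have rd: "real_distribution (n m)" if "finite_borel_measure m" "emeasure m UNIV = ennreal c" for m
    proof -
      interpret finite_borel_measure m by fact
      have "emeasure (n m) (space (n m)) = ennreal (1 / c) * ennreal c"
        using that(2) by (simp add: n_def emeasure_density_const M_is_borel borel_UNIV)
      then have "emeasure (n m) (space (n m)) = 1"
        using c by (simp flip: ennreal_mult)
      then show ?thesis
        by (intro real_distribution.intro real_distribution_axioms.intro prob_spaceI)
          (simp_all add: n_def M_is_borel)
    qed
    have ch: "char (n m) t = complex_of_real (1/c) * char m t" if "finite_borel_measure m" for m t
    proof -
      interpret finite_borel_measure m by fact
      have [measurable_cong]: "sets m = sets borel" by (rule M_is_borel)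
      show ?thesis
        unfolding char_def n_def using c
        by (subst integral_density) (auto simp: scaleR_conv_of_real simp del: of_real_divide)
    qed
    have "n m1 = n m2"
      by (rule Levy_uniqueness) (auto intro!: rd assms e1 e2 simp: ch assms eq fun_eq_iff)
    moreover have "emeasure m A = ennreal c * emeasure (n m) A" if "A \<in> sets m" for m A
      using c that by (simp add: n_def emeasure_density nn_integral_cmult_indicator flip: mult.assoc ennreal_mult)
    ultimately show ?thesis
      by (intro measure_eqI) (auto simp: m1.M_is_borel m2.M_is_borel)
  qed
qed

text \<open>With the weight \<open>g\<close> as density, the image measure under \<open>X\<close> is
  a finite Borel measure on the line whose characteristic function is the weighted exponential
  integral. The two image measures thus coincide, and both sides are integrals of \<open>h\<close>
  against one and the same measure, whether or not \<open>h\<close> is integrable.\<close>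

lemma integral_eqI_char:
  fixes g X f :: "'w \<Rightarrow> real"
  assumes fin: "finite_measure m1" "finite_measure m2" and sets: "sets m1 = sets m2"
    and [measurable]: "g \<in> borel_measurable m1" "X \<in> borel_measurable m1" 
    and g: "\<And>\<omega>. 0 \<le> g \<omega>" "\<And>\<omega>. g \<omega> \<le> K"
    and eq: "\<And>\<theta>. (CLINT \<omega>|m1. g \<omega> * iexp (\<theta> * X \<omega>)) = (CLINT \<omega>|m2. g \<omega> * iexp (\<theta> * X \<omega>))"
    and [measurable]: "h \<in> borel_measurable borel"
  shows "(\<integral>\<omega>. g \<omega> * h (X \<omega>) \<partial>m1) = (\<integral>\<omega>. g \<omega> * (h (X \<omega>) :: real) \<partial>m2)"
proof -
  have [measurable_cong]: "sets m2 = sets m1" by (simp add: sets)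
  define n where "n m = distr (density m g) borel X" for m
  have fb: "finite_borel_measure (n m)" if "finite_measure m" "sets m = sets m1" for m
  proof -
    interpret finite_measure m by fact
    have [measurable_cong]: "sets m = sets m1" by fact
    have "(\<integral>\<^sup>+\<omega>. g \<omega> \<partial>m) \<le> (\<integral>\<^sup>+\<omega>. ennreal K \<partial>m)"
      by (intro nn_integral_mono ennreal_leI g)
    also have "\<dots> < \<infinity>" by (simp add: ennreal_mult_eq_top_iff less_top[symmetric])
    finally have "emeasure (n m) (space (n m)) < \<infinity>"
      by (simp add: n_def emeasure_distr emeasure_density)
    then show ?thesis
      by (intro finite_borel_measure.intro finite_measureI finite_borel_measure_axioms.intro)
        (auto simp: n_def)
  qed
  have ch: "char (n m) \<theta> = (CLINT \<omega>|m. g \<omega> * iexp (\<theta> * X \<omega>))" if "sets m = sets m1" for m \<theta>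
  proof -
    have [measurable_cong]: "sets m = sets m1" by fact
    show ?thesis unfolding char_def n_def
      by (subst integral_distr) (auto simp: integral_density g scaleR_conv_of_real)
  qed
  have int: "(\<integral>x. h x \<partial>n m) = (\<integral>\<omega>. g \<omega> * h (X \<omega>) \<partial>m)" if "sets m = sets m1" for m
  proof -
    have [measurable_cong]: "sets m = sets m1" by fact
    show ?thesis unfolding n_def
      by (subst integral_distr) (auto simp: integral_density g)
  qed
  have "char (n m1) = char (n m2)"
    unfolding fun_eq_iff ch[OF refl] ch[OF sets[symmetric]] using eq by blast
  then have "n m1 = n m2"
    by (intro finite_borel_measure_eqI_char) (simp_all only: fb fin sets)
  then show ?thesis using int[of m1] int[of m2] sets by metis
qed

lemma integral_add_mult_mult:
  fixes f g h :: "'a \<Rightarrow> complex"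
  assumes "complex_integrable m f" "complex_integrable m g" "complex_integrable m h"
  shows "(CLINT \<omega>|m. f \<omega> + (a * g \<omega> + b * h \<omega>)) =
    (CLINT \<omega>|m. f \<omega>) + (a * (CLINT \<omega>|m. g \<omega>) + b * (CLINT \<omega>|m. h \<omega>))"
  using assms by simp

text \<open>An intersection-stable family for the pi-lambda argument. Conditions are added one at a
  time, so that induction trades one exponential for one indicator in each step.\<close>

inductive_set cylinders :: "'w set \<Rightarrow> ('w \<Rightarrow> real) set \<Rightarrow> 'w set set" for \<Omega> V where
  space: "\<Omega> \<in> cylinders \<Omega> V"
| inter: "E \<in> cylinders \<Omega> V \<Longrightarrow> X \<in> V \<Longrightarrow> B \<in> sets borel \<Longrightarrow> E \<inter> (X -` B \<inter> \<Omega>) \<in> cylinders \<Omega> V"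

lemma cylinders_subset: "E \<in> cylinders \<Omega> V \<Longrightarrow> E \<subseteq> \<Omega>"
  by (induction rule: cylinders.induct) auto

lemma cylinders_Int:
  "F \<in> cylinders \<Omega> V \<Longrightarrow> E \<in> cylinders \<Omega> V \<Longrightarrow> E \<inter> F \<in> cylinders \<Omega> V"
proof (induction rule: cylinders.induct)
  case space
  then show ?case using cylinders_subset[OF space] by (simp add: Int_absorb2)
next
  case (inter F X B)
  then have "(E \<inter> F) \<inter> (X -` B \<inter> \<Omega>) \<in> cylinders \<Omega> V" by (intro cylinders.inter)
  then show ?case by (simp add: Int_assoc)
qed

text \<open>Exponentials are replaced by indicators one variable at a time. The weights
  \<open>1 + Re (z iexp L)\<close> with \<open>|z| \<le> 1\<close> are nonnegative, so uniqueness of characteristic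
  functions is only needed for positive measures on the line.\<close>

lemma measure_eq_on_cylinders:
  fixes m1 m2 :: "'w measure" and V :: "('w \<Rightarrow> real) set"
  assumes fin: "finite_measure m1" "finite_measure m2" and sets: "sets m1 = sets m2"
    and meas: "V \<subseteq> borel_measurable m1"
    and zero: "(\<lambda>_. 0) \<in> V"
    and lin: "\<And>X L \<theta>. X \<in> V \<Longrightarrow> L \<in> V \<Longrightarrow> (\<lambda>\<omega>. \<theta> * X \<omega> + L \<omega>) \<in> V"
    and eq: "\<And>L. L \<in> V \<Longrightarrow> (CLINT \<omega>|m1. iexp (L \<omega>)) = (CLINT \<omega>|m2. iexp (L \<omega>))"
    and E: "E \<in> cylinders (space m1) V"
  shows "E \<in> sets m1 \<and> measure m1 E = measure m2 E"
proof -
  have [measurable_cong]: "sets m2 = sets m1" by (simp add: sets)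
  interpret m1: finite_measure m1 by fact
  interpret m2: finite_measure m2 by fact
  have mV [measurable]: "X \<in> borel_measurable m1" if "X \<in> V" for X using that meas by auto
  have I: "integrable m (\<lambda>\<omega>. indicator E \<omega> * iexp (L \<omega>))"
    if "finite_measure m" "sets m = sets m1" "E \<in> sets m1" "L \<in> V" for m E L
  proof -
    interpret finite_measure m by fact
    have [measurable_cong]: "sets m = sets m1" by fact
    have [measurable]: "E \<in> sets m1" "L \<in> borel_measurable m1" using that by auto
    show ?thesis
      by (rule integrable_const_bound[of _ 1]) (auto simp: norm_mult indicator_def)
  qed
  \<comment> \<open>The claim is strengthened from \<open>E\<close> to all exponentials weighted by
    \<open>indicator E\<close>. A new condition on \<open>X\<close> calls the induction hypothesis
    at the functions \<theta>X + L, \<theta>X - L and \<theta>X, hence the quantifier over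
    \<open>L\<close>.\<close>
  have "E \<in> sets m1 \<and> (\<forall>L\<in>V. (CLINT \<omega>|m1. indicator E \<omega> * iexp (L \<omega>)) = (CLINT \<omega>|m2. indicator E \<omega> * iexp (L \<omega>)))"
    using E
  proof (induction rule: cylinders.induct)
    case space
    have "(CLINT \<omega>|m. indicator (space m1) \<omega> * iexp (L \<omega>)) = (CLINT \<omega>|m. iexp (L \<omega>))" if "sets m = sets m1" for m L
      using sets_eq_imp_space_eq[OF that] by (intro Bochner_Integration.integral_cong) auto
    then show ?case using eq sets by auto
  next
    case (inter E X B)
    have [measurable]: "E \<in> sets m1" "X \<in> borel_measurable m1" "B \<in> sets borel" using inter by auto
    have M: "E \<inter> (X -` B \<inter> space m1) \<in> sets m1" by measurable
    have main: "(\<integral>\<omega>. indicator E \<omega> * (1 + Re (z * iexp (L \<omega>))) * indicator B (X \<omega>) \<partial>m1) =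
      (\<integral>\<omega>. indicator E \<omega> * (1 + Re (z * iexp (L \<omega>))) * indicator B (X \<omega>) \<partial>m2)"
      if L: "L \<in> V" and z: "norm z \<le> 1" for L z
    proof (rule integral_eqI_char[where K=2 and X=X and h="indicator B" and
          g="\<lambda>\<omega>. indicator E \<omega> * (1 + Re (z * iexp (L \<omega>)))"])
      have [measurable]: "L \<in> borel_measurable m1" using L by auto
      show "(\<lambda>\<omega>. indicator E \<omega> * (1 + Re (z * iexp (L \<omega>)))) \<in> borel_measurable m1"
        by measurable
      have b: "\<bar>Re (z * iexp (L \<omega>))\<bar> \<le> 1" for \<omega>
        using abs_Re_le_cmod[of "z * iexp (L \<omega>)"] z by (simp add: norm_mult)
      show "0 \<le> indicator E \<omega> * (1 + Re (z * iexp (L \<omega>)))" 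
        "indicator E \<omega> * (1 + Re (z * iexp (L \<omega>))) \<le> 2" for \<omega>
        using b[of \<omega>] unfolding indicator_def by (auto simp del: times_complex.sel)
      \<comment> \<open>These three combinations occur when a real part is written as (w + cnj w) /
        2 and multiplied by \<open>iexp (\<theta> * X \<omega>)\<close>. The summand 0 is the zero
        function of \<open>V\<close>, which keeps the shape that \<open>lin\<close>
        produces.\<close>
      have l1: "(\<lambda>\<omega>. \<theta> * X \<omega> + L \<omega>) \<in> V" "(\<lambda>\<omega>. \<theta> * X \<omega> + (- 1 * L \<omega> + 0)) \<in> V" "(\<lambda>\<omega>. \<theta> * X \<omega> + 0) \<in> V" for \<theta>
        using inter L zero by (intro lin; simp)+
      have ex: "complex_of_real (indicator E \<omega> * (1 + Re (z * iexp (L \<omega>)))) * iexp (\<theta> * X \<omega>) =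
         indicator E \<omega> * iexp (\<theta> * X \<omega> + 0) + (z/2 * (indicator E \<omega> * iexp (\<theta> * X \<omega> + L \<omega>))
           + cnj z/2 * (indicator E \<omega> * iexp (\<theta> * X \<omega> + (- 1 * L \<omega> + 0))))" for \<omega> \<theta>
      proof -
        have r: "complex_of_real (Re w) = (w + cnj w) / 2" for w by (simp add: complex_eq_iff)
        have e1: "iexp (p + q) = iexp p * iexp q" for p q by (simp add: exp_add distrib_left)
        have e2: "iexp (p + (- 1 * q + 0)) = iexp p * cnj (iexp q)" for p q
          by (simp add: exp_cnj right_diff_distrib exp_diff exp_minus divide_inverse)
        show ?thesis
          unfolding e2 unfolding e1 unfolding of_real_mult of_real_add r by (simp add: indicator_def algebra_simps add_divide_distrib)
      qed
      have ex2: "(CLINT \<omega>|m. complex_of_real (indicator E \<omega> * (1 + Re (z * iexp (L \<omega>)))) * iexp (\<theta> * X \<omega>)) =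
         (CLINT \<omega>|m. indicator E \<omega> * iexp (\<theta> * X \<omega> + 0)) + (z/2 * (CLINT \<omega>|m. indicator E \<omega> * iexp (\<theta> * X \<omega> + L \<omega>))
           + cnj z/2 * (CLINT \<omega>|m. indicator E \<omega> * iexp (\<theta> * X \<omega> + (- 1 * L \<omega> + 0))))" 
        if "finite_measure m" "sets m = sets m1" for m \<theta>
      proof -
        have E': "E \<in> sets m1" by measurable
        note i = I[OF that E' l1(1)[of \<theta>]] I[OF that E' l1(2)[of \<theta>]] I[OF that E' l1(3)[of \<theta>]]
        show ?thesis unfolding ex
          by (rule integral_add_mult_mult) (rule i)+
      qed
      show "(CLINT \<omega>|m1. complex_of_real (indicator E \<omega> * (1 + Re (z * iexp (L \<omega>)))) * iexp (\<theta> * X \<omega>)) =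
         (CLINT \<omega>|m2. complex_of_real (indicator E \<omega> * (1 + Re (z * iexp (L \<omega>)))) * iexp (\<theta> * X \<omega>))" for \<theta>
        unfolding ex2[OF fin(1) refl] ex2[OF fin(2) sets[symmetric]]
        by (simp only: inter.IH[THEN conjunct2, rule_format, OF l1(1)[of \<theta>]]
          inter.IH[THEN conjunct2, rule_format, OF l1(2)[of \<theta>]]
          inter.IH[THEN conjunct2, rule_format, OF l1(3)[of \<theta>]])
    qed (simp_all only: fin sets, measurable)
    have part: "(\<integral>\<omega>. indicator (E \<inter> (X -` B \<inter> space m1)) \<omega> * Re (z * iexp (L \<omega>)) \<partial>m1) =
      (\<integral>\<omega>. indicator (E \<inter> (X -` B \<inter> space m1)) \<omega> * Re (z * iexp (L \<omega>)) \<partial>m2)"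
      if L: "L \<in> V" and z: "norm z \<le> 1" for L z
    proof -
      have [measurable]: "L \<in> borel_measurable m1" using L by auto
      have b: "\<bar>Re (z * iexp (L \<omega>))\<bar> \<le> 1" for \<omega>
        using abs_Re_le_cmod[of "z * iexp (L \<omega>)"] z by (simp add: norm_mult)
      \<comment> \<open>The weight for z = 0 is the plain indicator; subtracting it from the weight
        for \<open>z\<close> leaves the real part alone.\<close>
      have s: "(\<integral>\<omega>. indicator (E \<inter> (X -` B \<inter> space m1)) \<omega> * Re (z * iexp (L \<omega>)) \<partial>m) =
         (\<integral>\<omega>. indicator E \<omega> * (1 + Re (z * iexp (L \<omega>))) * indicator B (X \<omega>) \<partial>m) -
         (\<integral>\<omega>. indicator E \<omega> * (1 + Re (0 * iexp (L \<omega>))) * indicator B (X \<omega>) \<partial>m)"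
        if "finite_measure m" "sets m = sets m1" for m
      proof -
        interpret finite_measure m by fact
        have [measurable_cong]: "sets m = sets m1" by fact
        have *: "integrable m (\<lambda>\<omega>. indicator E \<omega> * (1 + Re (w * iexp (L \<omega>))) * indicator B (X \<omega>))"
          if "norm w \<le> 1" for w
        proof (rule integrable_const_bound[of _ 2], rule AE_I2)
          fix \<omega>
          have b: "\<bar>Re (w * iexp (L \<omega>))\<bar> \<le> 1"
            using abs_Re_le_cmod[of "w * iexp (L \<omega>)"] that by (simp add: norm_mult)
          show "norm (indicator E \<omega> * (1 + Re (w * iexp (L \<omega>))) * indicator B (X \<omega>)) \<le> 2"
            using b by (auto simp: indicator_def simp del: times_complex.sel)
        qed measurable
        show ?thesis
          unfolding Bochner_Integration.integral_diff[OF *[OF z] *[of 0, simplified norm_zero, OF zero_le_one], symmetric]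
          by (rule Bochner_Integration.integral_cong)
            (simp_all add: indicator_def sets_eq_imp_space_eq[OF that(2)] del: times_complex.sel)
      qed
      show ?thesis
        using main[OF L z] main[OF L, of 0] unfolding s[OF fin(1) refl] s[OF fin(2) sets[symmetric]] by simp
    qed
    show ?case
    proof (intro conjI ballI M)
      fix L assume L: "L \<in> V"
      let ?E = "E \<inter> (X -` B \<inter> space m1)"
      \<comment> \<open>Since Re (- \<i> w) = Im w, the two values 1 and - \<i> of \<open>z\<close>
        in \<open>part\<close> determine the complex integral.\<close>
      have dec: "(CLINT \<omega>|m. indicator ?E \<omega> * iexp (L \<omega>)) = 
          Complex (\<integral>\<omega>. indicator ?E \<omega> * Re (1 * iexp (L \<omega>)) \<partial>m) (\<integral>\<omega>. indicator ?E \<omega> * Re (- \<i> * iexp (L \<omega>)) \<partial>m)"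
        if "finite_measure m" "sets m = sets m1" for m
      proof (rule complex_eqI)
        show "Re (CLINT \<omega>|m. indicator ?E \<omega> * iexp (L \<omega>)) = Re (Complex (\<integral>\<omega>. indicator ?E \<omega> * Re (1 * iexp (L \<omega>)) \<partial>m) (\<integral>\<omega>. indicator ?E \<omega> * Re (- \<i> * iexp (L \<omega>)) \<partial>m))"
          unfolding integral_Re[OF I[OF that M L], symmetric] complex.sel
          by (rule Bochner_Integration.integral_cong) (simp_all add: indicator_def)
        show "Im (CLINT \<omega>|m. indicator ?E \<omega> * iexp (L \<omega>)) = Im (Complex (\<integral>\<omega>. indicator ?E \<omega> * Re (1 * iexp (L \<omega>)) \<partial>m) (\<integral>\<omega>. indicator ?E \<omega> * Re (- \<i> * iexp (L \<omega>)) \<partial>m))"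
          unfolding integral_Im[OF I[OF that M L], symmetric] complex.sel
          by (rule Bochner_Integration.integral_cong) (simp_all add: indicator_def)
      qed
      show "(CLINT \<omega>|m1. indicator ?E \<omega> * iexp (L \<omega>)) = (CLINT \<omega>|m2. indicator ?E \<omega> * iexp (L \<omega>))"
        unfolding dec[OF fin(1) refl] dec[OF fin(2) sets[symmetric]]
        using part[OF L, of 1] part[OF L, of "-\<i>"] by simp
    qed
  qed
  note r = this
  from r have E': "E \<in> sets m1" by (rule conjunct1)
  \<comment> \<open>At the zero function the exponential is 1 and only the measure of
    \<open>E\<close> is left.\<close>
  have e: "(CLINT \<omega>|m1. indicator E \<omega> * iexp 0) = (CLINT \<omega>|m2. indicator E \<omega> * iexp 0)"
    using bspec[OF conjunct2[OF r] zero] .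
  have "(CLINT \<omega>|m. indicator E \<omega> * iexp 0) = complex_of_real (measure m E)"
    if "finite_measure m" "E \<in> sets m" for m
  proof -
    interpret finite_measure m by fact
    have "(CLINT \<omega>|m. indicator E \<omega> * iexp 0) = (CLINT \<omega>|m. complex_of_real (indicator E \<omega>))"
      by (simp add: of_real_indicator)
    also have "\<dots> = complex_of_real (\<integral>\<omega>. indicator E \<omega> \<partial>m)"
      using that by (intro integral_of_real) (simp add: less_top[symmetric])
    finally show ?thesis using that(2) by (simp add: sets.Int_space_eq2)
  qed
  from this[OF fin(1)] this[OF fin(2)] e E' sets have "complex_of_real (measure m1 E) = complex_of_real (measure m2 E)"
    by metis
  with E' show ?thesis by (simp only: of_real_eq_iff conj.left_neutral simp_thms)
qed

text \<open>The pi-lambda theorem for cylinders together with the sets that are null for both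
  measures. The null sets belong to the generator because the noise filtration is augmented by them;
  intersecting with a measurable set keeps them null, so the union remains
  intersection-stable.\<close>

lemma measure_eq_on_generated:
  fixes m1 m2 :: "'w measure" and V :: "('w \<Rightarrow> real) set"
  assumes fin: "finite_measure m1" "finite_measure m2" and sets: "sets m1 = sets m2"
    and meas: "V \<subseteq> borel_measurable m1"
    and zero: "(\<lambda>_. 0) \<in> V"
    and lin: "\<And>X L \<theta>. X \<in> V \<Longrightarrow> L \<in> V \<Longrightarrow> (\<lambda>\<omega>. \<theta> * X \<omega> + L \<omega>) \<in> V"
    and eq: "\<And>L. L \<in> V \<Longrightarrow> (CLINT \<omega>|m1. iexp (L \<omega>)) = (CLINT \<omega>|m2. iexp (L \<omega>))"
    and G: "G \<subseteq> {X -` B \<inter> space m1 | X B. X \<in> V \<and> B \<in> sets borel} \<union> (null_sets m1 \<inter> null_sets m2)"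
    and E: "E \<in> sigma_sets (space m1) G"
  shows "E \<in> sets m1 \<and> measure m1 E = measure m2 E"
proof -
  let ?H = "cylinders (space m1) V \<union> (null_sets m1 \<inter> null_sets m2)"
  interpret m1: finite_measure m1 by fact
  interpret m2: finite_measure m2 by fact
  have cyl: "A \<in> sets m1 \<and> measure m1 A = measure m2 A" if "A \<in> cylinders (space m1) V" for A
    by (rule measure_eq_on_cylinders[OF fin sets meas zero _ _ that]) (fact lin eq)+
  have sub: "?H \<subseteq> Pow (space m1)"
  proof
    fix A assume "A \<in> ?H"
    then have "A \<in> sets m1" using cyl by auto
    then show "A \<in> Pow (space m1)" using sets.sets_into_space by blast
  qed
  have st: "Int_stable ?H"
  proof (rule Int_stableI)
    fix a b assume ab: "a \<in> ?H" "b \<in> ?H"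
    show "a \<inter> b \<in> ?H"
    proof (cases "a \<in> cylinders (space m1) V \<and> b \<in> cylinders (space m1) V")
      case True then show ?thesis by (auto intro: cylinders_Int)
    next
      case False
      have s: "a \<in> sets m1" "b \<in> sets m1" "a \<in> sets m2" "b \<in> sets m2" 
        using ab cyl sets by auto
      from False ab have "a \<in> null_sets m1 \<inter> null_sets m2 \<or> b \<in> null_sets m1 \<inter> null_sets m2" by auto
      then show ?thesis using s by (auto intro: null_set_Int1 null_set_Int2)
    qed
  qed
  have "E \<in> sigma_sets (space m1) ?H"
  proof -
    have "G \<subseteq> ?H"
    proof
      fix x assume "x \<in> G"
      then consider X B where "x = X -` B \<inter> space m1" "X \<in> V" "B \<in> sets borel" | "x \<in> null_sets m1 \<inter> null_sets m2"
        using G by blast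
      then show "x \<in> ?H"
      proof cases
        case 1
        then have "space m1 \<inter> (X -` B \<inter> space m1) \<in> cylinders (space m1) V"
          by (intro cylinders.intros)
        with 1 show ?thesis by (simp add: Int_absorb1)
      qed auto
    qed
    with E show ?thesis using sigma_sets_mono' by blast
  qed
  with st sub show ?thesis
  proof (induction rule: sigma_sets_induct_disjoint)
    case (basic A)
    then show ?case using cyl by (auto simp: null_sets_def measure_def)
  next
    case empty show ?case by simp
  next
    case (compl A)
    have "measure m1 (space m1) = measure m2 (space m1)"
      using cyl[OF cylinders.space] by auto
    with compl show ?case
      using sets sets_eq_imp_space_eq[OF sets] m1.finite_measure_compl m2.finite_measure_compl by auto
  next
    case (union A)
    then have A: "A i \<in> sets m1" "A i \<in> sets m2" and e: "measure m1 (A i) = measure m2 (A i)" for i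
      using sets by auto
    have "(\<lambda>i. measure m1 (A i)) sums measure m1 (\<Union>i. A i)"
      using A union(1) by (intro m1.finite_measure_UNION) auto
    moreover have "(\<lambda>i. measure m2 (A i)) sums measure m2 (\<Union>i. A i)"
      using A union(1) by (intro m2.finite_measure_UNION) auto
    ultimately show ?case using A by (auto simp: e sums_unique2)
  qed
qed

section \<open>Gaussian variables orthogonal to the past\<close>

text \<open>The degenerate variable 0 satisfies the same formulas with variance 0; a nondegenerate
  one is rescaled to the standard normal distribution.\<close>

lemma centered_gaussian_facts:
  assumes "prob_space M" and X: "centered_gaussian M X"
  shows "X \<in> borel_measurable M" "integrable M (\<lambda>\<omega>. (X \<omega>)\<^sup>2)"
    "integral\<^sup>L M X = 0"
    "(CLINT \<omega>|M. iexp (X \<omega>)) = complex_of_real (exp (- (\<integral>\<omega>. (X \<omega>)\<^sup>2 \<partial>M) / 2))"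
proof -
  interpret prob_space M by fact
  from X show m [measurable]: "X \<in> borel_measurable M" by (simp add: centered_gaussian_def)
  from X consider "AE \<omega> in M. X \<omega> = 0" | \<sigma> where "\<sigma> > 0" "distributed M lborel X (normal_density 0 \<sigma>)"
    by (auto simp: centered_gaussian_def)
  then have "integrable M (\<lambda>\<omega>. (X \<omega>)\<^sup>2) \<and> integral\<^sup>L M X = 0 \<and>
    (CLINT \<omega>|M. iexp (X \<omega>)) = complex_of_real (exp (- (\<integral>\<omega>. (X \<omega>)\<^sup>2 \<partial>M) / 2))"
  proof cases
    case 1
    have "integrable M (\<lambda>\<omega>. (X \<omega>)\<^sup>2) \<longleftrightarrow> integrable M (\<lambda>\<omega>. 0::real)"
      by (rule integrable_cong_AE) (use 1 in auto)
    moreover have "(\<integral>\<omega>. (X \<omega>)\<^sup>2 \<partial>M) = (\<integral>\<omega>. 0 \<partial>M)"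
      by (rule integral_cong_AE) (use 1 in auto)
    moreover have "(\<integral>\<omega>. X \<omega> \<partial>M) = (\<integral>\<omega>. 0 \<partial>M)"
      by (rule integral_cong_AE) (use 1 in auto)
    moreover have "(CLINT \<omega>|M. iexp (X \<omega>)) = (CLINT \<omega>|M. 1)"
      by (rule integral_cong_AE) (use 1 in auto)
    ultimately show ?thesis by (simp add: prob_space)
  next
    case 2
    have ex: "expectation X = 0" by (rule normal_distributed_expectation[OF 2])
    have var: "(\<integral>\<omega>. (X \<omega>)\<^sup>2 \<partial>M) = \<sigma>\<^sup>2" 
      using normal_distributed_variance[OF 2] ex by simp
    have int: "integrable M (\<lambda>\<omega>. (X \<omega>)\<^sup>2)"
      using integrable_normal_moment[OF 2(1), of 0 2]
      by (subst distributed_integrable[OF 2(2), symmetric]) auto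
    have d: "distributed M lborel (\<lambda>\<omega>. X \<omega> / \<sigma>) std_normal_density"
      using normal_standard_normal_convert[OF 2(1), of X 0] 2 by simp
    have "(CLINT \<omega>|M. iexp (X \<omega>)) = char (distr M lborel (\<lambda>\<omega>. X \<omega> / \<sigma>)) \<sigma>"
      unfolding char_def using 2(1) by (subst integral_distr) auto
    also have "\<dots> = char std_normal_distribution \<sigma>"
      using distributed_distr_eq_density[OF d] by simp
    finally show ?thesis using ex var int char_std_normal_distribution by simp
  qed
  then show "integrable M (\<lambda>\<omega>. (X \<omega>)\<^sup>2)" "integral\<^sup>L M X = 0"
    "(CLINT \<omega>|M. iexp (X \<omega>)) = complex_of_real (exp (- (\<integral>\<omega>. (X \<omega>)\<^sup>2 \<partial>M) / 2))" by auto
qed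

lemma abs_mult_le_sum_squares: "\<bar>x * y\<bar> \<le> x\<^sup>2 + y\<^sup>2" for x y :: real
proof -
  have "2 * (\<bar>x\<bar> * \<bar>y\<bar>) \<le> x\<^sup>2 + y\<^sup>2"
    using sum_squares_bound[of "\<bar>x\<bar>" "\<bar>y\<bar>"] by simp
  moreover have "0 \<le> x\<^sup>2 + y\<^sup>2" by simp
  ultimately show ?thesis unfolding abs_mult by linarith
qed

lemma integrable_mult_L2:
  fixes X Y :: "'w \<Rightarrow> real"
  assumes [measurable]: "X \<in> borel_measurable M" "Y \<in> borel_measurable M"
    and i: "integrable M (\<lambda>\<omega>. (X \<omega>)\<^sup>2)" "integrable M (\<lambda>\<omega>. (Y \<omega>)\<^sup>2)"
  shows "integrable M (\<lambda>\<omega>. X \<omega> * Y \<omega>)"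
proof (rule Bochner_Integration.integrable_bound)
  show "integrable M (\<lambda>\<omega>. (X \<omega>)\<^sup>2 + (Y \<omega>)\<^sup>2)" using i by simp
  show "AE \<omega> in M. norm (X \<omega> * Y \<omega>) \<le> norm ((X \<omega>)\<^sup>2 + (Y \<omega>)\<^sup>2)"
    using abs_mult_le_sum_squares by auto
qed measurable

text \<open>Orthogonality makes the characteristic function of \<open>\<plusminus>U + L\<close> factorize. Hence the measures with
  density \<open>1 + Re (z iexp U)\<close> and with its constant expectation as density agree on the
  sigma-algebra generated by \<open>V\<close>; the values 1 and \<open>-\<i>\<close> of \<open>z\<close> give real and imaginary part.\<close>

lemma orthogonal_gaussian_char:
  fixes M :: "'w measure" and V :: "('w \<Rightarrow> real) set"
  assumes "prob_space M"
    and gauss: "\<And>L \<theta>. L \<in> V \<Longrightarrow> centered_gaussian M (\<lambda>\<omega>. \<theta> * U \<omega> + L \<omega>)"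
    and zero: "(\<lambda>_. 0) \<in> V"
    and lin: "\<And>X L \<theta>. X \<in> V \<Longrightarrow> L \<in> V \<Longrightarrow> (\<lambda>\<omega>. \<theta> * X \<omega> + L \<omega>) \<in> V"
    and orth: "\<And>L. L \<in> V \<Longrightarrow> (\<integral>\<omega>. L \<omega> * U \<omega> \<partial>M) = 0"
    and G: "G \<subseteq> {X -` B \<inter> space M | X B. X \<in> V \<and> B \<in> sets borel} \<union> null_sets M"
    and E: "E \<in> sigma_sets (space M) G"
  shows "E \<in> sets M" "(CLINT \<omega>|M. indicator E \<omega> * iexp (U \<omega>)) = complex_of_real (measure M E) * (CLINT \<omega>|M. iexp (U \<omega>))"
proof -
  interpret prob_space M by fact
  note cg = centered_gaussian_facts[OF \<open>prob_space M\<close>]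
  have gU: "centered_gaussian M U" using gauss[OF zero, of 1] by simp
  note mU [measurable] = cg(1)[OF gU]
  define a where "a = exp (- (\<integral>\<omega>. (U \<omega>)\<^sup>2 \<partial>M) / 2)"
  have chU: "(CLINT \<omega>|M. iexp (U \<omega>)) = complex_of_real a" unfolding a_def by (rule cg(4)[OF gU])
  have a: "0 \<le> a" "a \<le> 1" by (simp_all add: a_def)
  have gL: "centered_gaussian M L" if "L \<in> V" for L using gauss[OF that, of 0] by simp
  have mV [measurable]: "L \<in> borel_measurable M" if "L \<in> V" for L using cg(1)[OF gL[OF that]] .
  \<comment> \<open>A centered Gaussian characteristic function depends only on the variance, and
    variances of orthogonal summands add. The signs 1 and -1 of \<theta> belong to an exponential
    and its conjugate.\<close>
  have ch: "(CLINT \<omega>|M. iexp (\<theta> * U \<omega> + L \<omega>)) = complex_of_real a * (CLINT \<omega>|M. iexp (L \<omega>))"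
    if L: "L \<in> V" and \<theta>: "\<theta>\<^sup>2 = 1" for L \<theta>
  proof -
    note i = integrable_mult_L2[OF mV[OF L] mU cg(2)[OF gL[OF L]] cg(2)[OF gU]]
    have "(\<integral>\<omega>. (\<theta> * U \<omega> + L \<omega>)\<^sup>2 \<partial>M) = (\<integral>\<omega>. (U \<omega>)\<^sup>2 + ((L \<omega>)\<^sup>2 + 2 * \<theta> * (L \<omega> * U \<omega>)) \<partial>M)"
      by (intro Bochner_Integration.integral_cong) (auto simp: power2_sum power_mult_distrib \<theta>)
    also have "\<dots> = (\<integral>\<omega>. (U \<omega>)\<^sup>2 \<partial>M) + (\<integral>\<omega>. (L \<omega>)\<^sup>2 \<partial>M)"
      using i cg(2)[OF gL[OF L]] cg(2)[OF gU] orth[OF L] by simp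
    finally have v: "(\<integral>\<omega>. (\<theta> * U \<omega> + L \<omega>)\<^sup>2 \<partial>M) = (\<integral>\<omega>. (U \<omega>)\<^sup>2 \<partial>M) + (\<integral>\<omega>. (L \<omega>)\<^sup>2 \<partial>M)" .
    show ?thesis unfolding cg(4)[OF gauss[OF L]] cg(4)[OF gL[OF L]] v a_def 
      by (simp add: exp_add[symmetric] add_divide_distrib flip: of_real_mult of_real_add)
  qed
  have "E \<in> sets M \<and> (\<integral>\<omega>. indicator E \<omega> * Re (z * iexp (U \<omega>)) \<partial>M) = measure M E * (Re z * a)"
    if z: "norm z \<le> 1" for z
  proof -
    have b: "\<bar>Re (z * iexp (U \<omega>))\<bar> \<le> 1" for \<omega>
      using abs_Re_le_cmod[of "z * iexp (U \<omega>)"] z by (simp add: norm_mult)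
    have b': "\<bar>Re z * a\<bar> \<le> 1"
      using abs_Re_le_cmod[of z] z a by (simp add: abs_mult mult_le_one)
    define f where "f \<omega> = 1 + Re (z * iexp (U \<omega>))" for \<omega>
    have f [measurable]: "f \<in> borel_measurable M" unfolding f_def by measurable
    have f0: "0 \<le> f \<omega>" "f \<omega> \<le> 2" for \<omega> using b[of \<omega>] unfolding f_def by linarith+
    have c0: "0 \<le> 1 + Re z * a" using b' by linarith
    let ?m1 = "density M f" and ?m2 = "density M (\<lambda>_. 1 + Re z * a)"
    have fi: "integrable M (\<lambda>\<omega>. indicator A \<omega> * f \<omega>)" if "A \<in> sets M" for A
      using that f0 by (intro integrable_const_bound[of _ 2]) (auto simp: indicator_def)
    have m1: "measure ?m1 A = (\<integral>\<omega>. indicator A \<omega> * f \<omega> \<partial>M)" if [measurable]: "A \<in> sets M" for A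
    proof -
      have "emeasure ?m1 A = (\<integral>\<^sup>+\<omega>. ennreal (indicator A \<omega> * f \<omega>) \<partial>M)"
        by (subst emeasure_density) (auto intro!: nn_integral_cong simp: indicator_def)
      also have "\<dots> = ennreal (\<integral>\<omega>. indicator A \<omega> * f \<omega> \<partial>M)"
        using fi f0 by (intro nn_integral_eq_integral) auto
      finally show ?thesis using f0 by (simp add: measure_def integral_nonneg)
    qed
    have em2: "emeasure ?m2 A = ennreal (1 + Re z * a) * emeasure M A" if "A \<in> sets M" for A
      using that by (simp add: emeasure_density_const)
    have "E \<in> sets ?m1 \<and> measure ?m1 E = measure ?m2 E"
    proof (rule measure_eq_on_generated[where V=V and G=G])
      have "emeasure ?m1 (space M) = (\<integral>\<^sup>+\<omega>. ennreal (indicator (space M) \<omega> * f \<omega>) \<partial>M)"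
        by (subst emeasure_density) (auto intro!: nn_integral_cong simp: indicator_def)
      also have "\<dots> = ennreal (\<integral>\<omega>. indicator (space M) \<omega> * f \<omega> \<partial>M)"
        using fi f0 by (intro nn_integral_eq_integral) auto
      finally have "emeasure ?m1 (space M) < \<infinity>" by simp
      then show "finite_measure ?m1" by (intro finite_measureI) simp
      show "finite_measure ?m2"
        by (intro finite_measureI) (simp add: em2 emeasure_space_1)
      show "(CLINT \<omega>|?m1. iexp (L \<omega>)) = (CLINT \<omega>|?m2. iexp (L \<omega>))" if L: "L \<in> V" for L
      proof -
        have [measurable]: "L \<in> borel_measurable M" using L by auto
        have ii: "complex_integrable M (\<lambda>\<omega>. iexp (h \<omega>))" if [measurable]: "h \<in> borel_measurable M" for h
          by (rule integrable_const_bound[of _ 1]) auto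
        have "(CLINT \<omega>|?m1. iexp (L \<omega>)) = (CLINT \<omega>|M. complex_of_real (f \<omega>) * iexp (L \<omega>))"
          using f0 by (subst integral_density) (auto simp: scaleR_conv_of_real)
        also have "\<dots> = (CLINT \<omega>|M. iexp (L \<omega>) + (z/2 * iexp (1 * U \<omega> + L \<omega>) + cnj z/2 * iexp (- 1 * U \<omega> + L \<omega>)))"
        proof (rule Bochner_Integration.integral_cong)
          fix \<omega>
          have r: "complex_of_real (Re w) = (w + cnj w) / 2" for w by (simp add: complex_eq_iff)
          have e1: "iexp (1 * p + q) = iexp p * iexp q" for p q by (simp add: exp_add distrib_left)
          have e2: "iexp (- 1 * p + q) = cnj (iexp p) * iexp q" for p q
            by (simp add: exp_cnj right_diff_distrib exp_diff exp_minus divide_inverse)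
          show "complex_of_real (f \<omega>) * iexp (L \<omega>) = iexp (L \<omega>) + (z/2 * iexp (1 * U \<omega> + L \<omega>) + cnj z/2 * iexp (- 1 * U \<omega> + L \<omega>))"
            unfolding e1 e2 unfolding f_def of_real_add r by (simp add: algebra_simps add_divide_distrib)
        qed simp
        also have "\<dots> = (CLINT \<omega>|M. iexp (L \<omega>)) + (z/2 * (CLINT \<omega>|M. iexp (1 * U \<omega> + L \<omega>)) + cnj z/2 * (CLINT \<omega>|M. iexp (- 1 * U \<omega> + L \<omega>)))"
          by (rule integral_add_mult_mult) (rule ii, measurable)+
        also have "\<dots> = complex_of_real (1 + Re z * a) * (CLINT \<omega>|M. iexp (L \<omega>))"
        proof -
          have m1: "(- 1 :: real)\<^sup>2 = 1" by simp
          have "z + cnj z = complex_of_real (2 * Re z)" by (simp add: complex_eq_iff)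
          moreover have "w + (z/2 * (A * w) + cnj z/2 * (A * w)) = (1 + (z + cnj z) / 2 * A) * w" for w A
            by (simp add: field_simps)
          ultimately have "w + (z/2 * (A * w) + cnj z/2 * (A * w)) = (1 + complex_of_real (Re z) * A) * w" for w A
            by simp
          then show ?thesis 
            unfolding ch[OF L power_one] ch[OF L m1] unfolding of_real_add of_real_mult of_real_1 .
        qed
        also have "\<dots> = (CLINT \<omega>|?m2. iexp (L \<omega>))"
          using c0 by (subst integral_density) (auto simp: scaleR_conv_of_real)
        finally show ?thesis .
      qed
      show "G \<subseteq> {X -` B \<inter> space ?m1 | X B. X \<in> V \<and> B \<in> sets borel} \<union> (null_sets ?m1 \<inter> null_sets ?m2)"
      proof -
        have "null_sets M \<subseteq> null_sets (density M h)" if [measurable]: "h \<in> borel_measurable M" for h :: "'w \<Rightarrow> real"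
          by (rule absolutely_continuousI_density[unfolded absolutely_continuous_def]) measurable
        from this[OF f] this[of "\<lambda>_. 1 + Re z * a"]
        have "null_sets M \<subseteq> null_sets ?m1 \<inter> null_sets ?m2" by (intro Int_greatest) simp_all
        then show ?thesis unfolding space_density by (intro order.trans[OF G] Un_mono order_refl)
      qed
      show "E \<in> sigma_sets (space ?m1) G" using E by simp
    qed (use lin zero mV in \<open>simp_all add: subset_iff\<close>)
    then have E': "E \<in> sets M" and e: "measure ?m1 E = measure ?m2 E" by auto
    have i2: "integrable M (\<lambda>\<omega>. indicator E \<omega> * Re (z * iexp (U \<omega>)))"
      using E' b by (intro integrable_const_bound[of _ 1]) (auto simp: indicator_def simp del: times_complex.sel)
    have "measure ?m1 E = measure M E + (\<integral>\<omega>. indicator E \<omega> * Re (z * iexp (U \<omega>)) \<partial>M)"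
    proof -
      have "(\<integral>\<omega>. indicator E \<omega> * f \<omega> \<partial>M) = (\<integral>\<omega>. indicator E \<omega> + indicator E \<omega> * Re (z * iexp (U \<omega>)) \<partial>M)"
        unfolding f_def by (simp only: distrib_left mult_1_right)
      also have "\<dots> = (\<integral>\<omega>. indicator E \<omega> \<partial>M) + (\<integral>\<omega>. indicator E \<omega> * Re (z * iexp (U \<omega>)) \<partial>M)"
        using i2 E' by (intro Bochner_Integration.integral_add) (simp_all add: less_top[symmetric])
      finally show ?thesis unfolding m1[OF E'] using E' by (simp add: sets.Int_space_eq2)
    qed
    moreover have "measure ?m2 E = measure M E + measure M E * (Re z * a)"
      unfolding measure_def em2[OF E'] enn2real_mult enn2real_ennreal[OF c0] by (simp add: algebra_simps)
    ultimately show ?thesis using e E' by simp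
  qed
  from this[of 1] this[of "-\<i>"] have E': "E \<in> sets M" 
    and R: "(\<integral>\<omega>. indicator E \<omega> * Re (1 * iexp (U \<omega>)) \<partial>M) = measure M E * a"
    and I: "(\<integral>\<omega>. indicator E \<omega> * Re (- \<i> * iexp (U \<omega>)) \<partial>M) = 0"
    by auto
  have i: "complex_integrable M (\<lambda>\<omega>. indicator E \<omega> * iexp (U \<omega>))"
    using E' by (intro integrable_const_bound[of _ 1]) (auto simp: indicator_def norm_mult)
  show "E \<in> sets M" by fact
  show "(CLINT \<omega>|M. indicator E \<omega> * iexp (U \<omega>)) = complex_of_real (measure M E) * (CLINT \<omega>|M. iexp (U \<omega>))"
  proof (rule complex_eqI)
    have "(\<integral>\<omega>. Re (indicator E \<omega> * iexp (U \<omega>)) \<partial>M) = (\<integral>\<omega>. indicator E \<omega> * Re (1 * iexp (U \<omega>)) \<partial>M)"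
      by (rule Bochner_Integration.integral_cong) (simp_all add: indicator_def)
    then show "Re (CLINT \<omega>|M. indicator E \<omega> * iexp (U \<omega>)) = Re (complex_of_real (measure M E) * (CLINT \<omega>|M. iexp (U \<omega>)))"
      unfolding integral_Re[OF i, symmetric] R chU by simp
    have "(\<integral>\<omega>. Im (indicator E \<omega> * iexp (U \<omega>)) \<partial>M) = (\<integral>\<omega>. indicator E \<omega> * Re (- \<i> * iexp (U \<omega>)) \<partial>M)"
      by (rule Bochner_Integration.integral_cong) (simp_all add: indicator_def)
    then show "Im (CLINT \<omega>|M. indicator E \<omega> * iexp (U \<omega>)) = Im (complex_of_real (measure M E) * (CLINT \<omega>|M. iexp (U \<omega>)))"
      unfolding integral_Im[OF i, symmetric] I chU by simp
  qed
qed

text \<open>Restricting the probability to \<open>E\<close>, or scaling it by the probability of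
  \<open>E\<close>, gives two finite measures under which \<open>U\<close> has the same
  characteristic function, hence the same image measure. This is independence of \<open>E\<close>
  and \<open>U\<close> in the form of expectations.\<close>

lemma integral_indicator_times_eqI_char:
  fixes U :: "'w \<Rightarrow> real"
  assumes "prob_space M" and [measurable]: "E \<in> sets M" "U \<in> borel_measurable M" "h \<in> borel_measurable borel"
    and ch: "\<And>\<theta>. (CLINT \<omega>|M. indicator E \<omega> * iexp (\<theta> * U \<omega>)) = complex_of_real (measure M E) * (CLINT \<omega>|M. iexp (\<theta> * U \<omega>))"
  shows "(\<integral>\<omega>. indicator E \<omega> * h (U \<omega>) \<partial>M) = measure M E * (\<integral>\<omega>. (h (U \<omega>) :: real) \<partial>M)"
proof -
  interpret prob_space M by fact
  let ?m1 = "density M (indicator E :: 'w \<Rightarrow> real)" and ?m2 = "density M (\<lambda>_. measure M E)"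
  have "(\<integral>\<omega>. 1 * h (U \<omega>) \<partial>?m1) = (\<integral>\<omega>. 1 * h (U \<omega>) \<partial>?m2)"
  proof (rule integral_eqI_char[where K=1 and g="\<lambda>_. 1" and X=U and h=h])
    have "emeasure ?m1 (space M) = (\<integral>\<^sup>+\<omega>. indicator E \<omega> \<partial>M)"
      by (subst emeasure_density, simp, simp, rule nn_integral_cong, simp add: indicator_def)
    then show "finite_measure ?m1"
      by (intro finite_measureI) (simp add: emeasure_eq_measure)
    show "finite_measure ?m2"
      by (rule finite_measureI) (auto simp: emeasure_density_const emeasure_space_1)
    show "(CLINT \<omega>|?m1. complex_of_real 1 * iexp (\<theta> * U \<omega>)) = (CLINT \<omega>|?m2. complex_of_real 1 * iexp (\<theta> * U \<omega>))" for \<theta>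
    proof -
      have "(CLINT \<omega>|?m1. complex_of_real 1 * iexp (\<theta> * U \<omega>)) = (CLINT \<omega>|M. indicator E \<omega> * iexp (\<theta> * U \<omega>))"
        by (subst integral_density) (auto simp: scaleR_conv_of_real of_real_indicator)
      also have "\<dots> = (CLINT \<omega>|?m2. complex_of_real 1 * iexp (\<theta> * U \<omega>))"
        unfolding ch by (subst integral_density) (auto simp: scaleR_conv_of_real)
      finally show ?thesis .
    qed
  qed auto
  then show ?thesis
    by (simp add: integral_density)
qed

section \<open>Increments of the noise\<close>

text \<open>This is the vector space that plays the role of \<open>V\<close> above. The finite sums
  have the shape in which \<open>centered_gaussian_process\<close> asserts Gaussianity, so every
  element is centered Gaussian when the indices are admissible.\<close>

definition noise_span :: "(real \<Rightarrow> real set \<Rightarrow> 'w \<Rightarrow> real) \<Rightarrow> (real \<times> real set) set \<Rightarrow> ('w \<Rightarrow> real) set" where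
  "noise_span W T = {(\<lambda>\<omega>. \<Sum>i\<in>J. c i * W (fst i) (snd i) \<omega>) | J c. finite J \<and> J \<subseteq> T}"

lemma noise_spanI: "finite J \<Longrightarrow> J \<subseteq> T \<Longrightarrow> (\<lambda>\<omega>. \<Sum>i\<in>J. c i * W (fst i) (snd i) \<omega>) \<in> noise_span W T"
  by (auto simp: noise_span_def)

lemma noise_span_zero: "(\<lambda>_. 0) \<in> noise_span W T"
  using noise_spanI[of "{}" T "\<lambda>_. 0" W] by simp

lemma noise_span_mono: "T \<subseteq> T' \<Longrightarrow> noise_span W T \<subseteq> noise_span W T'"
  by (force simp: noise_span_def)

lemma noise_span_base: "(t, A) \<in> T \<Longrightarrow> W t A \<in> noise_span W T"
  using noise_spanI[of "{(t, A)}" T "\<lambda>_. 1" W] by simp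

lemma noise_span_lin:
  assumes "X \<in> noise_span W T" "Y \<in> noise_span W T"
  shows "(\<lambda>\<omega>. \<theta> * X \<omega> + Y \<omega>) \<in> noise_span W T"
proof -
  obtain J c where X: "X = (\<lambda>\<omega>. \<Sum>i\<in>J. c i * W (fst i) (snd i) \<omega>)" and J: "finite J" "J \<subseteq> T"
    using assms(1) by (auto simp: noise_span_def)
  obtain K d where Y: "Y = (\<lambda>\<omega>. \<Sum>i\<in>K. d i * W (fst i) (snd i) \<omega>)" and K: "finite K" "K \<subseteq> T"
    using assms(2) by (auto simp: noise_span_def)
  have ext: "(\<Sum>i\<in>A. e i * W (fst i) (snd i) \<omega>) = (\<Sum>i\<in>J \<union> K. (if i \<in> A then e i else 0) * W (fst i) (snd i) \<omega>)"
    if "A \<subseteq> J \<union> K" for A e \<omega>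
    using that J K by (intro sum.mono_neutral_cong_left) auto
  have "(\<lambda>\<omega>. \<theta> * X \<omega> + Y \<omega>) = (\<lambda>\<omega>. \<Sum>i\<in>J \<union> K. (\<theta> * (if i \<in> J then c i else 0) + (if i \<in> K then d i else 0)) * W (fst i) (snd i) \<omega>)"
    unfolding X Y ext[of J, OF Un_upper1] ext[of K, OF Un_upper2]
    by (simp add: sum_distrib_left distrib_right mult.assoc flip: sum.distrib)
  then show ?thesis using J K by (auto intro!: noise_spanI)
qed

lemma noise_span_add: "X \<in> noise_span W T \<Longrightarrow> Y \<in> noise_span W T \<Longrightarrow> (\<lambda>\<omega>. X \<omega> + Y \<omega>) \<in> noise_span W T"
  using noise_span_lin[of X W T Y 1] by simp

lemma noise_span_scale: "X \<in> noise_span W T \<Longrightarrow> (\<lambda>\<omega>. \<theta> * X \<omega>) \<in> noise_span W T"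
  using noise_span_lin[OF _ noise_span_zero, of X W T \<theta>] by simp

lemma noise_span_diff: "X \<in> noise_span W T \<Longrightarrow> Y \<in> noise_span W T \<Longrightarrow> (\<lambda>\<omega>. X \<omega> - Y \<omega>) \<in> noise_span W T"
  using noise_span_lin[of Y W T X "-1"] by simp

lemma iexp_lipschitz: "cmod (iexp x - iexp y) \<le> \<bar>x - y\<bar>"
proof -
  have "cmod (iexp x - iexp y) = cmod (iexp y * (iexp (x - y) - 1))"
    by (simp add: algebra_simps flip: exp_add)
  also have "\<dots> = cmod (iexp (x - y) - 1)" unfolding norm_mult by simp
  also have "\<dots> \<le> \<bar>x - y\<bar>" using iexp_approx1[of "x - y" 0] by simp
  finally show ?thesis .
qed

locale space_time_noise = prob_space M for M :: "'w measure" +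
  fixes W :: "real \<Rightarrow> real set \<Rightarrow> 'w \<Rightarrow> real"
  assumes noise: "space_time_white_noise M W"
begin

abbreviation all_indices :: "(real \<times> real set) set" where
  "all_indices \<equiv> {0..} \<times> finite_borel_sets"

abbreviation past_indices :: "real \<Rightarrow> (real \<times> real set) set" where
  "past_indices a \<equiv> {0..a} \<times> finite_borel_sets"

lemma span_gaussian: "X \<in> noise_span W all_indices \<Longrightarrow> centered_gaussian M X"
  using noise unfolding space_time_white_noise_def centered_gaussian_process_def noise_span_def
  by (auto simp: case_prod_beta)

lemmas span_measurable = centered_gaussian_facts(1)[OF prob_space_axioms span_gaussian]
lemmas span_square_integrable = centered_gaussian_facts(2)[OF prob_space_axioms span_gaussian]
lemmas span_mean = centered_gaussian_facts(3)[OF prob_space_axioms span_gaussian]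

lemma span_integrable_mult:
  "X \<in> noise_span W all_indices \<Longrightarrow> Y \<in> noise_span W all_indices \<Longrightarrow> integrable M (\<lambda>\<omega>. X \<omega> * Y \<omega>)"
  by (intro integrable_mult_L2 span_measurable span_square_integrable)

lemma noise_in_span: "0 \<le> t \<Longrightarrow> A \<in> finite_borel_sets \<Longrightarrow> W t A \<in> noise_span W all_indices"
  by (rule noise_span_base) auto

lemma noise_measurable: "0 \<le> t \<Longrightarrow> A \<in> finite_borel_sets \<Longrightarrow> W t A \<in> borel_measurable M"
  by (intro span_measurable noise_in_span)

lemma noise_covariance:
  "0 \<le> t \<Longrightarrow> 0 \<le> s \<Longrightarrow> A \<in> finite_borel_sets \<Longrightarrow> B \<in> finite_borel_sets \<Longrightarrow>
    (\<integral>\<omega>. W t A \<omega> * W s B \<omega> \<partial>M) = min t s * measure lborel (A \<inter> B)"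
  using noise by (auto simp: space_time_white_noise_def)

definition incr :: "real \<Rightarrow> real \<Rightarrow> real set \<Rightarrow> 'w \<Rightarrow> real" where
  "incr a b A \<omega> = W b A \<omega> - W a A \<omega>"

lemma incr_in_span: "0 \<le> a \<Longrightarrow> 0 \<le> b \<Longrightarrow> A \<in> finite_borel_sets \<Longrightarrow> incr a b A \<in> noise_span W all_indices"
  unfolding incr_def[abs_def] by (intro noise_span_diff noise_in_span)

text \<open>A common starting time is enough: increments that start at different times are cut until
  the overlapping pieces start together.\<close>

lemma incr_covariance:
  assumes "0 \<le> a" "a \<le> b" "a \<le> d" "A \<in> finite_borel_sets" "B \<in> finite_borel_sets"
  shows "(\<integral>\<omega>. incr a b A \<omega> * incr a d B \<omega> \<partial>M) = (min b d - a) * measure lborel (A \<inter> B)"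
proof -
  have i: "integrable M (\<lambda>\<omega>. W s A \<omega> * W t B \<omega>)" if "0 \<le> s" "0 \<le> t" for s t
    using that assms by (intro span_integrable_mult noise_in_span)
  have "(\<integral>\<omega>. incr a b A \<omega> * incr a d B \<omega> \<partial>M) =
    (\<integral>\<omega>. (W b A \<omega> * W d B \<omega> - W b A \<omega> * W a B \<omega>) - (W a A \<omega> * W d B \<omega> - W a A \<omega> * W a B \<omega>) \<partial>M)"
    by (rule Bochner_Integration.integral_cong) (auto simp: incr_def algebra_simps)
  also have "\<dots> = ((\<integral>\<omega>. W b A \<omega> * W d B \<omega> \<partial>M) - (\<integral>\<omega>. W b A \<omega> * W a B \<omega> \<partial>M)) -
      ((\<integral>\<omega>. W a A \<omega> * W d B \<omega> \<partial>M) - (\<integral>\<omega>. W a A \<omega> * W a B \<omega> \<partial>M))"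
    using assms by (simp add: i)
  also have "\<dots> = (min b d - a) * measure lborel (A \<inter> B)"
    using assms by (simp add: noise_covariance left_diff_distrib min_absorb1 min_absorb2)
  finally show ?thesis .
qed

text \<open>For s \<le> a both \<open>min s b\<close> and \<open>min s a\<close> equal
  \<open>s\<close>, so the two covariances in each summand cancel.\<close>

lemma incr_orthogonal_past:
  assumes "0 \<le> a" "a \<le> b" "A \<in> finite_borel_sets" and L: "L \<in> noise_span W (past_indices a)"
  shows "(\<integral>\<omega>. L \<omega> * incr a b A \<omega> \<partial>M) = 0"
proof -
  obtain J c where L: "L = (\<lambda>\<omega>. \<Sum>i\<in>J. c i * W (fst i) (snd i) \<omega>)" and J: "finite J" "J \<subseteq> past_indices a"
    using L by (auto simp: noise_span_def)
  have i: "integrable M (\<lambda>\<omega>. W (fst i) (snd i) \<omega> * W t A \<omega>)" if "0 \<le> t" "i \<in> J" for t i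
    using that assms J by (intro span_integrable_mult noise_in_span) auto
  have "(\<integral>\<omega>. L \<omega> * incr a b A \<omega> \<partial>M) = (\<integral>\<omega>. (\<Sum>i\<in>J. c i * (W (fst i) (snd i) \<omega> * W b A \<omega> - W (fst i) (snd i) \<omega> * W a A \<omega>)) \<partial>M)"
    by (rule Bochner_Integration.integral_cong) (auto simp: L incr_def sum_distrib_right right_diff_distrib mult.assoc sum_subtractf)
  also have "\<dots> = (\<Sum>i\<in>J. c i * ((\<integral>\<omega>. W (fst i) (snd i) \<omega> * W b A \<omega> \<partial>M) - (\<integral>\<omega>. W (fst i) (snd i) \<omega> * W a A \<omega> \<partial>M)))"
    using i assms by (subst Bochner_Integration.integral_sum) auto
  also have "\<dots> = 0"
  proof (rule sum.neutral, rule ballI)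
    fix i assume "i \<in> J"
    then obtain s B where "i = (s, B)" "0 \<le> s" "s \<le> a" "B \<in> finite_borel_sets" using J by auto
    then show "c i * ((\<integral>\<omega>. W (fst i) (snd i) \<omega> * W b A \<omega> \<partial>M) - (\<integral>\<omega>. W (fst i) (snd i) \<omega> * W a A \<omega> \<partial>M)) = 0"
      using assms by (simp add: noise_covariance)
  qed
  finally show ?thesis .
qed

section \<open>Independence of increments from past events\<close>

lemma natural_events_sets: "natural_events M W t \<subseteq> sets M"
  unfolding natural_events_def
  by (rule sets.sigma_sets_subset) (auto intro!: measurable_sets[OF noise_measurable])

text \<open>The combination of the two increments is orthogonal to the span of the past, and the
  generators of \<open>natural_events\<close> are null sets or preimages under elements of that
  span. Free coefficients \<open>p\<close> and \<open>q\<close> capture the joint law of the two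
  increments.\<close>

lemma natural_event_char:
  assumes "0 \<le> a" "a \<le> b" "a \<le> d" "A \<in> finite_borel_sets" "B \<in> finite_borel_sets"
    and E: "E \<in> natural_events M W a"
  shows "(CLINT \<omega>|M. indicator E \<omega> * iexp (p * incr a b A \<omega> + q * incr a d B \<omega>)) =
    complex_of_real (prob E) * (CLINT \<omega>|M. iexp (p * incr a b A \<omega> + q * incr a d B \<omega>))"
proof (rule orthogonal_gaussian_char(2)[OF prob_space_axioms, where V="noise_span W (past_indices a)"])
  let ?U = "\<lambda>\<omega>. p * incr a b A \<omega> + q * incr a d B \<omega>"
  have sub: "noise_span W (past_indices a) \<subseteq> noise_span W all_indices"
    by (rule noise_span_mono) auto
  have inc: "incr a b A \<in> noise_span W all_indices" "incr a d B \<in> noise_span W all_indices"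
    using assms by (auto intro!: incr_in_span)
  then have U: "?U \<in> noise_span W all_indices"
    by (intro noise_span_add noise_span_scale)
  show "centered_gaussian M (\<lambda>\<omega>. \<theta> * ?U \<omega> + L \<omega>)" if "L \<in> noise_span W (past_indices a)" for L \<theta>
    using that sub by (intro span_gaussian noise_span_lin[OF U]) auto
  show "(\<integral>\<omega>. L \<omega> * ?U \<omega> \<partial>M) = 0" if L: "L \<in> noise_span W (past_indices a)" for L
  proof -
    have L': "L \<in> noise_span W all_indices" using L sub by auto
    have "(\<integral>\<omega>. L \<omega> * ?U \<omega> \<partial>M) = (\<integral>\<omega>. p * (L \<omega> * incr a b A \<omega>) + q * (L \<omega> * incr a d B \<omega>) \<partial>M)"
      by (rule Bochner_Integration.integral_cong) (auto simp: algebra_simps)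
    also have "\<dots> = 0"
      using span_integrable_mult[OF L' inc(1)] span_integrable_mult[OF L' inc(2)] assms L
      by (simp add: incr_orthogonal_past)
    finally show ?thesis .
  qed
  show "E \<in> sigma_sets (space M) ({W s A -` B \<inter> space M | s A B. 0 \<le> s \<and> s \<le> a \<and> A \<in> finite_borel_sets \<and> B \<in> sets borel} \<union> null_sets M)"
    using E by (simp add: natural_events_def)
  show "{W s A -` B \<inter> space M | s A B. 0 \<le> s \<and> s \<le> a \<and> A \<in> finite_borel_sets \<and> B \<in> sets borel} \<union> null_sets M
    \<subseteq> {X -` B \<inter> space M | X B. X \<in> noise_span W (past_indices a) \<and> B \<in> sets borel} \<union> null_sets M"
  proof (rule Un_mono[OF _ order_refl], safe)
    fix s A' B' assume "0 \<le> s" "s \<le> a" "A' \<in> finite_borel_sets" "B' \<in> sets (borel :: real measure)"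
    then show "\<exists>X B. W s A' -` B' \<inter> space M = X -` B \<inter> space M \<and> X \<in> noise_span W (past_indices a) \<and> B \<in> sets borel"
      by (intro exI[of _ "W s A'"] exI[of _ B'] conjI noise_span_base) auto
  qed
qed (auto intro: noise_span_zero noise_span_lin)

text \<open>Nonnegativity of the variance of the absolute value is the Cauchy-Schwarz inequality
  against the constant 1.\<close>

lemma expectation_abs_le_sqrt:
  assumes [measurable]: "X \<in> borel_measurable M" and i: "integrable M (\<lambda>\<omega>. (X \<omega>)\<^sup>2)"
  shows "integrable M X" "(\<integral>\<omega>. \<bar>X \<omega>\<bar> \<partial>M) \<le> sqrt (\<integral>\<omega>. (X \<omega>)\<^sup>2 \<partial>M)"
proof -
  show iX: "integrable M X"
    using integrable_mult_L2[of X M "\<lambda>_. 1"] i by simp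
  have "0 \<le> variance (\<lambda>\<omega>. \<bar>X \<omega>\<bar>)" by (rule variance_positive)
  also have "\<dots> = (\<integral>\<omega>. (X \<omega>)\<^sup>2 \<partial>M) - (\<integral>\<omega>. \<bar>X \<omega>\<bar> \<partial>M)\<^sup>2"
    using variance_eq[of "\<lambda>\<omega>. \<bar>X \<omega>\<bar>"] iX i by simp
  finally show "(\<integral>\<omega>. \<bar>X \<omega>\<bar> \<partial>M) \<le> sqrt (\<integral>\<omega>. (X \<omega>)\<^sup>2 \<partial>M)"
    by (intro real_le_rsqrt) simp
qed

text \<open>The filtration is right-continuous: an event of time \<open>a+\<close> is only known to be independent of the
  increments that start at \<open>a + e\<close>, and \<open>e\<close> tends to 0.\<close>

lemma germ_event_char:
  assumes "0 \<le> a" "a < b" "a < d" "A \<in> finite_borel_sets" "B \<in> finite_borel_sets"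
    and E: "E \<in> (\<Inter>s\<in>{a<..}. natural_events M W s)"
  shows "(CLINT \<omega>|M. indicator E \<omega> * iexp (p * incr a b A \<omega> + q * incr a d B \<omega>)) =
    complex_of_real (prob E) * (CLINT \<omega>|M. iexp (p * incr a b A \<omega> + q * incr a d B \<omega>))"
proof -
  have E' [measurable]: "E \<in> sets M" using E natural_events_sets[of "a + 1"] by auto
  define U where "U e \<omega> = p * incr (a + e) b A \<omega> + q * incr (a + e) d B \<omega>" for e \<omega>
  have Uspan: "U e \<in> noise_span W all_indices" if "0 \<le> e" for e
    unfolding U_def[abs_def] using assms that by (intro noise_span_add noise_span_scale incr_in_span) auto
  define Q where "Q e = (CLINT \<omega>|M. indicator E \<omega> * iexp (U e \<omega>)) - complex_of_real (prob E) * (CLINT \<omega>|M. iexp (U e \<omega>))" for e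
  have Q0: "Q e = 0" if "0 < e" "e \<le> min b d - a" for e
    using natural_event_char[of "a + e" b d A B E p q] that assms by (auto simp: Q_def U_def)
  \<comment> \<open>Moving the start from \<open>a\<close> to \<open>a + e\<close> changes each
    increment by a variable of first absolute moment at most
    \<open>sqrt (e * measure lborel C)\<close>, where \<open>C\<close> is \<open>A\<close> or
    \<open>B\<close>, and \<open>iexp\<close> is 1-Lipschitz. The factor 2 counts the two terms of
    \<open>Q\<close>.\<close>
  let ?r = "\<lambda>e. 2 * (\<bar>p\<bar> * sqrt (e * measure lborel A) + \<bar>q\<bar> * sqrt (e * measure lborel B))"
  have bound: "cmod (Q 0) \<le> ?r e" if e: "0 < e" "e \<le> min b d - a" for e
  proof -
    have [measurable]: "U 0 \<in> borel_measurable M" "U e \<in> borel_measurable M" 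
      using e by (auto intro!: span_measurable Uspan)
    have ii: "complex_integrable M (\<lambda>\<omega>. iexp (h \<omega>))" "complex_integrable M (\<lambda>\<omega>. indicator E \<omega> * iexp (h \<omega>))" if [measurable]: "h \<in> borel_measurable M" for h
      by (rule integrable_const_bound[of _ 1]; auto simp: norm_mult indicator_def)+
    have incA: "incr a (a + e) C \<in> noise_span W all_indices" if "C \<in> finite_borel_sets" for C
      using assms e that by (intro incr_in_span) auto
    have i1: "integrable M (\<lambda>\<omega>. \<bar>incr a (a + e) C \<omega>\<bar>)" if "C \<in> finite_borel_sets" for C
      using expectation_abs_le_sqrt(1)[OF span_measurable span_square_integrable] incA that by auto
    have i2: "(\<integral>\<omega>. \<bar>incr a (a + e) C \<omega>\<bar> \<partial>M) \<le> sqrt (e * measure lborel C)" if C: "C \<in> finite_borel_sets" for C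
      using expectation_abs_le_sqrt(2)[OF span_measurable span_square_integrable, OF incA incA, OF C C]
        incr_covariance[of a "a + e" "a + e" C C] assms e C
      by (simp add: power2_eq_square)
    have iU: "integrable M (\<lambda>\<omega>. \<bar>p\<bar> * \<bar>incr a (a + e) A \<omega>\<bar> + \<bar>q\<bar> * \<bar>incr a (a + e) B \<omega>\<bar>)"
      using i1 assms by simp
    have dU: "\<bar>U 0 \<omega> - U e \<omega>\<bar> \<le> \<bar>p\<bar> * \<bar>incr a (a + e) A \<omega>\<bar> + \<bar>q\<bar> * \<bar>incr a (a + e) B \<omega>\<bar>" for \<omega>
    proof -
      have "U 0 \<omega> - U e \<omega> = p * incr a (a + e) A \<omega> + q * incr a (a + e) B \<omega>"
        by (simp add: U_def incr_def algebra_simps)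
      then show ?thesis by (simp add: abs_triangle_ineq flip: abs_mult)
    qed
    have N: "cmod ((CLINT \<omega>|M. h \<omega> * iexp (U 0 \<omega>)) - (CLINT \<omega>|M. h \<omega> * iexp (U e \<omega>))) \<le> ?r e / 2"
      if h: "h = (\<lambda>_. 1) \<or> h = (\<lambda>\<omega>. indicator E \<omega>)" for h :: "'w \<Rightarrow> complex"
    proof -
      have i: "complex_integrable M (\<lambda>\<omega>. h \<omega> * iexp (U 0 \<omega>))" "complex_integrable M (\<lambda>\<omega>. h \<omega> * iexp (U e \<omega>))"
        using h ii[of "U 0"] ii[of "U e"] by auto
      have "cmod ((CLINT \<omega>|M. h \<omega> * iexp (U 0 \<omega>)) - (CLINT \<omega>|M. h \<omega> * iexp (U e \<omega>))) =
        cmod (CLINT \<omega>|M. h \<omega> * iexp (U 0 \<omega>) - h \<omega> * iexp (U e \<omega>))"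
        using i by simp
      also have "\<dots> \<le> (\<integral>\<omega>. cmod (h \<omega> * iexp (U 0 \<omega>) - h \<omega> * iexp (U e \<omega>)) \<partial>M)"
        by (rule integral_norm_bound)
      also have "\<dots> \<le> (\<integral>\<omega>. \<bar>p\<bar> * \<bar>incr a (a + e) A \<omega>\<bar> + \<bar>q\<bar> * \<bar>incr a (a + e) B \<omega>\<bar> \<partial>M)"
      proof (rule integral_mono)
        show "integrable M (\<lambda>\<omega>. cmod (h \<omega> * iexp (U 0 \<omega>) - h \<omega> * iexp (U e \<omega>)))" using i by auto
        fix \<omega>
        have "cmod (h \<omega>) \<le> 1" using h by (auto simp: indicator_def)
        then have "cmod (h \<omega> * iexp (U 0 \<omega>) - h \<omega> * iexp (U e \<omega>)) \<le> cmod (iexp (U 0 \<omega>) - iexp (U e \<omega>))"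
          unfolding right_diff_distrib[symmetric] norm_mult by (rule mult_left_le_one_le[rotated 2]) auto
        also have "\<dots> \<le> \<bar>U 0 \<omega> - U e \<omega>\<bar>" by (rule iexp_lipschitz)
        also note dU[of \<omega>]
        finally show "cmod (h \<omega> * iexp (U 0 \<omega>) - h \<omega> * iexp (U e \<omega>)) \<le> \<bar>p\<bar> * \<bar>incr a (a + e) A \<omega>\<bar> + \<bar>q\<bar> * \<bar>incr a (a + e) B \<omega>\<bar>" .
      qed (rule iU)
      also have "\<dots> = \<bar>p\<bar> * (\<integral>\<omega>. \<bar>incr a (a + e) A \<omega>\<bar> \<partial>M) + \<bar>q\<bar> * (\<integral>\<omega>. \<bar>incr a (a + e) B \<omega>\<bar> \<partial>M)"
        using i1 assms by simp
      also have "\<dots> \<le> ?r e / 2"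
        using i2 assms by (simp add: add_mono mult_left_mono)
      finally show ?thesis .
    qed
    have "Q 0 = Q 0 - Q e" using Q0 e by simp
    also have "\<dots> = ((CLINT \<omega>|M. indicator E \<omega> * iexp (U 0 \<omega>)) - (CLINT \<omega>|M. indicator E \<omega> * iexp (U e \<omega>)))
      - complex_of_real (prob E) * ((CLINT \<omega>|M. 1 * iexp (U 0 \<omega>)) - (CLINT \<omega>|M. 1 * iexp (U e \<omega>)))"
      by (simp add: Q_def algebra_simps)
    finally have "cmod (Q 0) \<le> cmod ((CLINT \<omega>|M. indicator E \<omega> * iexp (U 0 \<omega>)) - (CLINT \<omega>|M. indicator E \<omega> * iexp (U e \<omega>)))
      + cmod (complex_of_real (prob E) * ((CLINT \<omega>|M. 1 * iexp (U 0 \<omega>)) - (CLINT \<omega>|M. 1 * iexp (U e \<omega>))))"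
      by (simp add: norm_triangle_ineq4)
    also have "\<dots> \<le> ?r e / 2 + 1 * (?r e / 2)"
      unfolding norm_mult using e by (intro add_mono mult_mono N) auto
    finally show ?thesis by simp
  qed
  have "((\<lambda>e. ?r e) \<longlongrightarrow> 2 * (\<bar>p\<bar> * sqrt (0 * measure lborel A) + \<bar>q\<bar> * sqrt (0 * measure lborel B))) (at_right 0)"
    by (intro tendsto_intros)
  moreover have "eventually (\<lambda>e. cmod (Q 0) \<le> ?r e) (at_right 0)"
    unfolding eventually_at_right_field using bound assms
    by (intro exI[of _ "min b d - a"]) auto
  ultimately have "cmod (Q 0) \<le> 2 * (\<bar>p\<bar> * sqrt (0 * measure lborel A) + \<bar>q\<bar> * sqrt (0 * measure lborel B))"
    by (intro tendsto_lowerbound) auto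
  then show ?thesis by (simp add: Q_def U_def)
qed

text \<open>The frequency \<theta> is absorbed into the coefficients \<open>p\<close> and
  \<open>q\<close>, so the factorization holds along the whole characteristic function of the
  combination. The identity and the square are the functions \<open>h\<close> of interest.\<close>

lemma germ_event_expectation:
  assumes "0 \<le> a" "a < b" "a < d" "A \<in> finite_borel_sets" "B \<in> finite_borel_sets"
    and E: "E \<in> (\<Inter>s\<in>{a<..}. natural_events M W s)"
    and [measurable]: "h \<in> borel_measurable borel"
  shows "(\<integral>\<omega>. indicator E \<omega> * h (p * incr a b A \<omega> + q * incr a d B \<omega>) \<partial>M) =
    prob E * (\<integral>\<omega>. (h (p * incr a b A \<omega> + q * incr a d B \<omega>) :: real) \<partial>M)"
proof (rule integral_indicator_times_eqI_char[OF prob_space_axioms, where h=h and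
    U="\<lambda>\<omega>. p * incr a b A \<omega> + q * incr a d B \<omega>"])
  show "E \<in> sets M" using E natural_events_sets[of "a + 1"] by auto
  show "(\<lambda>\<omega>. p * incr a b A \<omega> + q * incr a d B \<omega>) \<in> borel_measurable M"
    using assms by (intro span_measurable noise_span_add noise_span_scale incr_in_span) auto
  fix \<theta>
  have "\<theta> * (p * x + q * y) = (\<theta> * p) * x + (\<theta> * q) * y" for x y by (simp add: algebra_simps)
  then show "(CLINT \<omega>|M. indicator E \<omega> * iexp (\<theta> * (p * incr a b A \<omega> + q * incr a d B \<omega>))) =
    complex_of_real (prob E) * (CLINT \<omega>|M. iexp (\<theta> * (p * incr a b A \<omega> + q * incr a d B \<omega>)))"
    using germ_event_char[OF assms(1-6), of "\<theta> * p" "\<theta> * q"] by simp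
qed fact

lemma germ_event_incr:
  assumes "0 \<le> a" "a < b" "A \<in> finite_borel_sets" and E: "E \<in> (\<Inter>s\<in>{a<..}. natural_events M W s)"
  shows "(\<integral>\<omega>. indicator E \<omega> * incr a b A \<omega> \<partial>M) = 0"
proof -
  have "(\<integral>\<omega>. indicator E \<omega> * (1 * incr a b A \<omega> + 0 * incr a b A \<omega>) \<partial>M) =
      prob E * (\<integral>\<omega>. 1 * incr a b A \<omega> + 0 * incr a b A \<omega> \<partial>M)"
    by (rule germ_event_expectation[OF assms(1,2,2,3,3) E measurable_ident_sets[OF refl]])
  also have "(\<integral>\<omega>. 1 * incr a b A \<omega> + 0 * incr a b A \<omega> \<partial>M) = 0"
    using span_mean[OF incr_in_span, of a b A] assms(1-3) by simp
  finally show ?thesis by simp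
qed

text \<open>Polarization: the square of the combination is taken for (p, q) = (1, 1), (1, 0) and (0,
  1), once on \<open>E\<close> and once on the whole space.\<close>

lemma germ_event_incr2:
  assumes "0 \<le> a" "a < b" "a < d" "A \<in> finite_borel_sets" "B \<in> finite_borel_sets"
    and E: "E \<in> (\<Inter>s\<in>{a<..}. natural_events M W s)"
  shows "(\<integral>\<omega>. indicator E \<omega> * (incr a b A \<omega> * incr a d B \<omega>) \<partial>M) =
    prob E * ((min b d - a) * measure lborel (A \<inter> B))"
proof -
  let ?X = "incr a b A" and ?Y = "incr a d B"
  have inc: "?X \<in> noise_span W all_indices" "?Y \<in> noise_span W all_indices"
    using assms by (auto intro!: incr_in_span)
  have E' [measurable]: "E \<in> sets M" using E natural_events_sets[of "a + 1"] by auto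
  have i: "integrable M (\<lambda>\<omega>. ?X \<omega> * ?Y \<omega>)" "integrable M (\<lambda>\<omega>. (?X \<omega>)\<^sup>2)" "integrable M (\<lambda>\<omega>. (?Y \<omega>)\<^sup>2)"
    using inc by (auto intro: span_integrable_mult span_square_integrable)
  have expand: "(\<integral>\<omega>. indicator F \<omega> * (1 * ?X \<omega> + 1 * ?Y \<omega>)\<^sup>2 \<partial>M) =
    (\<integral>\<omega>. indicator F \<omega> * (1 * ?X \<omega> + 0 * ?Y \<omega>)\<^sup>2 \<partial>M) + (\<integral>\<omega>. indicator F \<omega> * (0 * ?X \<omega> + 1 * ?Y \<omega>)\<^sup>2 \<partial>M)
     + 2 * (\<integral>\<omega>. indicator F \<omega> * (?X \<omega> * ?Y \<omega>) \<partial>M)" if F: "F \<in> sets M" for F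
  proof -
    have iF: "integrable M (\<lambda>\<omega>. indicator F \<omega> * f \<omega>)" if "integrable M f" for f :: "'w \<Rightarrow> real"
      using integrable_mult_indicator[OF F that] by simp
    have "(\<integral>\<omega>. indicator F \<omega> * (1 * ?X \<omega> + 1 * ?Y \<omega>)\<^sup>2 \<partial>M) = (\<integral>\<omega>. indicator F \<omega> * (?X \<omega>)\<^sup>2 + indicator F \<omega> * (?Y \<omega>)\<^sup>2
      + 2 * (indicator F \<omega> * (?X \<omega> * ?Y \<omega>)) \<partial>M)"
      by (rule Bochner_Integration.integral_cong) (auto simp: power2_eq_square algebra_simps)
    then show ?thesis using iF[OF i(1)] iF[OF i(2)] iF[OF i(3)] by simp
  qed
  have sp: "(\<integral>\<omega>. indicator (space M) \<omega> * f \<omega> \<partial>M) = (\<integral>\<omega>. f \<omega> \<partial>M)" for f :: "'w \<Rightarrow> real"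
    by (rule Bochner_Integration.integral_cong) auto
  have "(\<lambda>x::real. x\<^sup>2) \<in> borel_measurable borel" by measurable
  note g = germ_event_expectation[OF assms this]
  have "2 * (\<integral>\<omega>. indicator E \<omega> * (?X \<omega> * ?Y \<omega>) \<partial>M) = prob E * (2 * (\<integral>\<omega>. ?X \<omega> * ?Y \<omega> \<partial>M))"
    using expand[OF E', unfolded g] expand[OF sets.top, unfolded sp] by (simp add: algebra_simps)
  then show ?thesis
    using incr_covariance[of a b d A B] assms by simp
qed

section \<open>The right-continuous filtration\<close>

lemma germ_events_Pow: "(\<Inter>s\<in>{a<..}. natural_events M W s) \<subseteq> Pow (space M)"
proof -
  have "natural_events M W (a + 1) \<subseteq> Pow (space M)"
    using natural_events_sets sets.sets_into_space by blast
  then show ?thesis by (intro INF_lower2[of "a + 1"]) auto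
qed

lemma filtration_space [simp]: "space (noise_filtration M W a) = space M"
  unfolding noise_filtration_def by (rule space_measure_of[OF germ_events_Pow])

lemma sets_filtration:
  "sets (noise_filtration M W a) = sigma_sets (space M) (\<Inter>s\<in>{a<..}. natural_events M W s)"
  unfolding noise_filtration_def by (rule sets_measure_of[OF germ_events_Pow])

lemma filtration_germ:
  assumes E: "E \<in> sets (noise_filtration M W a)"
  shows "E \<in> (\<Inter>s\<in>{a<..}. natural_events M W s)"
proof
  fix s assume s: "s \<in> {a<..}"
  have "sigma_sets (space M) (\<Inter>s\<in>{a<..}. natural_events M W s) \<subseteq> natural_events M W s"
    using s unfolding natural_events_def by (intro sigma_sets_mono) auto
  then show "E \<in> natural_events M W s" using E by (auto simp: sets_filtration)
qed

lemma filtration_subalgebra: "subalgebra M (noise_filtration M W a)"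
proof -
  have "E \<in> sets M" if "E \<in> sets (noise_filtration M W a)" for E
  proof -
    have "E \<in> natural_events M W (a + 1)" using INT_D[OF filtration_germ[OF that], of "a + 1"] by simp
    then show ?thesis using natural_events_sets by blast
  qed
  then show ?thesis unfolding subalgebra_def by auto
qed

lemma filtration_mono:
  assumes "a \<le> b"
  shows "subalgebra (noise_filtration M W b) (noise_filtration M W a)"
proof -
  have "{b<..} \<subseteq> {a<..}" using assms by auto
  then show ?thesis
    unfolding subalgebra_def sets_filtration
    by (simp add: sigma_sets_mono' INF_superset_mono)
qed

lemma noise_filtration_measurable:
  assumes "0 \<le> t" "t \<le> a" "A \<in> finite_borel_sets"
  shows "W t A \<in> borel_measurable (noise_filtration M W a)"
proof (rule measurableI)
  fix B :: "real set" assume B: "B \<in> sets borel"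
  have "W t A -` B \<inter> space M \<in> natural_events M W s" if "s \<in> {a<..}" for s
    unfolding natural_events_def
    by (rule sigma_sets.Basic, rule UnI1, rule CollectI, rule exI[of _ t], rule exI[of _ A], rule exI[of _ B])
      (use assms that B in simp)
  then show "W t A -` B \<inter> space (noise_filtration M W a) \<in> sets (noise_filtration M W a)"
    unfolding sets_filtration filtration_space by (intro sigma_sets.Basic INT_I)
qed simp

text \<open>The hypothesis on events says that the conditional expectation of \<open>Y\<close> is
  the constant \<open>c\<close>, and the factor \<open>X\<close> known at time \<open>a\<close> may
  be pulled out. This passes from events to the random coefficients of elementary processes.\<close>

lemma filtration_cond_exp:
  assumes X: "X \<in> borel_measurable (noise_filtration M W a)" and Y: "integrable M Y"
    and XY: "integrable M (\<lambda>\<omega>. X \<omega> * Y \<omega>)"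
    and c: "\<And>E. E \<in> sets (noise_filtration M W a) \<Longrightarrow> (\<integral>\<omega>. indicator E \<omega> * Y \<omega> \<partial>M) = prob E * c"
  shows "(\<integral>\<omega>. X \<omega> * Y \<omega> \<partial>M) = (\<integral>\<omega>. X \<omega> \<partial>M) * c"
proof -
  interpret F: finite_measure_subalgebra M "noise_filtration M W a"
    by standard (rule filtration_subalgebra)
  have "AE \<omega> in M. real_cond_exp M (noise_filtration M W a) Y \<omega> = c"
  proof (rule F.real_cond_exp_charact)
    fix E assume E: "E \<in> sets (noise_filtration M W a)"
    then have "E \<in> sets M" using filtration_subalgebra by (auto simp: subalgebra_def)
    then show "(\<integral>\<omega>\<in>E. Y \<omega> \<partial>M) = (\<integral>\<omega>\<in>E. c \<partial>M)"
      using c[OF E] by (simp add: set_lebesgue_integral_def sets.Int_space_eq2)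
  qed (use Y in auto)
  then have "(\<integral>\<omega>. X \<omega> * real_cond_exp M (noise_filtration M W a) Y \<omega> \<partial>M) = (\<integral>\<omega>. X \<omega> * c \<partial>M)"
    using X measurable_from_subalg[OF filtration_subalgebra X] by (intro integral_cong_AE) auto
  then show ?thesis
    using F.real_cond_exp_intg(2)[OF XY X] Y by simp
qed

section \<open>Products of two simple stochastic integrals\<close>

lemma integrable_bounded_mult:
  fixes X Y :: "'w \<Rightarrow> real"
  assumes "X \<in> borel_measurable M" "\<And>\<omega>. \<omega> \<in> space M \<Longrightarrow> \<bar>X \<omega>\<bar> \<le> K" "integrable M Y"
  shows "integrable M (\<lambda>\<omega>. X \<omega> * Y \<omega>)"
proof (rule Bochner_Integration.integrable_bound)
  show "integrable M (\<lambda>\<omega>. \<bar>K\<bar> * \<bar>Y \<omega>\<bar>)" using assms by simp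
  show "(\<lambda>\<omega>. X \<omega> * Y \<omega>) \<in> borel_measurable M" using assms by simp
  show "AE \<omega> in M. norm (X \<omega> * Y \<omega>) \<le> norm (\<bar>K\<bar> * \<bar>Y \<omega>\<bar>)"
  proof (rule AE_I2)
    fix \<omega> assume "\<omega> \<in> space M"
    then have "\<bar>X \<omega>\<bar> \<le> \<bar>K\<bar>" using assms(2) by fastforce
    then show "norm (X \<omega> * Y \<omega>) \<le> norm (\<bar>K\<bar> * \<bar>Y \<omega>\<bar>)"
      by (simp add: abs_mult mult_right_mono)
  qed
qed

definition simple_integrand :: "('w \<Rightarrow> real) \<times> real \<times> real \<times> real set \<Rightarrow> bool" where
  "simple_integrand = (\<lambda>(X, a, b, A). 0 \<le> a \<and> a < b \<and> A \<in> finite_borel_sets \<and>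
     X \<in> borel_measurable (noise_filtration M W a) \<and> (\<exists>K. \<forall>\<omega>\<in>space M. \<bar>X \<omega>\<bar> \<le> K))"

lemma elementary_process_iff: "elementary_process M W S \<longleftrightarrow> (\<forall>e\<in>set S. simple_integrand e)"
  by (simp add: elementary_process_def simple_integrand_def)

text \<open>The first increment is cut at the later starting time \<open>c\<close>. The part before \<open>c\<close> belongs to the past
  of the second increment and contributes 0; the part after \<open>c\<close> contributes the covariance.\<close>

lemma simple_integral_product_ordered:
  assumes s1: "simple_integrand (X, a, b, A)" and s2: "simple_integrand (Y, c, d, B)" and ac: "a \<le> c"
  shows "integrable M (\<lambda>\<omega>. (X \<omega> * incr a b A \<omega>) * (Y \<omega> * incr c d B \<omega>))"
    "(\<integral>\<omega>. (X \<omega> * incr a b A \<omega>) * (Y \<omega> * incr c d B \<omega>) \<partial>M) =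
      (\<integral>\<omega>. X \<omega> * Y \<omega> \<partial>M) * (measure lborel ({a<..b} \<inter> {c<..d}) * measure lborel (A \<inter> B))"
proof -
  let ?F = "noise_filtration M W"
  from s1 obtain K where *: "0 \<le> a" "a < b" "A \<in> finite_borel_sets" "X \<in> borel_measurable (?F a)"
    and K: "\<And>\<omega>. \<omega> \<in> space M \<Longrightarrow> \<bar>X \<omega>\<bar> \<le> K" by (auto simp: simple_integrand_def)
  from s2 obtain L where **: "0 \<le> c" "c < d" "B \<in> finite_borel_sets" "Y \<in> borel_measurable (?F c)"
    and L: "\<And>\<omega>. \<omega> \<in> space M \<Longrightarrow> \<bar>Y \<omega>\<bar> \<le> L" by (auto simp: simple_integrand_def)
  have XF [measurable]: "X \<in> borel_measurable (?F c)"
    by (rule measurable_from_subalg[OF filtration_mono[OF ac] *(4)])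
  have YF [measurable]: "Y \<in> borel_measurable (?F c)" by fact
  have [measurable]: "X \<in> borel_measurable M" "Y \<in> borel_measurable M"
    using measurable_from_subalg[OF filtration_subalgebra XF] measurable_from_subalg[OF filtration_subalgebra YF] by auto
  \<comment> \<open>One decomposition covers both cases. If b \<le> c, then m = b and n = c, and the
    second piece \<open>incr c n A\<close> is 0; otherwise m = c and n = b, and the interval is cut
    at \<open>c\<close>.\<close>
  define m where "m = min b c"
  define n where "n = max b c"
  have mn: "a \<le> m" "m \<le> c" "c \<le> n" using * ac by (auto simp: m_def n_def)
  have split: "incr a b A \<omega> = incr a m A \<omega> + incr c n A \<omega>" for \<omega>
    by (auto simp: m_def n_def incr_def min_def max_def)
  have bd: "\<bar>X \<omega> * Y \<omega>\<bar> \<le> \<bar>K\<bar> * \<bar>L\<bar>" if "\<omega> \<in> space M" for \<omega>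
    using K[OF that] L[OF that] unfolding abs_mult by (intro mult_mono) auto
  have inc: "incr a m A \<in> noise_span W all_indices" "incr c n A \<in> noise_span W all_indices" "incr c d B \<in> noise_span W all_indices"
    using * ** mn by (auto intro!: incr_in_span)
  have i1: "integrable M (\<lambda>\<omega>. X \<omega> * Y \<omega> * (incr a m A \<omega> * incr c d B \<omega>))"
    by (rule integrable_bounded_mult[OF _ bd]) (auto intro!: span_integrable_mult inc)
  have i2: "integrable M (\<lambda>\<omega>. X \<omega> * Y \<omega> * (incr c n A \<omega> * incr c d B \<omega>))"
    by (rule integrable_bounded_mult[OF _ bd]) (auto intro!: span_integrable_mult inc)
  have eq: "(X \<omega> * incr a b A \<omega>) * (Y \<omega> * incr c d B \<omega>) =
    X \<omega> * Y \<omega> * (incr a m A \<omega> * incr c d B \<omega>) + X \<omega> * Y \<omega> * (incr c n A \<omega> * incr c d B \<omega>)" for \<omega>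
    unfolding split by (simp add: algebra_simps)
  show "integrable M (\<lambda>\<omega>. (X \<omega> * incr a b A \<omega>) * (Y \<omega> * incr c d B \<omega>))"
    unfolding eq using i1 i2 by simp
  have id: "integrable M (incr c d B)"
    using expectation_abs_le_sqrt(1)[OF span_measurable span_square_integrable, OF inc(3) inc(3)] .
  have "(\<integral>\<omega>. (X \<omega> * Y \<omega> * incr a m A \<omega>) * incr c d B \<omega> \<partial>M) = (\<integral>\<omega>. X \<omega> * Y \<omega> * incr a m A \<omega> \<partial>M) * 0"
  proof (rule filtration_cond_exp[OF _ id])
    have "incr a m A \<in> borel_measurable (?F c)"
      unfolding incr_def[abs_def] using * mn by (intro borel_measurable_diff noise_filtration_measurable) auto
    then show "(\<lambda>\<omega>. X \<omega> * Y \<omega> * incr a m A \<omega>) \<in> borel_measurable (?F c)" by measurable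
    show "integrable M (\<lambda>\<omega>. X \<omega> * Y \<omega> * incr a m A \<omega> * incr c d B \<omega>)"
      using i1 by (simp add: mult.assoc)
    show "(\<integral>\<omega>. indicator E \<omega> * incr c d B \<omega> \<partial>M) = prob E * 0" if "E \<in> sets (?F c)" for E
      using germ_event_incr[OF _ _ _ filtration_germ[OF that]] ** by simp
  qed
  then have e1: "(\<integral>\<omega>. X \<omega> * Y \<omega> * (incr a m A \<omega> * incr c d B \<omega>) \<partial>M) = 0"
    by (simp add: mult.assoc)
  have e2: "(\<integral>\<omega>. X \<omega> * Y \<omega> * (incr c n A \<omega> * incr c d B \<omega>) \<partial>M) =
    (\<integral>\<omega>. X \<omega> * Y \<omega> \<partial>M) * ((min n d - c) * measure lborel (A \<inter> B))"
  proof (cases "c < n")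
    case True
    show ?thesis
    proof (rule filtration_cond_exp)
      show "integrable M (\<lambda>\<omega>. incr c n A \<omega> * incr c d B \<omega>)" by (intro span_integrable_mult inc)
      show "(\<integral>\<omega>. indicator E \<omega> * (incr c n A \<omega> * incr c d B \<omega>) \<partial>M) = prob E * ((min n d - c) * measure lborel (A \<inter> B))"
        if "E \<in> sets (?F c)" for E
        using germ_event_incr2[OF _ True _ _ _ filtration_germ[OF that]] * ** by simp
    qed (use i2 in auto)
  next
    case False
    then have "n = c" using mn by simp
    then show ?thesis using ** by (simp add: incr_def)
  qed
  have len: "measure lborel ({a<..b} \<inter> {c<..d}) = min n d - c"
  proof -
    have "{a<..b} \<inter> {c<..d} = {c<..min n d}" using ac * ** by (auto simp: n_def)
    then show ?thesis using mn ** by simp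
  qed
  show "(\<integral>\<omega>. (X \<omega> * incr a b A \<omega>) * (Y \<omega> * incr c d B \<omega>) \<partial>M) =
      (\<integral>\<omega>. X \<omega> * Y \<omega> \<partial>M) * (measure lborel ({a<..b} \<inter> {c<..d}) * measure lborel (A \<inter> B))"
    unfolding eq len using i1 i2 e1 e2 by simp
qed

lemma simple_integral_product:
  assumes s1: "simple_integrand (X, a, b, A)" and s2: "simple_integrand (Y, c, d, B)"
  shows "integrable M (\<lambda>\<omega>. (X \<omega> * incr a b A \<omega>) * (Y \<omega> * incr c d B \<omega>)) \<and>
    (\<integral>\<omega>. (X \<omega> * incr a b A \<omega>) * (Y \<omega> * incr c d B \<omega>) \<partial>M) =
      (\<integral>\<omega>. X \<omega> * Y \<omega> \<partial>M) * (measure lborel ({a<..b} \<inter> {c<..d}) * measure lborel (A \<inter> B))"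
proof (cases "a \<le> c")
  case True
  then show ?thesis using simple_integral_product_ordered[OF s1 s2] by simp
next
  case False
  then show ?thesis using simple_integral_product_ordered[OF s2 s1] by (simp add: mult.commute Int_commute)
qed

end

section \<open>The Ito isometry\<close>

lemma square_add_le:
  fixes x y e :: real assumes "e > 0"
  shows "(x + y)\<^sup>2 \<le> (1 + e) * x\<^sup>2 + (1 + 1/e) * y\<^sup>2"
proof -
  have "0 \<le> (e * x - y)\<^sup>2 / e" using assms by simp
  also have "\<dots> = (1 + e) * x\<^sup>2 + (1 + 1/e) * y\<^sup>2 - (x + y)\<^sup>2"
    using assms by (simp add: field_simps power2_eq_square)
  finally show ?thesis by simp
qed

text \<open>A triangle inequality for squared norms with values in the extended reals, free of
  square roots. With \<open>e\<close> tending to 0 the factor of the first summand tends to 1, which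
  is sharp enough for an isometry; \<open>e = 1\<close> gives the usual factor 2.\<close>

lemma L2_norm_sq_add_le:
  assumes "e > 0" and [measurable]: "X \<in> borel_measurable M" "Y \<in> borel_measurable M"
  shows "L2_norm_sq M (\<lambda>\<omega>. X \<omega> + Y \<omega>) \<le> ennreal (1 + e) * L2_norm_sq M X + ennreal (1 + 1/e) * L2_norm_sq M Y"
proof -
  have "L2_norm_sq M (\<lambda>\<omega>. X \<omega> + Y \<omega>) \<le> (\<integral>\<^sup>+\<omega>. ennreal (1 + e) * ennreal ((X \<omega>)\<^sup>2) + ennreal (1 + 1/e) * ennreal ((Y \<omega>)\<^sup>2) \<partial>M)"
    unfolding L2_norm_sq_def using assms(1) square_add_le[OF assms(1)]
    by (intro nn_integral_mono) (simp add: ennreal_leI flip: ennreal_mult ennreal_plus)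
  also have "\<dots> = ennreal (1 + e) * L2_norm_sq M X + ennreal (1 + 1/e) * L2_norm_sq M Y"
    unfolding L2_norm_sq_def by (simp add: nn_integral_add nn_integral_cmult)
  finally show ?thesis .
qed

lemma L2_norm_sq_uminus: "L2_norm_sq M (\<lambda>\<omega>. X \<omega> - Y \<omega>) = L2_norm_sq M (\<lambda>\<omega>. Y \<omega> - X \<omega>)"
  unfolding L2_norm_sq_def by (simp add: power2_commute)

lemma L2_norm_sq_integral: "integrable M (\<lambda>\<omega>. (X \<omega>)\<^sup>2) \<Longrightarrow> L2_norm_sq M X = ennreal (\<integral>\<omega>. (X \<omega>)\<^sup>2 \<partial>M)"
  unfolding L2_norm_sq_def by (rule nn_integral_eq_integral) auto

lemma L2_norm_sq_finite_iff:
  assumes [measurable]: "X \<in> borel_measurable M"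
  shows "L2_norm_sq M X < \<infinity> \<longleftrightarrow> integrable M (\<lambda>\<omega>. (X \<omega>)\<^sup>2)"
  unfolding L2_norm_sq_def by (simp add: integrable_iff_bounded)

text \<open>The triangle inequality is used twice, from \<open>X\<close> to \<open>x n\<close> and
  from \<open>y n\<close> to \<open>Y\<close>; this costs the factor (1 + e)^2, which disappears as
  \<open>e\<close> tends to 0. The statement is one-sided: exchanging the two sides yields equality,
  and an infinite right-hand side is trivial.\<close>

lemma L2_norm_sq_limit_le:
  fixes x :: "nat \<Rightarrow> 'a \<Rightarrow> real" and y :: "nat \<Rightarrow> 'b \<Rightarrow> real"
  assumes meas: "\<And>n. x n \<in> borel_measurable M" "X \<in> borel_measurable M"
      "\<And>n. y n \<in> borel_measurable N" "Y \<in> borel_measurable N"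
    and eq: "\<And>n. L2_norm_sq M (x n) = L2_norm_sq N (y n)"
    and x: "(\<lambda>n. L2_norm_sq M (\<lambda>\<omega>. x n \<omega> - X \<omega>)) \<longlonglongrightarrow> 0"
    and y: "(\<lambda>n. L2_norm_sq N (\<lambda>\<omega>. y n \<omega> - Y \<omega>)) \<longlonglongrightarrow> 0"
  shows "L2_norm_sq M X \<le> L2_norm_sq N Y"
proof (cases "L2_norm_sq N Y = \<top>")
  case False
  note [measurable] = meas
  let ?d = "\<lambda>n. L2_norm_sq M (\<lambda>\<omega>. x n \<omega> - X \<omega>)" and ?d' = "\<lambda>n. L2_norm_sq N (\<lambda>\<omega>. y n \<omega> - Y \<omega>)"
  have bound: "L2_norm_sq M X \<le> ennreal ((1 + e)\<^sup>2) * L2_norm_sq N Y" if e: "e > 0" for e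
  proof (rule LIMSEQ_le_const)
    let ?c = "ennreal (1 + 1/e)"
    let ?r = "\<lambda>n. ennreal (1 + e) * (ennreal (1 + e) * L2_norm_sq N Y + ?c * ?d' n) + ?c * ?d n"
    have "?r \<longlonglongrightarrow> ennreal (1 + e) * (ennreal (1 + e) * L2_norm_sq N Y + ?c * 0) + ?c * 0"
      by (intro tendsto_add ennreal_tendsto_cmult tendsto_const x y) auto
    then show "?r \<longlonglongrightarrow> ennreal ((1 + e)\<^sup>2) * L2_norm_sq N Y"
      using e by (simp add: power2_eq_square ennreal_mult mult.assoc)
    have "L2_norm_sq M X \<le> ?r n" for n
    proof -
      have "L2_norm_sq M X = L2_norm_sq M (\<lambda>\<omega>. x n \<omega> + (X \<omega> - x n \<omega>))" by simp
      also have "\<dots> \<le> ennreal (1 + e) * L2_norm_sq M (x n) + ?c * L2_norm_sq M (\<lambda>\<omega>. X \<omega> - x n \<omega>)"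
        by (rule L2_norm_sq_add_le[OF e]) measurable
      also have "L2_norm_sq M (x n) = L2_norm_sq N (\<lambda>\<omega>. Y \<omega> + (y n \<omega> - Y \<omega>))" by (simp add: eq)
      also have "\<dots> \<le> ennreal (1 + e) * L2_norm_sq N Y + ?c * ?d' n"
        by (rule L2_norm_sq_add_le[OF e]) measurable
      finally show ?thesis
        by (simp add: L2_norm_sq_uminus[of M X] add_right_mono mult_left_mono)
    qed
    then show "\<exists>N. \<forall>n\<ge>N. L2_norm_sq M X \<le> ?r n" by blast
  qed
  have "((\<lambda>e::real. L2_norm_sq N Y * ennreal ((1 + e)\<^sup>2)) \<longlongrightarrow> L2_norm_sq N Y * ennreal ((1 + 0)\<^sup>2)) (at_right 0)"
    using False by (intro ennreal_tendsto_cmult tendsto_ennrealI tendsto_intros) (simp add: top.not_eq_extremum)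
  moreover have "eventually (\<lambda>e. L2_norm_sq M X \<le> L2_norm_sq N Y * ennreal ((1 + e)\<^sup>2)) (at_right (0::real))"
    unfolding eventually_at_right_field using bound by (intro exI[of _ 1]) (auto simp: mult.commute)
  ultimately have "L2_norm_sq M X \<le> L2_norm_sq N Y * ennreal ((1 + 0)\<^sup>2)"
    by (rule tendsto_lowerbound) simp
  then show ?thesis by simp
qed simp

text \<open>Bilinearity replaces the usual refinement of an elementary process into disjoint
  rectangles: if \<open>p\<close> and \<open>q\<close> have the same inner products for all pairs of
  entries, overlapping or not, then so do their sums.\<close>

lemma sum_list_product_integral:
  fixes p :: "'e \<Rightarrow> 'a \<Rightarrow> real" and q :: "'e \<Rightarrow> 'b \<Rightarrow> real"
  assumes pq: "\<And>e f. e \<in> A \<Longrightarrow> f \<in> A \<Longrightarrow> integrable M (\<lambda>\<omega>. p e \<omega> * p f \<omega>) \<and> integrable N (\<lambda>\<omega>. q e \<omega> * q f \<omega>) \<and>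
    (\<integral>\<omega>. p e \<omega> * p f \<omega> \<partial>M) = (\<integral>\<omega>. q e \<omega> * q f \<omega> \<partial>N)"
    and "set S \<subseteq> A" "set T \<subseteq> A"
  shows "integrable M (\<lambda>\<omega>. (\<Sum>e\<leftarrow>S. p e \<omega>) * (\<Sum>f\<leftarrow>T. p f \<omega>)) \<and> integrable N (\<lambda>\<omega>. (\<Sum>e\<leftarrow>S. q e \<omega>) * (\<Sum>f\<leftarrow>T. q f \<omega>)) \<and>
    (\<integral>\<omega>. (\<Sum>e\<leftarrow>S. p e \<omega>) * (\<Sum>f\<leftarrow>T. p f \<omega>) \<partial>M) = (\<integral>\<omega>. (\<Sum>e\<leftarrow>S. q e \<omega>) * (\<Sum>f\<leftarrow>T. q f \<omega>) \<partial>N)"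
proof -
  have one: "integrable M (\<lambda>\<omega>. p e \<omega> * (\<Sum>f\<leftarrow>T. p f \<omega>)) \<and> integrable N (\<lambda>\<omega>. q e \<omega> * (\<Sum>f\<leftarrow>T. q f \<omega>)) \<and>
    (\<integral>\<omega>. p e \<omega> * (\<Sum>f\<leftarrow>T. p f \<omega>) \<partial>M) = (\<integral>\<omega>. q e \<omega> * (\<Sum>f\<leftarrow>T. q f \<omega>) \<partial>N)" if e: "e \<in> A" for e
    using \<open>set T \<subseteq> A\<close>
  proof (induction T)
    case (Cons f T)
    then show ?case using pq[OF e, of f] by (simp add: distrib_left)
  qed simp
  show ?thesis using \<open>set S \<subseteq> A\<close>
  proof (induction S)
    case (Cons e S)
    then show ?case using one[of e] by (simp add: distrib_right)
  qed simp
qed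

section \<open>Elementary processes on space-time\<close>

lemma sigma_finite_spacetime: "sigma_finite_measure spacetime"
  unfolding spacetime_def
proof (rule sigma_finite_measure_restrict_space)
  have "{0<..} \<times> (UNIV :: real set) \<in> sets (borel :: (real \<times> real) measure)"
    unfolding borel_prod[symmetric] by (rule pair_measureI) auto
  then show "{0<..} \<times> (UNIV :: real set) \<in> sets (lborel :: (real \<times> real) measure)" by simp
qed (rule lborel.sigma_finite_measure_axioms)

lemma spacetime_rectangle:
  assumes "I \<in> sets borel" "A \<in> sets borel" "I \<subseteq> {0<..}"
  shows "I \<times> A \<in> sets spacetime" "emeasure spacetime (I \<times> A) = emeasure lborel I * emeasure lborel A"
proof -
  have IA: "I \<times> A \<in> sets (lborel :: (real \<times> real) measure)" if "I \<in> sets borel" "A \<in> sets borel" for I A :: "real set"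
    unfolding sets_lborel borel_prod[symmetric] using that by (intro pair_measureI) auto
  have P: "{0<..} \<times> (UNIV :: real set) \<inter> space lborel \<in> sets (lborel :: (real \<times> real) measure)"
    using IA[of "{0<..}" UNIV] by simp
  have sub: "I \<times> A \<subseteq> {0<..} \<times> UNIV" using assms by auto
  show "I \<times> A \<in> sets spacetime"
    unfolding spacetime_def sets_restrict_space_iff[OF P] using IA[OF assms(1,2)] sub by simp
  have "emeasure spacetime (I \<times> A) = emeasure lborel (I \<times> A)"
    unfolding spacetime_def by (rule emeasure_restrict_space[OF P sub])
  also have "\<dots> = emeasure lborel I * emeasure lborel A"
    unfolding lborel_prod[symmetric] using assms by (intro lborel.emeasure_pair_measure_Times) auto
  finally show "emeasure spacetime (I \<times> A) = emeasure lborel I * emeasure lborel A" .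
qed

context space_time_noise begin

lemma pair_sigma_finite_spacetime: "pair_sigma_finite spacetime M"
  by (intro pair_sigma_finite.intro sigma_finite_spacetime sigma_finite_measure_axioms)

definition term_value :: "('w \<Rightarrow> real) \<times> real \<times> real \<times> real set \<Rightarrow> (real \<times> real) \<times> 'w \<Rightarrow> real" where
  "term_value = (\<lambda>(X, a, b, A) ((s, y), \<omega>). X \<omega> * indicator {a<..b} s * indicator A y)"

definition term_integral :: "('w \<Rightarrow> real) \<times> real \<times> real \<times> real set \<Rightarrow> 'w \<Rightarrow> real" where
  "term_integral = (\<lambda>(X, a, b, A) \<omega>. X \<omega> * incr a b A \<omega>)"

lemma elementary_value_eq: "(\<lambda>((s, y), \<omega>). elementary_value S s y \<omega>) = (\<lambda>p. \<Sum>e\<leftarrow>S. term_value e p)"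
  by (auto simp: elementary_value_def term_value_def fun_eq_iff intro!: arg_cong[where f=sum_list] map_cong)

lemma elementary_integral_eq: "elementary_integral W S = (\<lambda>\<omega>. \<Sum>e\<leftarrow>S. term_integral e \<omega>)"
  by (auto simp: elementary_integral_def term_integral_def incr_def fun_eq_iff intro!: arg_cong[where f=sum_list] map_cong)

lemma term_value_rectangle:
  "term_value (X, a, b, A) (p, \<omega>) = indicator ({a<..b} \<times> A) p * X \<omega>"
  by (cases p) (simp add: term_value_def indicator_def)

lemma simple_integrand_rectangle:
  assumes "simple_integrand (X, a, b, A)"
  shows "{a<..b} \<times> A \<in> sets spacetime" "emeasure spacetime ({a<..b} \<times> A) < \<infinity>" "X \<in> borel_measurable M"
proof -
  note * = assms[unfolded simple_integrand_def split finite_borel_sets_def mem_Collect_eq]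
  have s: "{a<..b} \<in> sets borel" "A \<in> sets borel" "{a<..b} \<subseteq> {0<..}" using * by auto
  show "{a<..b} \<times> A \<in> sets spacetime" by (rule spacetime_rectangle(1)[OF s])
  show "emeasure spacetime ({a<..b} \<times> A) < \<infinity>"
    unfolding spacetime_rectangle(2)[OF s] using * by (simp add: ennreal_mult_less_top)
  show "X \<in> borel_measurable M" using * measurable_from_subalg[OF filtration_subalgebra] by blast
qed

lemma term_value_measurable:
  assumes "simple_integrand e"
  shows "term_value e \<in> borel_measurable (spacetime \<Otimes>\<^sub>M M)"
proof -
  obtain X a b A where e: "e = (X, a, b, A)" by (cases e)
  note [measurable] = simple_integrand_rectangle(1,3)[OF assms[unfolded e]]
  have "term_value e = (\<lambda>p. indicator ({a<..b} \<times> A) (fst p) * X (snd p))"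
    unfolding e by (rule ext, rename_tac p, case_tac p) (simp only: term_value_rectangle fst_conv snd_conv)
  then show ?thesis by simp
qed

text \<open>The product of two entries lives on the intersection of their rectangles, and Fubini
  separates the area of that intersection from the expectation. The value is the one in
  \<open>simple_integral_product\<close>; the coincidence is the isometry for a pair of
  entries.\<close>

lemma simple_value_product:
  assumes s1: "simple_integrand (X, a, b, A)" and s2: "simple_integrand (Y, c, d, B)"
  shows "integrable (spacetime \<Otimes>\<^sub>M M) (\<lambda>p. term_value (X, a, b, A) p * term_value (Y, c, d, B) p) \<and>
    (\<integral>p. term_value (X, a, b, A) p * term_value (Y, c, d, B) p \<partial>(spacetime \<Otimes>\<^sub>M M)) =
      (\<integral>\<omega>. X \<omega> * Y \<omega> \<partial>M) * (measure lborel ({a<..b} \<inter> {c<..d}) * measure lborel (A \<inter> B))"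
proof -
  interpret P: pair_sigma_finite spacetime M by (rule pair_sigma_finite_spacetime)
  let ?R = "({a<..b} \<inter> {c<..d}) \<times> (A \<inter> B)"
  note r1 = simple_integrand_rectangle[OF s1] and r2 = simple_integrand_rectangle[OF s2]
  have R_eq: "?R = ({a<..b} \<times> A) \<inter> ({c<..d} \<times> B)" by auto
  have R [measurable]: "?R \<in> sets spacetime" unfolding R_eq using r1(1) r2(1) by (rule sets.Int)
  have Rfin: "emeasure spacetime ?R < \<infinity>"
    unfolding R_eq using emeasure_mono[OF Int_lower1 r1(1), of "{c<..d} \<times> B"] r1(2) by (rule le_less_trans)
  have [measurable]: "X \<in> borel_measurable M" "Y \<in> borel_measurable M" using r1 r2 by auto
  from s1 s2 obtain K L where KL: "\<And>\<omega>. \<omega> \<in> space M \<Longrightarrow> \<bar>X \<omega>\<bar> \<le> K" "\<And>\<omega>. \<omega> \<in> space M \<Longrightarrow> \<bar>Y \<omega>\<bar> \<le> L"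
    by (auto simp: simple_integrand_def)
  have iXY: "integrable M (\<lambda>\<omega>. X \<omega> * Y \<omega>)"
  proof (rule integrable_bounded_mult)
    show "integrable M Y" by (rule integrable_const_bound[of _ L]) (use KL in auto)
  qed (use KL in auto)
  have eq: "term_value (X, a, b, A) (p, \<omega>) * term_value (Y, c, d, B) (p, \<omega>) = indicator ?R p * (X \<omega> * Y \<omega>)" for p \<omega>
    unfolding term_value_rectangle R_eq by (simp add: indicator_inter_arith)
  have eqf: "(\<lambda>p. term_value (X, a, b, A) p * term_value (Y, c, d, B) p) = (\<lambda>(p, \<omega>). indicator ?R p * (X \<omega> * Y \<omega>))"
    by (auto simp only: fun_eq_iff eq split_paired_all split)
  have int: "integrable (spacetime \<Otimes>\<^sub>M M) (\<lambda>(p, \<omega>). indicator ?R p * (X \<omega> * Y \<omega>))"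
  proof (rule P.Fubini_integrable)
    show "(\<lambda>(p, \<omega>). indicator ?R p * (X \<omega> * Y \<omega>)) \<in> borel_measurable (spacetime \<Otimes>\<^sub>M M)" by measurable
    have "integrable spacetime (\<lambda>p. indicator ?R p * (\<integral>\<omega>. \<bar>X \<omega> * Y \<omega>\<bar> \<partial>M))"
      using R Rfin by (intro integrable_mult_left integrable_real_indicator) auto
    then show "integrable spacetime (\<lambda>p. \<integral>\<omega>. norm (case (p, \<omega>) of (p, \<omega>) \<Rightarrow> indicator ?R p * (X \<omega> * Y \<omega>)) \<partial>M)"
      by (simp add: abs_mult)
    show "AE p in spacetime. integrable M (\<lambda>\<omega>. case (p, \<omega>) of (p, \<omega>) \<Rightarrow> indicator ?R p * (X \<omega> * Y \<omega>))"
      using iXY by simp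
  qed
  have "(\<integral>p. (case p of (p, \<omega>) \<Rightarrow> indicator ?R p * (X \<omega> * Y \<omega>)) \<partial>(spacetime \<Otimes>\<^sub>M M)) =
    (\<integral>p. (\<integral>\<omega>. indicator ?R p * (X \<omega> * Y \<omega>) \<partial>M) \<partial>spacetime)"
    using P.integral_fst'[OF int] by simp
  also have "\<dots> = measure spacetime ?R * (\<integral>\<omega>. X \<omega> * Y \<omega> \<partial>M)"
    using sets.sets_into_space[OF R] by (simp add: Int_absorb2)
  also have "measure spacetime ?R = measure lborel ({a<..b} \<inter> {c<..d}) * measure lborel (A \<inter> B)"
    unfolding measure_def using s1 s2
    by (subst spacetime_rectangle(2)) (auto simp: simple_integrand_def finite_borel_sets_def enn2real_mult)
  finally show ?thesis unfolding eqf using int by (simp add: mult.commute)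
qed

lemma elementary_isometry:
  assumes S: "elementary_process M W S"
  shows "elementary_integral W S \<in> borel_measurable M"
    "(\<lambda>((s, y), \<omega>). elementary_value S s y \<omega>) \<in> borel_measurable (spacetime \<Otimes>\<^sub>M M)"
    "L2_norm_sq M (elementary_integral W S) = L2_norm_sq (spacetime \<Otimes>\<^sub>M M) (\<lambda>((s, y), \<omega>). elementary_value S s y \<omega>)"
proof -
  have mi: "term_integral e \<in> borel_measurable M" if "simple_integrand e" for e
  proof -
    obtain X a b A where e: "e = (X, a, b, A)" by (cases e)
    have "incr a b A \<in> noise_span W all_indices"
      using that by (intro incr_in_span) (auto simp: e simple_integrand_def)
    from span_measurable[OF this] simple_integrand_rectangle(3)[OF that[unfolded e]]
    show ?thesis unfolding e term_integral_def split by (rule borel_measurable_times[rotated])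
  qed
  have mS: "set S \<subseteq> Collect simple_integrand" using S by (auto simp: elementary_process_iff)
  show "elementary_integral W S \<in> borel_measurable M"
    unfolding elementary_integral_eq using mS mi by (induction S) auto
  show "(\<lambda>((s, y), \<omega>). elementary_value S s y \<omega>) \<in> borel_measurable (spacetime \<Otimes>\<^sub>M M)"
    unfolding elementary_value_eq using mS term_value_measurable by (induction S) auto
  have "integrable M (\<lambda>\<omega>. term_integral e \<omega> * term_integral f \<omega>) \<and>
      integrable (spacetime \<Otimes>\<^sub>M M) (\<lambda>\<omega>. term_value e \<omega> * term_value f \<omega>) \<and>
    (\<integral>\<omega>. term_integral e \<omega> * term_integral f \<omega> \<partial>M) = (\<integral>\<omega>. term_value e \<omega> * term_value f \<omega> \<partial>(spacetime \<Otimes>\<^sub>M M))"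
    if "e \<in> Collect simple_integrand" "f \<in> Collect simple_integrand" for e f
  proof -
    obtain X a b A where e: "e = (X, a, b, A)" by (cases e)
    obtain Y c d B where f: "f = (Y, c, d, B)" by (cases f)
    show ?thesis
      using simple_integral_product[of X a b A Y c d B] simple_value_product[of X a b A Y c d B] that
      by (simp add: e f term_integral_def)
  qed
  from sum_list_product_integral[OF this mS mS]
  show "L2_norm_sq M (elementary_integral W S) = L2_norm_sq (spacetime \<Otimes>\<^sub>M M) (\<lambda>((s, y), \<omega>). elementary_value S s y \<omega>)"
    unfolding elementary_value_eq elementary_integral_eq
    by (subst (1 2) L2_norm_sq_integral) (auto simp: power2_eq_square)
qed

text \<open>Elementary integrals and elementary values have equal norms at every stage, and both
  sequences converge in mean square. \<open>L2_norm_sq_limit_le\<close> is applied in both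
  directions.\<close>

lemma walsh_isometry:
  assumes "has_walsh_integral M W f I"
  shows "L2_norm_sq M I = L2_norm_sq (spacetime \<Otimes>\<^sub>M M) (\<lambda>((s, y), \<omega>). f s y \<omega>)"
proof -
  let ?N = "spacetime \<Otimes>\<^sub>M M" and ?f = "\<lambda>((s, y), \<omega>). f s y \<omega>"
  from assms obtain S where S: "\<And>n. elementary_process M W (S n)"
    and f [measurable]: "?f \<in> borel_measurable ?N"
    and l1: "(\<lambda>n. L2_norm_sq ?N (\<lambda>((s, y), \<omega>). elementary_value (S n) s y \<omega> - f s y \<omega>)) \<longlonglongrightarrow> 0"
    and l2: "tendsto_L2 M (\<lambda>n. elementary_integral W (S n)) I sequentially"
    by (auto simp: has_walsh_integral_def)
  define v where "v n = (\<lambda>((s, y), \<omega>). elementary_value (S n) s y \<omega>)" for n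
  define F where "F = ?f"
  have l1': "(\<lambda>n. L2_norm_sq ?N (\<lambda>p. v n p - F p)) \<longlonglongrightarrow> 0"
    using l1 by (simp add: case_prod_unfold v_def F_def)
  have mF: "F \<in> borel_measurable ?N" using f by (simp only: F_def)
  note iso = elementary_isometry[OF S, folded v_def]
  from l2 have I: "I \<in> borel_measurable M" and l2': "(\<lambda>n. L2_norm_sq M (\<lambda>\<omega>. elementary_integral W (S n) \<omega> - I \<omega>)) \<longlonglongrightarrow> 0"
    by (auto simp: tendsto_L2_def L2_space_def)
  have "L2_norm_sq M I \<le> L2_norm_sq ?N F"
    by (rule L2_norm_sq_limit_le[where x="\<lambda>n. elementary_integral W (S n)" and y=v])
      (fact iso I mF l1' l2')+
  moreover have "L2_norm_sq ?N F \<le> L2_norm_sq M I"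
    by (rule L2_norm_sq_limit_le[where y="\<lambda>n. elementary_integral W (S n)" and x=v])
      (fact iso iso(3)[symmetric] I mF l1' l2')+
  ultimately show ?thesis by (simp add: F_def)
qed

text \<open>Concatenation of lists is addition of elementary processes and of their integrals.
  Additivity is what polarization of the isometry requires.\<close>

lemma walsh_add:
  assumes "has_walsh_integral M W f I" "has_walsh_integral M W g J"
  shows "has_walsh_integral M W (\<lambda>s y \<omega>. f s y \<omega> + g s y \<omega>) (\<lambda>\<omega>. I \<omega> + J \<omega>)"
proof -
  let ?N = "spacetime \<Otimes>\<^sub>M M" and ?f = "\<lambda>((s, y), \<omega>). f s y \<omega>" and ?g = "\<lambda>((s, y), \<omega>). g s y \<omega>"
  from assms(1) obtain S where S: "\<And>n. elementary_process M W (S n)"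
    and f [measurable]: "?f \<in> borel_measurable ?N"
    and lf: "(\<lambda>n. L2_norm_sq ?N (\<lambda>((s, y), \<omega>). elementary_value (S n) s y \<omega> - f s y \<omega>)) \<longlonglongrightarrow> 0"
    and lI: "tendsto_L2 M (\<lambda>n. elementary_integral W (S n)) I sequentially"
    by (auto simp: has_walsh_integral_def)
  from assms(2) obtain T where T: "\<And>n. elementary_process M W (T n)"
    and g [measurable]: "?g \<in> borel_measurable ?N"
    and lg: "(\<lambda>n. L2_norm_sq ?N (\<lambda>((s, y), \<omega>). elementary_value (T n) s y \<omega> - g s y \<omega>)) \<longlonglongrightarrow> 0"
    and lJ: "tendsto_L2 M (\<lambda>n. elementary_integral W (T n)) J sequentially"
    by (auto simp: has_walsh_integral_def)
  note [measurable] = elementary_isometry(1,2)[OF S] elementary_isometry(1,2)[OF T]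
  have ST: "elementary_process M W (S n @ T n)" for n
    using S[of n] T[of n] by (auto simp: elementary_process_iff)
  have eqv: "elementary_value (S n @ T n) s y \<omega> = elementary_value (S n) s y \<omega> + elementary_value (T n) s y \<omega>" for n s y \<omega>
    by (simp add: elementary_value_def)
  have eqi: "elementary_integral W (S n @ T n) \<omega> = elementary_integral W (S n) \<omega> + elementary_integral W (T n) \<omega>" for n \<omega>
    by (simp add: elementary_integral_def)
  \<comment> \<open>Used both on the space of integrands and on the probability space, hence the
    arbitrary measure \<open>m\<close>.\<close>
  have lim2: "(\<lambda>n. L2_norm_sq m (\<lambda>p. (x n p + y n p) - (X p + Y p))) \<longlonglongrightarrow> 0"
    if x: "(\<lambda>n. L2_norm_sq m (\<lambda>p. x n p - X p)) \<longlonglongrightarrow> 0" and y: "(\<lambda>n. L2_norm_sq m (\<lambda>p. y n p - Y p)) \<longlonglongrightarrow> 0"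
     and m: "\<And>n. x n \<in> borel_measurable m" "\<And>n. y n \<in> borel_measurable m" "X \<in> borel_measurable m" "Y \<in> borel_measurable m"
     for m :: "'z measure" and x y X Y
  proof (rule tendsto_sandwich[OF _ _ tendsto_const])
    let ?r = "\<lambda>n. ennreal (1 + 1) * L2_norm_sq m (\<lambda>p. x n p - X p) + ennreal (1 + 1/1) * L2_norm_sq m (\<lambda>p. y n p - Y p)"
    show "eventually (\<lambda>n. L2_norm_sq m (\<lambda>p. (x n p + y n p) - (X p + Y p)) \<le> ?r n) sequentially"
    proof (rule always_eventually, rule allI)
      fix n
      have "L2_norm_sq m (\<lambda>p. (x n p + y n p) - (X p + Y p)) = L2_norm_sq m (\<lambda>p. (x n p - X p) + (y n p - Y p))"
        by (simp add: algebra_simps)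
      also have "\<dots> \<le> ?r n" using m by (intro L2_norm_sq_add_le) auto
      finally show "L2_norm_sq m (\<lambda>p. (x n p + y n p) - (X p + Y p)) \<le> ?r n" .
    qed
    have "?r \<longlonglongrightarrow> ennreal (1 + 1) * 0 + ennreal (1 + 1/1) * 0"
      by (intro tendsto_add ennreal_tendsto_cmult x y) auto
    then show "?r \<longlonglongrightarrow> 0" by simp
  qed simp
  have "(\<lambda>((s, y), \<omega>). f s y \<omega> + g s y \<omega>) \<in> borel_measurable ?N"
    using borel_measurable_add[OF f g] by (simp add: case_prod_unfold)
  moreover have "(\<lambda>n. L2_norm_sq ?N (\<lambda>((s, y), \<omega>). elementary_value (S n @ T n) s y \<omega> - (f s y \<omega> + g s y \<omega>))) \<longlonglongrightarrow> 0"
    using lim2[of ?N "\<lambda>n. (\<lambda>((s, y), \<omega>). elementary_value (S n) s y \<omega>)" ?f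
        "\<lambda>n. (\<lambda>((s, y), \<omega>). elementary_value (T n) s y \<omega>)" ?g] lf lg f g
      elementary_isometry(2)[OF S] elementary_isometry(2)[OF T]
    by (simp add: case_prod_unfold eqv)
  moreover have "tendsto_L2 M (\<lambda>n. elementary_integral W (S n @ T n)) (\<lambda>\<omega>. I \<omega> + J \<omega>) sequentially"
  proof -
    have I: "I \<in> L2_space M" "J \<in> L2_space M" using lI lJ by (auto simp: tendsto_L2_def)
    then have [measurable]: "I \<in> borel_measurable M" "J \<in> borel_measurable M" by (auto simp: L2_space_def)
    have sum: "(\<lambda>\<omega>. X \<omega> + Y \<omega>) \<in> L2_space M" if "X \<in> L2_space M" "Y \<in> L2_space M" for X Y
    proof -
      have m: "X \<in> borel_measurable M" "Y \<in> borel_measurable M" using that by (auto simp: L2_space_def)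
      have "ennreal (1 + 1) * L2_norm_sq M X + ennreal (1 + 1/1) * L2_norm_sq M Y < \<infinity>"
        using that by (simp add: L2_space_def ennreal_mult_less_top)
      with L2_norm_sq_add_le[OF zero_less_one m] show ?thesis using m by (auto simp: L2_space_def intro: le_less_trans)
    qed
    have "eventually (\<lambda>n. elementary_integral W (S n @ T n) \<in> L2_space M) sequentially"
    proof -
      have "eventually (\<lambda>n. elementary_integral W (S n) \<in> L2_space M) sequentially"
        "eventually (\<lambda>n. elementary_integral W (T n) \<in> L2_space M) sequentially"
        using lI lJ by (simp_all add: tendsto_L2_def)
      then show ?thesis by eventually_elim (simp add: eqi[abs_def] sum)
    qed
    moreover have "(\<lambda>n. L2_norm_sq M (\<lambda>\<omega>. elementary_integral W (S n @ T n) \<omega> - (I \<omega> + J \<omega>))) \<longlonglongrightarrow> 0"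
      unfolding eqi using lI lJ by (intro lim2) (auto simp: tendsto_L2_def)
    ultimately show ?thesis using sum[OF I] by (simp add: tendsto_L2_def)
  qed
  ultimately show ?thesis unfolding has_walsh_integral_def using ST by (intro conjI exI[of _ "\<lambda>n. S n @ T n"]) auto
qed

text \<open>The definition places the integral \<open>I\<close> in mean square; the isometry carries
  this finiteness over to the integrand, and the extended-valued identity becomes one between real
  integrals.\<close>

lemma walsh_square_integrable:
  assumes "has_walsh_integral M W f I"
  shows "I \<in> borel_measurable M" "integrable M (\<lambda>\<omega>. (I \<omega>)\<^sup>2)"
    "integrable (spacetime \<Otimes>\<^sub>M M) (\<lambda>p. ((\<lambda>((s, y), \<omega>). f s y \<omega>) p)\<^sup>2)"
    "(\<integral>\<omega>. (I \<omega>)\<^sup>2 \<partial>M) = (\<integral>p. ((\<lambda>((s, y), \<omega>). f s y \<omega>) p)\<^sup>2 \<partial>(spacetime \<Otimes>\<^sub>M M))"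
proof -
  have I: "I \<in> L2_space M" and f: "(\<lambda>((s, y), \<omega>). f s y \<omega>) \<in> borel_measurable (spacetime \<Otimes>\<^sub>M M)"
    using assms by (auto simp: has_walsh_integral_def tendsto_L2_def)
  then show m: "I \<in> borel_measurable M" by (simp add: L2_space_def)
  show i: "integrable M (\<lambda>\<omega>. (I \<omega>)\<^sup>2)" using I L2_norm_sq_finite_iff[OF m] by (simp add: L2_space_def)
  show j: "integrable (spacetime \<Otimes>\<^sub>M M) (\<lambda>p. ((\<lambda>((s, y), \<omega>). f s y \<omega>) p)\<^sup>2)"
    using I L2_norm_sq_finite_iff[OF f] walsh_isometry[OF assms] by (simp add: L2_space_def)
  show "(\<integral>\<omega>. (I \<omega>)\<^sup>2 \<partial>M) = (\<integral>p. ((\<lambda>((s, y), \<omega>). f s y \<omega>) p)\<^sup>2 \<partial>(spacetime \<Otimes>\<^sub>M M))"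
    using walsh_isometry[OF assms] unfolding L2_norm_sq_integral[OF i] L2_norm_sq_integral[OF j]
    by (subst (asm) ennreal_inj) auto
qed

lemma walsh_covariance:
  assumes f: "has_walsh_integral M W f I" and g: "has_walsh_integral M W g J"
  shows "(\<integral>\<omega>. I \<omega> * J \<omega> \<partial>M) = (\<integral>p. (\<lambda>((s, y), \<omega>). f s y \<omega> * g s y \<omega>) p \<partial>(spacetime \<Otimes>\<^sub>M M))"
proof -
  let ?N = "spacetime \<Otimes>\<^sub>M M" and ?f = "\<lambda>((s, y), \<omega>). f s y \<omega>" and ?g = "\<lambda>((s, y), \<omega>). g s y \<omega>"
  have sq: "2 * (\<integral>p. X p * Y p \<partial>m) = (\<integral>p. (X p + Y p)\<^sup>2 \<partial>m) - (\<integral>p. (X p)\<^sup>2 \<partial>m) - (\<integral>p. (Y p)\<^sup>2 \<partial>m)"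
    if "X \<in> borel_measurable m" "Y \<in> borel_measurable m" "integrable m (\<lambda>p. (X p)\<^sup>2)" "integrable m (\<lambda>p. (Y p)\<^sup>2)" for m :: "'z measure" and X Y :: "'z \<Rightarrow> real"
  proof -
    have "(\<integral>p. (X p + Y p)\<^sup>2 \<partial>m) = (\<integral>p. (X p)\<^sup>2 + (Y p)\<^sup>2 + 2 * (X p * Y p) \<partial>m)"
      by (simp add: power2_sum mult.assoc)
    then show ?thesis using integrable_mult_L2[OF that] that by simp
  qed
  have mf: "?f \<in> borel_measurable ?N" "?g \<in> borel_measurable ?N" using f g by (auto simp: has_walsh_integral_def)
  note wf = walsh_square_integrable[OF f] and wg = walsh_square_integrable[OF g] 
    and wfg = walsh_square_integrable[OF walsh_add[OF f g]]
  have "2 * (\<integral>\<omega>. I \<omega> * J \<omega> \<partial>M) = (\<integral>p. (?f p + ?g p)\<^sup>2 \<partial>?N) - (\<integral>p. (?f p)\<^sup>2 \<partial>?N) - (\<integral>p. (?g p)\<^sup>2 \<partial>?N)"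
    unfolding sq[OF wf(1) wg(1) wf(2) wg(2)] wf(4) wg(4) wfg(4) by (simp add: case_prod_unfold)
  also have "\<dots> = 2 * (\<integral>p. ?f p * ?g p \<partial>?N)"
    by (rule sq[OF mf wf(3) wg(3), symmetric])
  finally show ?thesis by (simp add: case_prod_unfold)
qed

end

section \<open>The heat flow of a measure\<close>

text \<open>Valid for every \<open>f\<close>: the integral of a non-integrable function is 0 by
  convention.\<close>

lemma integral_norm_le_nn_integral:
  fixes f :: "'a \<Rightarrow> real"
  shows "ennreal (norm (integral\<^sup>L M f)) \<le> (\<integral>\<^sup>+x. ennreal (norm (f x)) \<partial>M)"
  using integral_norm_bound_ennreal[of M f] by (cases "integrable M f") (auto simp: not_integrable_integral_eq)

lemma heat_kernel_eq_normal_density: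
  assumes "\<nu> > 0" "t > 0"
  shows "heat_kernel \<nu> t (x - y) = normal_density y (sqrt (\<nu> * t)) x"
  using assms by (simp add: heat_kernel_def normal_density_def mult.assoc)

text \<open>Division by \<open>sqrt 0\<close> yields 0. Thanks to this default value the kernel
  bounds below hold on closed time intervals, including s = t.\<close>

lemma heat_kernel_zero [simp]: "heat_kernel \<nu> 0 x = 0"
  by (simp add: heat_kernel_def)

lemma heat_kernel_nonneg: "\<nu> > 0 \<Longrightarrow> t \<ge> 0 \<Longrightarrow> 0 \<le> heat_kernel \<nu> t x"
  by (simp add: heat_kernel_def)

lemma heat_kernel_uminus [simp]: "heat_kernel \<nu> t (- x) = heat_kernel \<nu> t x"
  by (simp add: heat_kernel_def)

lemma heat_kernel_measurable [measurable]:
  assumes [measurable]: "f \<in> borel_measurable M" "g \<in> borel_measurable M"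
  shows "(\<lambda>x. heat_kernel \<nu> (f x) (g x)) \<in> borel_measurable M"
  unfolding heat_kernel_def by measurable

text \<open>The mass is 1 for positive times and 0 at the default value t = 0, hence an
  inequality.\<close>

lemma heat_kernel_mass:
  assumes "\<nu> > 0" "t \<ge> 0"
  shows "(\<integral>\<^sup>+ x. heat_kernel \<nu> t (x - y) \<partial>lborel) \<le> 1"
proof (cases "t = 0")
  case False
  then have t: "t > 0" using assms by simp
  have "(\<integral>\<^sup>+ x. heat_kernel \<nu> t (x - y) \<partial>lborel) = ennreal (\<integral>x. normal_density y (sqrt (\<nu> * t)) x \<partial>lborel)"
    unfolding heat_kernel_eq_normal_density[OF assms(1) t] using t assms
    by (intro nn_integral_eq_integral) auto
  then show ?thesis using t assms by simp
qed simp

text \<open>The exponent is split into two equal halves, one of which belongs to the kernel at time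
  2r; \<open>sqrt 2\<close> is the ratio of the normalizing factors at times r and 2r.\<close>

lemma heat_kernel_halving:
  assumes "\<nu> > 0" "0 \<le> r"
  shows "heat_kernel \<nu> r z = sqrt 2 * exp (- z\<^sup>2 / (4 * \<nu> * r)) * heat_kernel \<nu> (2 * r) z"
proof (cases "r = 0")
  case False
  then have r: "r > 0" using assms by simp
  have s: "sqrt (2 * pi * \<nu> * (2 * r)) = sqrt 2 * sqrt (2 * pi * \<nu> * r)"
    by (simp add: real_sqrt_mult[symmetric] mult_ac)
  have e: "exp (- z\<^sup>2 / (2 * \<nu> * r)) = exp (- z\<^sup>2 / (4 * \<nu> * r)) * exp (- z\<^sup>2 / (2 * \<nu> * (2 * r)))"
    unfolding exp_add[symmetric] using r assms by (simp add: field_simps)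
  show ?thesis unfolding heat_kernel_def s e by simp
qed simp

text \<open>On the support of a test function the heat kernel has a Gaussian bound that is uniform in \<open>r \<le> t\<close>,
  even though \<open>r\<close> may tend to 0: half of the exponent is given away, which leaves a kernel of
  mass 1.\<close>

lemma heat_kernel_localized:
  assumes "\<nu> > 0" "0 \<le> r" "r \<le> t" "0 < t" "\<bar>x\<bar> \<le> a"
  shows "heat_kernel \<nu> r (x - y) \<le> sqrt 2 * exp (a\<^sup>2 / (4 * \<nu> * t)) * exp (- y\<^sup>2 / (8 * \<nu> * t)) * heat_kernel \<nu> (2 * r) (x - y)"
proof (cases "r = 0")
  case False
  then have r: "r > 0" using assms by simp
  have "x\<^sup>2 \<le> a\<^sup>2" using assms by (intro abs_le_square_iff[THEN iffD1]) auto
  \<comment> \<open>Decay in x - y becomes decay in y. The factor 2 lost here turns the denominator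
    4 \<nu> t into the 8 \<nu> t of the statement.\<close>
  moreover have "y\<^sup>2 \<le> 2 * (x - y)\<^sup>2 + 2 * x\<^sup>2"
    using zero_le_power2[of "y - 2 * x"] by (simp add: power2_eq_square algebra_simps)
  ultimately have "y\<^sup>2 / 2 - a\<^sup>2 \<le> (x - y)\<^sup>2" by simp
  then have "(y\<^sup>2 / 2 - a\<^sup>2) / (4 * \<nu> * t) \<le> (x - y)\<^sup>2 / (4 * \<nu> * t)"
    using assms by (intro divide_right_mono) auto
  also have "\<dots> \<le> (x - y)\<^sup>2 / (4 * \<nu> * r)"
    using assms r by (intro divide_left_mono) auto
  finally have "- (x - y)\<^sup>2 / (4 * \<nu> * r) \<le> a\<^sup>2 / (4 * \<nu> * t) + - y\<^sup>2 / (8 * \<nu> * t)"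
    by (simp add: diff_divide_distrib)
  then have "exp (- (x - y)\<^sup>2 / (4 * \<nu> * r)) \<le> exp (a\<^sup>2 / (4 * \<nu> * t)) * exp (- y\<^sup>2 / (8 * \<nu> * t))"
    unfolding exp_add[symmetric] by simp
  then show ?thesis
    unfolding heat_kernel_halving[OF assms(1,2), of "x - y"] mult.assoc using assms
    by (simp only: mult.assoc[symmetric]) (intro mult_right_mono mult_left_mono heat_kernel_nonneg, auto)
qed simp

text \<open>The prefactor of the Gaussian majorant for a function bounded by \<open>K\<close> and
  supported in [-a, a]. It is the same for all kernel times up to \<open>t\<close>.\<close>

definition localized_const :: "real \<Rightarrow> real \<Rightarrow> real \<Rightarrow> real \<Rightarrow> real" where
  "localized_const \<nu> a K t = K * (sqrt 2 * exp (a\<^sup>2 / (4 * \<nu> * t)))"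

text \<open>The pointwise bound of the kernel on the support takes the Gaussian in \<open>y\<close>
  out of the integral, and the remaining kernel at time 2r has mass at most 1. The bound serves
  twice: as majorant with respect to the initial measure and in the estimate of the noise.\<close>

lemma heat_flow_localized:
  fixes \<phi> :: "real \<Rightarrow> real"
  assumes "\<nu> > 0" "0 \<le> r" "r \<le> t" "0 < t"
    and [measurable]: "\<phi> \<in> borel_measurable borel"
    and \<phi>: "\<And>x. \<bar>\<phi> x\<bar> \<le> K" "\<And>x. \<phi> x \<noteq> 0 \<Longrightarrow> \<bar>x\<bar> \<le> a"
  shows "(\<integral>\<^sup>+ x. ennreal (\<bar>\<phi> x\<bar> * heat_kernel \<nu> r (x - y)) \<partial>lborel) \<le>
    ennreal (localized_const \<nu> a K t * exp (- y\<^sup>2 / (8 * \<nu> * t)))"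
proof -
  let ?c = "localized_const \<nu> a K t * exp (- y\<^sup>2 / (8 * \<nu> * t))"
  have K: "K \<ge> 0" using \<phi>(1)[of 0] by simp
  have c: "?c \<ge> 0" using K by (simp add: localized_const_def)
  have "(\<integral>\<^sup>+ x. ennreal (\<bar>\<phi> x\<bar> * heat_kernel \<nu> r (x - y)) \<partial>lborel) \<le>
    (\<integral>\<^sup>+ x. ennreal ?c * ennreal (heat_kernel \<nu> (2 * r) (x - y)) \<partial>lborel)"
  proof (rule nn_integral_mono)
    fix x
    have g: "0 \<le> heat_kernel \<nu> (2 * r) (x - y)" "0 \<le> heat_kernel \<nu> r (x - y)" using assms by (auto intro: heat_kernel_nonneg)
    have "\<bar>\<phi> x\<bar> * heat_kernel \<nu> r (x - y) \<le> ?c * heat_kernel \<nu> (2 * r) (x - y)"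
    proof (cases "\<phi> x = 0")
      case False
      then have "\<bar>\<phi> x\<bar> * heat_kernel \<nu> r (x - y) \<le> K * (sqrt 2 * exp (a\<^sup>2 / (4 * \<nu> * t)) * exp (- y\<^sup>2 / (8 * \<nu> * t)) * heat_kernel \<nu> (2 * r) (x - y))"
        using assms K g by (intro mult_mono heat_kernel_localized \<phi>) auto
      then show ?thesis by (simp add: localized_const_def mult.assoc)
    qed (use c g in simp)
    then show "ennreal (\<bar>\<phi> x\<bar> * heat_kernel \<nu> r (x - y)) \<le> ennreal ?c * ennreal (heat_kernel \<nu> (2 * r) (x - y))"
      using c g by (simp add: ennreal_leI flip: ennreal_mult)
  qed
  also have "\<dots> = ennreal ?c * (\<integral>\<^sup>+ x. ennreal (heat_kernel \<nu> (2 * r) (x - y)) \<partial>lborel)"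
    by (rule nn_integral_cmult) measurable
  also have "\<dots> \<le> ennreal ?c * 1"
    using assms by (intro mult_left_mono heat_kernel_mass) auto
  finally show ?thesis by simp
qed

text \<open>The substitution x = y + \<sigma> z, with \<sigma> the standard deviation of the kernel,
  moves the time dependence from the kernel into the argument of \<phi>. A multiple of the fixed
  standard normal density then dominates.\<close>

lemma heat_flow_tendsto:
  fixes \<phi> :: "real \<Rightarrow> real"
  assumes "\<nu> > 0" and cont: "continuous_on UNIV \<phi>" and bound: "\<And>x. \<bar>\<phi> x\<bar> \<le> K"
    and t: "\<And>n. t n > 0" "t \<longlonglongrightarrow> 0"
  shows "(\<lambda>n. \<integral>x. \<phi> x * heat_kernel \<nu> (t n) (x - y) \<partial>lborel) \<longlonglongrightarrow> \<phi> y"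
proof -
  have [measurable]: "\<phi> \<in> borel_measurable borel" by (rule borel_measurable_continuous_onI[OF cont])
  define \<sigma> where "\<sigma> n = sqrt (\<nu> * t n)" for n
  have \<sigma>: "\<sigma> n > 0" for n using assms by (simp add: \<sigma>_def)
  have \<sigma>0: "\<sigma> \<longlonglongrightarrow> 0"
    using tendsto_real_sqrt[OF tendsto_mult_left[OF t(2), of \<nu>]] by (simp add: \<sigma>_def[abs_def])
  have eq: "(\<integral>x. \<phi> x * heat_kernel \<nu> (t n) (x - y) \<partial>lborel) = (\<integral>z. \<phi> (y + \<sigma> n * z) * std_normal_density z \<partial>lborel)" for n
  proof -
    have "(\<integral>x. \<phi> x * heat_kernel \<nu> (t n) (x - y) \<partial>lborel) = (\<integral>x. \<phi> x * normal_density y (\<sigma> n) x \<partial>lborel)"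
      using heat_kernel_eq_normal_density[OF assms(1) t(1)] by (simp add: \<sigma>_def)
    also have "\<dots> = \<bar>\<sigma> n\<bar> *\<^sub>R (\<integral>z. \<phi> (y + \<sigma> n * z) * normal_density y (\<sigma> n) (y + \<sigma> n * z) \<partial>lborel)"
      using \<sigma>[of n] by (intro lborel_integral_real_affine) simp
    also have "\<dots> = (\<integral>z. \<sigma> n * (\<phi> (y + \<sigma> n * z) * normal_density y (\<sigma> n) (y + \<sigma> n * z)) \<partial>lborel)"
      using \<sigma>[of n] by simp
    also have "\<dots> = (\<integral>z. \<phi> (y + \<sigma> n * z) * std_normal_density z \<partial>lborel)"
    proof (rule Bochner_Integration.integral_cong)
      fix z
      have "\<sigma> n * normal_density y (\<sigma> n) (y + \<sigma> n * z) = std_normal_density z"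
        using \<sigma>[of n] by (simp add: normal_density_def real_sqrt_mult power_mult_distrib)
      then show "\<sigma> n * (\<phi> (y + \<sigma> n * z) * normal_density y (\<sigma> n) (y + \<sigma> n * z)) = \<phi> (y + \<sigma> n * z) * std_normal_density z"
        by (metis mult.left_commute)
    qed simp
    finally show ?thesis .
  qed
  have "(\<lambda>n. \<integral>z. \<phi> (y + \<sigma> n * z) * std_normal_density z \<partial>lborel) \<longlonglongrightarrow> (\<integral>z. \<phi> y * std_normal_density z \<partial>lborel)"
  proof (rule integral_dominated_convergence)
    show "integrable lborel (\<lambda>z. K * std_normal_density z)" by simp
    show "AE z in lborel. (\<lambda>n. \<phi> (y + \<sigma> n * z) * std_normal_density z) \<longlonglongrightarrow> \<phi> y * std_normal_density z"
    proof (rule AE_I2)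
      fix z
      have "(\<lambda>n. y + \<sigma> n * z) \<longlonglongrightarrow> y + 0 * z" by (intro tendsto_intros \<sigma>0)
      then have "(\<lambda>n. \<phi> (y + \<sigma> n * z)) \<longlonglongrightarrow> \<phi> y"
        using cont by (intro isCont_tendsto_compose[of _ \<phi>]) (auto simp: continuous_on_eq_continuous_at)
      then show "(\<lambda>n. \<phi> (y + \<sigma> n * z) * std_normal_density z) \<longlonglongrightarrow> \<phi> y * std_normal_density z"
        by (intro tendsto_intros)
    qed
    show "AE z in lborel. norm (\<phi> (y + \<sigma> n * z) * std_normal_density z) \<le> K * std_normal_density z" for n
      using bound by (auto simp: abs_mult intro!: mult_right_mono)
  qed measurable
  then show ?thesis unfolding eq by simp
qed

text \<open>Fubini transfers the heat kernel from the measure to \<phi>. The smoothed test function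
  no longer has bounded support, but its Gaussian tail is integrable by the growth condition
  \<open>fin\<close>. The signed case is a difference of two such statements.\<close>

lemma heat_flow_measure:
  fixes \<phi> :: "real \<Rightarrow> real" and P :: "real measure"
  assumes "\<nu> > 0" and sets [measurable_cong]: "sets P = sets borel" and sf: "sigma_finite_measure P"
    and fin: "\<And>b. b > 0 \<Longrightarrow> (\<integral>\<^sup>+ x. ennreal (exp (- b * x\<^sup>2)) \<partial>P) < \<infinity>"
    and cont: "continuous_on UNIV \<phi>"
    and \<phi>: "\<And>x. \<bar>\<phi> x\<bar> \<le> K" "\<And>x. \<phi> x \<noteq> 0 \<Longrightarrow> \<bar>x\<bar> \<le> a"
  shows "\<And>t. t > 0 \<Longrightarrow> integrable lborel (\<lambda>x. \<phi> x * (\<integral>y. heat_kernel \<nu> t (x - y) \<partial>P))"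
    and "\<And>t. (\<And>n. t n > 0) \<Longrightarrow> t \<longlonglongrightarrow> 0 \<Longrightarrow>
      (\<lambda>n. \<integral>x. \<phi> x * (\<integral>y. heat_kernel \<nu> (t n) (x - y) \<partial>P) \<partial>lborel) \<longlonglongrightarrow> (\<integral>y. \<phi> y \<partial>P)"
proof -
  have [measurable]: "\<phi> \<in> borel_measurable borel" by (rule borel_measurable_continuous_onI[OF cont])
  interpret P: sigma_finite_measure P by fact
  interpret LP: pair_sigma_finite lborel P by standard
  have K: "K \<ge> 0" using \<phi>(1)[of 0] by simp
  have dom: "(\<integral>\<^sup>+ x. ennreal (\<bar>\<phi> x\<bar> * heat_kernel \<nu> r (x - y)) \<partial>lborel) \<le> ennreal (localized_const \<nu> a K t * exp (- y\<^sup>2 / (8 * \<nu> * t)))"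
    if "0 < r" "r \<le> t" for r t y
    using that assms(1) \<phi> by (intro heat_flow_localized) auto
  have int: "integrable (lborel \<Otimes>\<^sub>M P) (\<lambda>(x, y). \<phi> x * heat_kernel \<nu> t (x - y))" if t: "t > 0" for t
  proof (rule integrableI_bounded)
    have "(\<integral>\<^sup>+ p. ennreal (norm (case p of (x, y) \<Rightarrow> \<phi> x * heat_kernel \<nu> t (x - y))) \<partial>(lborel \<Otimes>\<^sub>M P)) =
      (\<integral>\<^sup>+ y. (\<integral>\<^sup>+ x. ennreal (norm (\<phi> x * heat_kernel \<nu> t (x - y))) \<partial>lborel) \<partial>P)"
      by (subst LP.nn_integral_snd[symmetric]) auto
    also have "\<dots> = (\<integral>\<^sup>+ y. (\<integral>\<^sup>+ x. ennreal (\<bar>\<phi> x\<bar> * heat_kernel \<nu> t (x - y)) \<partial>lborel) \<partial>P)"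
      using heat_kernel_nonneg[of \<nu> t] assms(1) t by (simp add: abs_mult)
    also have "\<dots> \<le> (\<integral>\<^sup>+ y. ennreal (localized_const \<nu> a K t) * ennreal (exp (- (1 / (8 * \<nu> * t)) * y\<^sup>2)) \<partial>P)"
    proof (rule nn_integral_mono)
      fix y
      show "(\<integral>\<^sup>+ x. ennreal (\<bar>\<phi> x\<bar> * heat_kernel \<nu> t (x - y)) \<partial>lborel) \<le> ennreal (localized_const \<nu> a K t) * ennreal (exp (- (1 / (8 * \<nu> * t)) * y\<^sup>2))"
        using dom[of t t y] t K by (simp add: localized_const_def flip: ennreal_mult)
    qed
    also have "\<dots> = ennreal (localized_const \<nu> a K t) * (\<integral>\<^sup>+ y. ennreal (exp (- (1 / (8 * \<nu> * t)) * y\<^sup>2)) \<partial>P)"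
      by (rule nn_integral_cmult) measurable
    also have "\<dots> < \<infinity>" using fin[of "1 / (8 * \<nu> * t)"] t assms(1) by (simp add: ennreal_mult_less_top)
    finally show "(\<integral>\<^sup>+ p. ennreal (norm (case p of (x, y) \<Rightarrow> \<phi> x * heat_kernel \<nu> t (x - y))) \<partial>(lborel \<Otimes>\<^sub>M P)) < \<infinity>" .
  qed measurable
  show "integrable lborel (\<lambda>x. \<phi> x * (\<integral>y. heat_kernel \<nu> t (x - y) \<partial>P))" if t: "t > 0" for t
    using LP.integrable_fst'[OF int[OF t]] by simp
  fix t :: "nat \<Rightarrow> real" assume t: "\<And>n. t n > 0" "t \<longlonglongrightarrow> 0"
  have swap: "(\<integral>x. \<phi> x * (\<integral>y. heat_kernel \<nu> (t n) (x - y) \<partial>P) \<partial>lborel) = (\<integral>y. (\<integral>x. \<phi> x * heat_kernel \<nu> (t n) (x - y) \<partial>lborel) \<partial>P)" for n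
    using LP.Fubini_integral[of "\<lambda>x y. \<phi> x * heat_kernel \<nu> (t n) (x - y)", OF int[OF t(1)]] by simp
  \<comment> \<open>A bound of the whole sequence of times gives one Gaussian majorant for all
    \<open>n\<close>, since \<open>heat_flow_localized\<close> is uniform in the times up to
    \<open>C\<close>.\<close>
  obtain C where C: "\<And>n. t n \<le> C" "C > 0"
  proof -
    obtain B where "\<And>n. \<bar>t n\<bar> \<le> B" using convergent_imp_Bseq[of t] t(2) by (auto simp: Bseq_def convergent_def)
    then show ?thesis using t(1)[of 0] that[of B] by (meson abs_ge_self less_le_trans order_trans)
  qed
  let ?w = "\<lambda>y. localized_const \<nu> a K C * exp (- (1 / (8 * \<nu> * C)) * y\<^sup>2)"
  show "(\<lambda>n. \<integral>x. \<phi> x * (\<integral>y. heat_kernel \<nu> (t n) (x - y) \<partial>P) \<partial>lborel) \<longlonglongrightarrow> (\<integral>y. \<phi> y \<partial>P)"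
    unfolding swap
  proof (rule integral_dominated_convergence[where w="?w"])
    have "integrable P (\<lambda>y. exp (- (1 / (8 * \<nu> * C)) * y\<^sup>2))"
      using fin[of "1 / (8 * \<nu> * C)"] C assms(1) by (intro integrableI_bounded) auto
    then show "integrable P ?w" by (rule integrable_mult_right)
    show "AE y in P. (\<lambda>n. \<integral>x. \<phi> x * heat_kernel \<nu> (t n) (x - y) \<partial>lborel) \<longlonglongrightarrow> \<phi> y"
      using heat_flow_tendsto[OF assms(1) cont \<phi>(1) t] by simp
    show "AE y in P. norm (\<integral>x. \<phi> x * heat_kernel \<nu> (t n) (x - y) \<partial>lborel) \<le> ?w y" for n
    proof (rule AE_I2)
      fix y
      have "ennreal (norm (\<integral>x. \<phi> x * heat_kernel \<nu> (t n) (x - y) \<partial>lborel)) \<le> (\<integral>\<^sup>+x. ennreal (norm (\<phi> x * heat_kernel \<nu> (t n) (x - y))) \<partial>lborel)"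
        by (rule integral_norm_le_nn_integral)
      also have "\<dots> = (\<integral>\<^sup>+ x. ennreal (\<bar>\<phi> x\<bar> * heat_kernel \<nu> (t n) (x - y)) \<partial>lborel)"
        using heat_kernel_nonneg[of \<nu> "t n"] assms(1) t(1)[of n] by (simp add: abs_mult)
      also have "\<dots> \<le> ennreal (?w y)"
        using dom[OF t(1) C(1), of n y] by simp
      finally show "norm (\<integral>x. \<phi> x * heat_kernel \<nu> (t n) (x - y) \<partial>lborel) \<le> ?w y"
        using K by (simp add: localized_const_def)
    qed
  qed (simp_all add: swap, measurable)
qed

section \<open>Signed measures and test functions\<close>

lemma jordan_sigma_finite:
  assumes "jordan_decomposition \<mu> P N"
  shows "sigma_finite_measure P" "sigma_finite_measure N"
proof -
  have "sigma_finite_measure Q" if s: "sets Q = sets borel" and f: "\<And>A. A \<in> sets borel \<Longrightarrow> bounded A \<Longrightarrow> emeasure Q A < \<infinity>" for Q :: "real measure"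
  proof
    have sp: "space Q = UNIV" using sets_eq_imp_space_eq[OF s] by simp
    have "(\<Union>n. {- real n..real n}) = UNIV"
    proof (rule UNIV_eq_I[symmetric])
      fix x :: real
      obtain n :: nat where "\<bar>x\<bar> \<le> real n" using real_arch_simple by blast
      then show "x \<in> (\<Union>n. {- real n..real n})" by (intro UN_I[of n]) auto
    qed
    then show "\<exists>A. countable A \<and> A \<subseteq> sets Q \<and> \<Union> A = space Q \<and> (\<forall>a\<in>A. emeasure Q a \<noteq> \<infinity>)"
      using f by (intro exI[of _ "range (\<lambda>n. {- real n..real n})"]) (auto simp: s sp less_top)
  qed
  then show "sigma_finite_measure P" "sigma_finite_measure N"
    using assms by (auto simp: jordan_decomposition_def)
qed

lemma M_H_parts:
  assumes "\<mu> \<in> M_H"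
  shows "sets (pos_measure \<mu>) = sets borel" "sets (neg_measure \<mu>) = sets borel"
    "sigma_finite_measure (pos_measure \<mu>)" "sigma_finite_measure (neg_measure \<mu>)"
    "\<And>b. b > 0 \<Longrightarrow> (\<integral>\<^sup>+ x. ennreal (exp (- b * x\<^sup>2)) \<partial>pos_measure \<mu>) < \<infinity>"
    "\<And>b. b > 0 \<Longrightarrow> (\<integral>\<^sup>+ x. ennreal (exp (- b * x\<^sup>2)) \<partial>neg_measure \<mu>) < \<infinity>"
proof -
  obtain P N where "jordan_decomposition \<mu> P N" using assms by (auto simp: M_H_def)
  then have "case (SOME (P, N). jordan_decomposition \<mu> P N) of (P, N) \<Rightarrow> jordan_decomposition \<mu> P N"
    by (intro someI[of "\<lambda>(P, N). jordan_decomposition \<mu> P N" "(P, N)"]) simp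
  then have j: "jordan_decomposition \<mu> (pos_measure \<mu>) (neg_measure \<mu>)"
    unfolding pos_measure_def neg_measure_def by (simp add: case_prod_unfold)
  then show "sets (pos_measure \<mu>) = sets borel" "sets (neg_measure \<mu>) = sets borel"
    by (simp_all add: jordan_decomposition_def)
  show "sigma_finite_measure (pos_measure \<mu>)" "sigma_finite_measure (neg_measure \<mu>)"
    using jordan_sigma_finite[OF j] .
  fix b :: real assume "b > 0"
  then have "(\<integral>\<^sup>+ x. ennreal (exp (- b * x\<^sup>2)) \<partial>pos_measure \<mu>) + (\<integral>\<^sup>+ x. ennreal (exp (- b * x\<^sup>2)) \<partial>neg_measure \<mu>) < \<infinity>"
    using assms by (simp add: M_H_def)
  then show "(\<integral>\<^sup>+ x. ennreal (exp (- b * x\<^sup>2)) \<partial>pos_measure \<mu>) < \<infinity>"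
    "(\<integral>\<^sup>+ x. ennreal (exp (- b * x\<^sup>2)) \<partial>neg_measure \<mu>) < \<infinity>"
    by simp_all
qed

lemma heat_flow_signed_measure:
  fixes \<phi> :: "real \<Rightarrow> real"
  assumes "\<nu> > 0" and \<mu>: "\<mu> \<in> M_H" and cont: "continuous_on UNIV \<phi>"
    and \<phi>: "\<And>x. \<bar>\<phi> x\<bar> \<le> K" "\<And>x. \<phi> x \<noteq> 0 \<Longrightarrow> \<bar>x\<bar> \<le> a"
  shows "\<And>t. (\<lambda>x. signed_integral \<mu> (\<lambda>y. heat_kernel \<nu> t (x - y))) \<in> borel_measurable borel"
    and "\<And>t. t > 0 \<Longrightarrow> integrable lborel (\<lambda>x. signed_integral \<mu> (\<lambda>y. heat_kernel \<nu> t (x - y)) * \<phi> x)"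
    and "\<And>t. (\<And>n. t n > 0) \<Longrightarrow> t \<longlonglongrightarrow> 0 \<Longrightarrow>
      (\<lambda>n. \<integral>x. signed_integral \<mu> (\<lambda>y. heat_kernel \<nu> (t n) (x - y)) * \<phi> x \<partial>lborel) \<longlonglongrightarrow> signed_integral \<mu> \<phi>"
proof -
  note p = M_H_parts[OF \<mu>]
  note [measurable_cong] = p(1,2)
  interpret P: sigma_finite_measure "pos_measure \<mu>" by (rule p(3))
  interpret N: sigma_finite_measure "neg_measure \<mu>" by (rule p(4))
  have P: "integrable lborel (\<lambda>x. \<phi> x * (\<integral>y. heat_kernel \<nu> t (x - y) \<partial>pos_measure \<mu>))" if "t > 0" for t
    by (rule heat_flow_measure(1)[OF assms(1) p(1) p(3) _ cont _ _ that]) (fact p \<phi>)+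
  have N: "integrable lborel (\<lambda>x. \<phi> x * (\<integral>y. heat_kernel \<nu> t (x - y) \<partial>neg_measure \<mu>))" if "t > 0" for t
    by (rule heat_flow_measure(1)[OF assms(1) p(2) p(4) _ cont _ _ that]) (fact p \<phi>)+
  show "(\<lambda>x. signed_integral \<mu> (\<lambda>y. heat_kernel \<nu> t (x - y))) \<in> borel_measurable borel" for t
    unfolding signed_integral_def by measurable
  have eq: "signed_integral \<mu> (\<lambda>y. heat_kernel \<nu> t (x - y)) * \<phi> x =
    \<phi> x * (\<integral>y. heat_kernel \<nu> t (x - y) \<partial>pos_measure \<mu>) - \<phi> x * (\<integral>y. heat_kernel \<nu> t (x - y) \<partial>neg_measure \<mu>)" for t x
    by (simp add: signed_integral_def algebra_simps)
  show "integrable lborel (\<lambda>x. signed_integral \<mu> (\<lambda>y. heat_kernel \<nu> t (x - y)) * \<phi> x)" if "t > 0" for t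
    unfolding eq using P[OF that] N[OF that] by (rule Bochner_Integration.integrable_diff)
  fix t :: "nat \<Rightarrow> real" assume t: "\<And>n. t n > 0" "t \<longlonglongrightarrow> 0"
  show "(\<lambda>n. \<integral>x. signed_integral \<mu> (\<lambda>y. heat_kernel \<nu> (t n) (x - y)) * \<phi> x \<partial>lborel) \<longlonglongrightarrow> signed_integral \<mu> \<phi>"
    unfolding eq Bochner_Integration.integral_diff[OF P[OF t(1)] N[OF t(1)]] signed_integral_def[of \<mu> \<phi>]
    by (intro tendsto_diff heat_flow_measure(2)[OF assms(1) p(1) p(3) _ cont _ _ t]
      heat_flow_measure(2)[OF assms(1) p(2) p(4) _ cont _ _ t]) (fact p \<phi>)+
qed

lemma test_function_facts:
  assumes "\<phi> \<in> test_functions"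
  obtains K a where "continuous_on UNIV \<phi>" "\<And>x. \<bar>\<phi> x\<bar> \<le> K" "\<And>x. \<phi> x \<noteq> 0 \<Longrightarrow> \<bar>x\<bar> \<le> a"
proof -
  have "\<phi> field_differentiable (at x)" for x
    using assms[unfolded test_functions_def mem_Collect_eq, THEN conjunct1, rule_format, of 0 x] by simp
  then have cont: "continuous_on UNIV \<phi>"
    by (simp add: continuous_on_eq_continuous_at field_differentiable_imp_continuous_at)
  have cpt: "compact (closure {x. \<phi> x \<noteq> 0})" using assms by (simp add: test_functions_def)
  then obtain a where a: "\<And>x. x \<in> closure {x. \<phi> x \<noteq> 0} \<Longrightarrow> \<bar>x\<bar> \<le> a"
    using compact_imp_bounded bounded_real by metis
  have "compact (\<phi> ` closure {x. \<phi> x \<noteq> 0})"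
    by (rule compact_continuous_image[OF continuous_on_subset[OF cont] cpt]) simp
  then obtain B where B: "\<And>x. x \<in> closure {x. \<phi> x \<noteq> 0} \<Longrightarrow> \<bar>\<phi> x\<bar> \<le> B"
    using compact_imp_bounded bounded_real by (metis imageI)
  show ?thesis
  proof
    show "continuous_on UNIV \<phi>" by (rule cont)
    \<comment> \<open>If \<phi> is identically 0, the support is empty and \<open>B\<close> may be
      negative.\<close>
    show "\<bar>\<phi> x\<bar> \<le> \<bar>B\<bar>" for x
      using B[of x] closure_subset[of "{x. \<phi> x \<noteq> 0}"] by (cases "\<phi> x = 0") auto
    show "\<bar>x\<bar> \<le> a" if "\<phi> x \<noteq> 0" for x
      using a[of x] closure_subset[of "{x. \<phi> x \<noteq> 0}"] that by auto
  qed
qed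

section \<open>The solution of the stochastic heat equation\<close>

text \<open>The bound of \<open>heat_flow_localized\<close> at \<open>t = 1/8\<close> is a multiple of the left-hand side; the right-hand
  side is the weight whose integrability is condition (iii) of a random field solution at the
  point \<open>(1, 0)\<close>.\<close>

lemma exp_le_heat_kernel_sq:
  assumes "\<nu> > 0" "0 \<le> s" "s \<le> 1/8"
  shows "(exp (- y\<^sup>2 / \<nu>))\<^sup>2 \<le> 2 * pi * \<nu> * (heat_kernel \<nu> (1 - s) y)\<^sup>2"
proof -
  have s: "1 - s > 0" using assms by simp
  have p: "2 * pi * \<nu> * (1 - s) > 0" using assms s by simp
  have "2 * pi * \<nu> * (heat_kernel \<nu> (1 - s) y)\<^sup>2 = 2 * pi * \<nu> / (2 * pi * \<nu> * (1 - s)) * (exp (- y\<^sup>2 / (2 * \<nu> * (1 - s))))\<^sup>2"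
    using p by (simp add: heat_kernel_def power_mult_distrib power_divide)
  also have "2 * pi * \<nu> / (2 * pi * \<nu> * (1 - s)) = 1 / (1 - s)" using assms by simp
  finally have eq: "2 * pi * \<nu> * (heat_kernel \<nu> (1 - s) y)\<^sup>2 = 1 / (1 - s) * (exp (- y\<^sup>2 / (2 * \<nu> * (1 - s))))\<^sup>2" .
  have "\<nu> \<le> 2 * \<nu> * (1 - s)" using assms by (simp add: algebra_simps)
  then have "y\<^sup>2 / (2 * \<nu> * (1 - s)) \<le> y\<^sup>2 / \<nu>" using assms s by (intro divide_left_mono) auto
  then have "(exp (- y\<^sup>2 / \<nu>))\<^sup>2 \<le> 1 * (exp (- y\<^sup>2 / (2 * \<nu> * (1 - s))))\<^sup>2"
    by (simp add: power_mono)
  also have "\<dots> \<le> 1 / (1 - s) * (exp (- y\<^sup>2 / (2 * \<nu> * (1 - s))))\<^sup>2"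
    using assms by (intro mult_right_mono) auto
  finally show ?thesis unfolding eq .
qed

text \<open>Write X for the integral of \<open>Y\<close> over x. Ordinary Fubini is applied twice:
  the second moment of X is the integral of E[Y(x) X], and E[Y(x) X] is in turn the integral of
  E[Y(x) Y(x')] over x'. The majorant \<open>b\<close> justifies the exchanges. Absolute values stay
  outside the expectation, so the covariance remains available for the isometry.\<close>

lemma second_moment_integral_le:
  fixes Y :: "'x \<Rightarrow> 'w \<Rightarrow> real"
  assumes "sigma_finite_measure L" "sigma_finite_measure M"
    and Y [measurable]: "(\<lambda>(x, \<omega>). Y x \<omega>) \<in> borel_measurable (L \<Otimes>\<^sub>M M)"
    and b [measurable]: "b \<in> borel_measurable L"
    and bound: "\<And>x x'. x \<in> space L \<Longrightarrow> x' \<in> space L \<Longrightarrow> (\<integral>\<^sup>+\<omega>. ennreal \<bar>Y x \<omega> * Y x' \<omega>\<bar> \<partial>M) \<le> b x * b x'"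
    and fin: "(\<integral>\<^sup>+x. b x \<partial>L) < \<infinity>" "\<And>x. b x < \<infinity>"
  shows "(\<integral>\<^sup>+\<omega>. ennreal ((\<integral>x. Y x \<omega> \<partial>L)\<^sup>2) \<partial>M) \<le> (\<integral>\<^sup>+x. (\<integral>\<^sup>+x'. ennreal \<bar>\<integral>\<omega>. Y x \<omega> * Y x' \<omega> \<partial>M\<bar> \<partial>L) \<partial>L)"
proof -
  interpret L: sigma_finite_measure L by fact
  interpret M: sigma_finite_measure M by fact
  interpret LM: pair_sigma_finite L M by standard
  define X where "X \<omega> = (\<integral>x. Y x \<omega> \<partial>L)" for \<omega>
  have Ysw [measurable]: "(\<lambda>(\<omega>, x). Y x \<omega>) \<in> borel_measurable (M \<Otimes>\<^sub>M L)"
    using measurable_pair_swap[OF Y] by simp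
  have mX [measurable]: "X \<in> borel_measurable M"
    unfolding X_def[abs_def] by (rule L.borel_measurable_lebesgue_integral[OF Ysw])
  have Yx [measurable]: "Y x \<in> borel_measurable M" if "x \<in> space L" for x
    using measurable_Pair2[OF Y that] by simp
  have Yom [measurable]: "(\<lambda>x. Y x \<omega>) \<in> borel_measurable L" if "\<omega> \<in> space M" for \<omega>
    using measurable_Pair1[OF Y that] by simp
  have YX: "(\<integral>\<^sup>+\<omega>. ennreal \<bar>Y x \<omega> * X \<omega>\<bar> \<partial>M) \<le> b x * (\<integral>\<^sup>+x'. b x' \<partial>L)" if x: "x \<in> space L" for x
  proof -
    note [measurable] = Yx[OF x]
    have "(\<integral>\<^sup>+\<omega>. ennreal \<bar>Y x \<omega> * X \<omega>\<bar> \<partial>M) \<le> (\<integral>\<^sup>+\<omega>. (\<integral>\<^sup>+x'. ennreal \<bar>Y x \<omega> * Y x' \<omega>\<bar> \<partial>L) \<partial>M)"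
    proof (rule nn_integral_mono)
      fix \<omega>
      show "ennreal \<bar>Y x \<omega> * X \<omega>\<bar> \<le> (\<integral>\<^sup>+x'. ennreal \<bar>Y x \<omega> * Y x' \<omega>\<bar> \<partial>L)"
        using integral_norm_le_nn_integral[of L "\<lambda>x'. Y x \<omega> * Y x' \<omega>"] by (simp add: X_def)
    qed
    also have "\<dots> = (\<integral>\<^sup>+x'. (\<integral>\<^sup>+\<omega>. ennreal \<bar>Y x \<omega> * Y x' \<omega>\<bar> \<partial>M) \<partial>L)"
      by (rule LM.Fubini') measurable
    also have "\<dots> \<le> (\<integral>\<^sup>+x'. b x * b x' \<partial>L)" by (intro nn_integral_mono bound x) 
    also have "\<dots> = b x * (\<integral>\<^sup>+x'. b x' \<partial>L)" by (rule nn_integral_cmult) measurable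
    finally show ?thesis .
  qed
  have intYX: "integrable (L \<Otimes>\<^sub>M M) (\<lambda>(x, \<omega>). Y x \<omega> * X \<omega>)"
  proof (rule integrableI_bounded)
    have "(\<integral>\<^sup>+p. ennreal (norm (case p of (x, \<omega>) \<Rightarrow> Y x \<omega> * X \<omega>)) \<partial>(L \<Otimes>\<^sub>M M)) = (\<integral>\<^sup>+x. (\<integral>\<^sup>+\<omega>. ennreal \<bar>Y x \<omega> * X \<omega>\<bar> \<partial>M) \<partial>L)"
      by (subst M.nn_integral_fst[symmetric]) (auto simp: case_prod_unfold)
    also have "\<dots> \<le> (\<integral>\<^sup>+x. b x * (\<integral>\<^sup>+x'. b x' \<partial>L) \<partial>L)" by (intro nn_integral_mono YX)
    also have "\<dots> = (\<integral>\<^sup>+x. b x \<partial>L) * (\<integral>\<^sup>+x'. b x' \<partial>L)" by (rule nn_integral_multc) measurable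
    also have "\<dots> < \<infinity>" using fin by (simp add: ennreal_mult_less_top)
    finally show "(\<integral>\<^sup>+p. ennreal (norm (case p of (x, \<omega>) \<Rightarrow> Y x \<omega> * X \<omega>)) \<partial>(L \<Otimes>\<^sub>M M)) < \<infinity>" .
  qed measurable
  have sq: "(X \<omega>)\<^sup>2 = (\<integral>x. Y x \<omega> * X \<omega> \<partial>L)" for \<omega>
    by (simp add: X_def power2_eq_square)
  have iX2: "integrable M (\<lambda>\<omega>. (X \<omega>)\<^sup>2)"
    unfolding sq using LM.integrable_snd[OF intYX] .
  have EYX: "ennreal \<bar>\<integral>\<omega>. Y x \<omega> * X \<omega> \<partial>M\<bar> \<le> (\<integral>\<^sup>+x'. ennreal \<bar>\<integral>\<omega>. Y x \<omega> * Y x' \<omega> \<partial>M\<bar> \<partial>L)" if x: "x \<in> space L" for x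
  proof -
    note [measurable] = Yx[OF x]
    have int: "integrable (L \<Otimes>\<^sub>M M) (\<lambda>(x', \<omega>). Y x \<omega> * Y x' \<omega>)"
    proof (rule integrableI_bounded)
      have "(\<integral>\<^sup>+p. ennreal (norm (case p of (x', \<omega>) \<Rightarrow> Y x \<omega> * Y x' \<omega>)) \<partial>(L \<Otimes>\<^sub>M M)) = (\<integral>\<^sup>+x'. (\<integral>\<^sup>+\<omega>. ennreal \<bar>Y x \<omega> * Y x' \<omega>\<bar> \<partial>M) \<partial>L)"
        by (subst M.nn_integral_fst[symmetric]) (auto simp: case_prod_unfold)
      also have "\<dots> \<le> (\<integral>\<^sup>+x'. b x * b x' \<partial>L)" by (intro nn_integral_mono bound x)
      also have "\<dots> = b x * (\<integral>\<^sup>+x'. b x' \<partial>L)" by (rule nn_integral_cmult) measurable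
      also have "\<dots> < \<infinity>" using fin by (simp add: ennreal_mult_less_top)
      finally show "(\<integral>\<^sup>+p. ennreal (norm (case p of (x', \<omega>) \<Rightarrow> Y x \<omega> * Y x' \<omega>)) \<partial>(L \<Otimes>\<^sub>M M)) < \<infinity>" .
    qed measurable
    have "(\<integral>\<omega>. Y x \<omega> * X \<omega> \<partial>M) = (\<integral>\<omega>. (\<integral>x'. Y x \<omega> * Y x' \<omega> \<partial>L) \<partial>M)" by (simp add: X_def)
    also have "\<dots> = (\<integral>x'. (\<integral>\<omega>. Y x \<omega> * Y x' \<omega> \<partial>M) \<partial>L)"
      by (rule LM.Fubini_integral[OF int])
    finally show ?thesis
      using integral_norm_le_nn_integral[of L "\<lambda>x'. \<integral>\<omega>. Y x \<omega> * Y x' \<omega> \<partial>M"] by simp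
  qed
  have "(\<integral>\<^sup>+\<omega>. ennreal ((X \<omega>)\<^sup>2) \<partial>M) = ennreal (\<integral>\<omega>. (X \<omega>)\<^sup>2 \<partial>M)"
    by (rule nn_integral_eq_integral[OF iX2]) simp
  also have "(\<integral>\<omega>. (X \<omega>)\<^sup>2 \<partial>M) = (\<integral>x. (\<integral>\<omega>. Y x \<omega> * X \<omega> \<partial>M) \<partial>L)"
    unfolding sq by (rule LM.Fubini_integral[OF intYX])
  also have "ennreal \<dots> \<le> (\<integral>\<^sup>+x. ennreal \<bar>\<integral>\<omega>. Y x \<omega> * X \<omega> \<partial>M\<bar> \<partial>L)"
    by (rule order.trans[OF ennreal_leI[OF abs_ge_self] integral_norm_le_nn_integral[unfolded real_norm_def]])
  also have "\<dots> \<le> (\<integral>\<^sup>+x. (\<integral>\<^sup>+x'. ennreal \<bar>\<integral>\<omega>. Y x \<omega> * Y x' \<omega> \<partial>M\<bar> \<partial>L) \<partial>L)"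
    by (intro nn_integral_mono EYX)
  finally show ?thesis by (simp add: X_def)
qed

locale heat_equation_solution = space_time_noise M W
  for M :: "'w measure" and W :: "real \<Rightarrow> real set \<Rightarrow> 'w \<Rightarrow> real" +
  fixes \<nu> :: real and \<rho> :: "real \<Rightarrow> real" and \<mu> :: "real set \<Rightarrow> real"
    and u :: "real \<Rightarrow> real \<Rightarrow> 'w \<Rightarrow> real" and I :: "real \<Rightarrow> real \<Rightarrow> 'w \<Rightarrow> real"
  assumes nu: "\<nu> > 0" and rho [measurable]: "\<rho> \<in> borel_measurable borel" and mu: "\<mu> \<in> M_H"
    and u_meas: "(\<lambda>((t, x), \<omega>). u t x \<omega>) \<in> borel_measurable (restrict_space borel ({0<..} \<times> UNIV) \<Otimes>\<^sub>M M)"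
    and conv_fin: "\<And>t x. t > 0 \<Longrightarrow> spacetime_conv (\<lambda>s y. ennreal ((heat_kernel \<nu> s y)\<^sup>2))
                  (\<lambda>s y. L2_norm_sq M (\<lambda>\<omega>. \<rho> (u s y \<omega>))) t x < \<infinity>"
    and walsh: "\<And>t x. t > 0 \<Longrightarrow> has_walsh_integral M W
              (\<lambda>s y \<omega>. indicator {0..t} s * heat_kernel \<nu> (t - s) (x - y) * \<rho> (u s y \<omega>)) (I t x)"
    and L2_cont: "\<And>t x. t > 0 \<Longrightarrow> tendsto_L2 M (\<lambda>(s, y). I s y) (I t x) (at (t, x) within {0<..} \<times> UNIV)"
    and mild: "\<And>t x. t > 0 \<Longrightarrow> AE \<omega> in M. u t x \<omega> = signed_integral \<mu> (\<lambda>y. heat_kernel \<nu> t (x - y)) + I t x \<omega>"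
begin

text \<open>A version of \<open>I\<close> that inherits joint measurability in (x, \<omega>) from
  \<open>u\<close>, so that it may be integrated over x.\<close>

definition noise_part :: "real \<Rightarrow> real \<Rightarrow> 'w \<Rightarrow> real" where
  "noise_part t x \<omega> = u t x \<omega> - signed_integral \<mu> (\<lambda>y. heat_kernel \<nu> t (x - y))"

lemma noise_part_AE: "t > 0 \<Longrightarrow> AE \<omega> in M. noise_part t x \<omega> = I t x \<omega>"
  using mild[of t x] by (auto simp: noise_part_def elim!: eventually_mono)

lemma u_section_measurable:
  assumes t: "t > 0" shows "(\<lambda>(x, \<omega>). u t x \<omega>) \<in> borel_measurable (lborel \<Otimes>\<^sub>M M)"
proof -
  have "(\<lambda>(x, \<omega>). ((t, x), \<omega>)) \<in> lborel \<Otimes>\<^sub>M M \<rightarrow>\<^sub>M restrict_space borel ({0<..} \<times> UNIV) \<Otimes>\<^sub>M M"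
  proof -
    have "(\<lambda>p. (t, fst p)) \<in> lborel \<Otimes>\<^sub>M M \<rightarrow>\<^sub>M restrict_space borel ({0<..} \<times> UNIV)"
      using t by (intro measurable_restrict_space2) (auto simp: borel_prod[symmetric])
    then show ?thesis unfolding case_prod_unfold by measurable
  qed
  from measurable_compose[OF this u_meas] show ?thesis by (simp add: case_prod_unfold)
qed

lemma sets_spacetime: "sets spacetime = sets (restrict_space borel ({0<..} \<times> UNIV))"
  unfolding spacetime_def by (rule sets_restrict_space_cong) simp

lemma u_spacetime_measurable: "(\<lambda>((s, y), \<omega>). u s y \<omega>) \<in> borel_measurable (spacetime \<Otimes>\<^sub>M M)"
  using u_meas by (subst measurable_cong_sets[OF sets_pair_measure_cong[OF sets_spacetime refl] refl])

definition source :: "(real \<times> real) \<times> 'w \<Rightarrow> real" where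
  "source = (\<lambda>((s, y), \<omega>). \<rho> (u s y \<omega>))"

lemma source_measurable [measurable]: "source \<in> borel_measurable (spacetime \<Otimes>\<^sub>M M)"
  using measurable_compose[OF u_spacetime_measurable rho] by (simp add: source_def case_prod_unfold)

definition kernel :: "real \<Rightarrow> real \<Rightarrow> real \<times> real \<Rightarrow> real" where
  "kernel t x = (\<lambda>(s, y). indicator {0..t} s * heat_kernel \<nu> (t - s) (x - y))"

lemma kernel_nonneg: "0 \<le> kernel t x p"
  using nu by (auto simp: kernel_def indicator_def heat_kernel_nonneg split: prod.splits)

lemma fst_spacetime [measurable]: "fst \<in> borel_measurable spacetime"
  and snd_spacetime [measurable]: "snd \<in> borel_measurable spacetime"
  unfolding spacetime_def by (auto intro!: measurable_restrict_space1 simp: borel_prod[symmetric])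

lemma kernel_measurable [measurable]:
  "(\<lambda>(x, p). kernel t x (fst p)) \<in> borel_measurable (lborel \<Otimes>\<^sub>M (spacetime \<Otimes>\<^sub>M M))"
  unfolding kernel_def case_prod_unfold by measurable

lemma noise_part_integrable2:
  assumes t: "t > 0"
  shows "noise_part t x \<in> borel_measurable M" "integrable M (\<lambda>\<omega>. (noise_part t x \<omega>)\<^sup>2)"
    "(\<integral>\<omega>. (noise_part t x \<omega>)\<^sup>2 \<partial>M) = (\<integral>\<omega>. (I t x \<omega>)\<^sup>2 \<partial>M)"
proof -
  have "u t x \<in> borel_measurable M"
    using measurable_Pair2[OF u_section_measurable[OF t], of x] by simp
  then show m [measurable]: "noise_part t x \<in> borel_measurable M"
    unfolding noise_part_def[abs_def] by simp
  note w = walsh_square_integrable(1,2)[OF walsh[OF t, of x]]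
  note [measurable] = w(1)
  show "integrable M (\<lambda>\<omega>. (noise_part t x \<omega>)\<^sup>2)"
    using w(2) by (subst integrable_cong_AE[where g="\<lambda>\<omega>. (I t x \<omega>)\<^sup>2"]) (use noise_part_AE[OF t, of x] in auto)
  show "(\<integral>\<omega>. (noise_part t x \<omega>)\<^sup>2 \<partial>M) = (\<integral>\<omega>. (I t x \<omega>)\<^sup>2 \<partial>M)"
    by (rule integral_cong_AE) (use noise_part_AE[OF t, of x] in auto)
qed

text \<open>Almost sure equality at the two points replaces \<open>noise_part\<close> by the
  stochastic integrals. Since the kernels are nonnegative, the right-hand side is free of absolute
  values and ready for Tonelli.\<close>

lemma noise_part_covariance:
  assumes t: "t > 0"
  shows "ennreal \<bar>\<integral>\<omega>. noise_part t x \<omega> * noise_part t x' \<omega> \<partial>M\<bar> \<le>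
    (\<integral>\<^sup>+p. ennreal (kernel t x (fst p) * kernel t x' (fst p) * (source p)\<^sup>2) \<partial>(spacetime \<Otimes>\<^sub>M M))"
proof -
  have [measurable]: "I t x \<in> borel_measurable M" "I t x' \<in> borel_measurable M"
    "noise_part t x \<in> borel_measurable M" "noise_part t x' \<in> borel_measurable M"
    using walsh_square_integrable(1)[OF walsh[OF t]] noise_part_integrable2(1)[OF t] by auto
  have "(\<integral>\<omega>. noise_part t x \<omega> * noise_part t x' \<omega> \<partial>M) = (\<integral>\<omega>. I t x \<omega> * I t x' \<omega> \<partial>M)"
    by (rule integral_cong_AE) (use noise_part_AE[OF t, of x] noise_part_AE[OF t, of x'] in \<open>auto elim!: eventually_elim2\<close>)
  also have "\<dots> = (\<integral>p. kernel t x (fst p) * kernel t x' (fst p) * (source p)\<^sup>2 \<partial>(spacetime \<Otimes>\<^sub>M M))"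
    unfolding walsh_covariance[OF walsh[OF t] walsh[OF t]]
    by (rule Bochner_Integration.integral_cong) (auto simp: kernel_def source_def power2_eq_square)
  finally show ?thesis
    using integral_norm_le_nn_integral[of "spacetime \<Otimes>\<^sub>M M" "\<lambda>p. kernel t x (fst p) * kernel t x' (fst p) * (source p)\<^sup>2"]
    by (simp add: kernel_nonneg abs_mult)
qed

text \<open>The kernel bounds do not give this, because \<open>G\<^sup>2\<close> is singular at \<open>s = t\<close>; it follows from the
  continuity of the stochastic integral in \<open>L\<^sup>2\<close> and compactness.\<close>

lemma noise_part_locally_bounded:
  assumes t: "t > 0"
  shows "\<exists>B\<ge>0. \<forall>x. \<bar>x\<bar> \<le> a \<longrightarrow> (\<integral>\<omega>. (noise_part t x \<omega>)\<^sup>2 \<partial>M) \<le> B"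
proof -
  let ?n = "\<lambda>x. \<integral>\<omega>. (I t x \<omega>)\<^sup>2 \<partial>M"
  \<comment> \<open>A squared distance below 1 and \<open>L2_norm_sq_add_le\<close> with weight 1
    give 2 E[I(t, x)^2] + 2.\<close>
  have "\<exists>e>0. \<forall>x'. \<bar>x' - x\<bar> < e \<longrightarrow> ?n x' \<le> 2 * ?n x + 2" for x
  proof -
    have "((\<lambda>i. L2_norm_sq M (\<lambda>\<omega>. (case i of (s, y) \<Rightarrow> I s y) \<omega> - I t x \<omega>)) \<longlongrightarrow> 0) (at (t, x) within {0<..} \<times> UNIV)"
      using L2_cont[OF t, of x] by (simp add: tendsto_L2_def)
    then have "eventually (\<lambda>i. L2_norm_sq M (\<lambda>\<omega>. (case i of (s, y) \<Rightarrow> I s y) \<omega> - I t x \<omega>) < 1) (at (t, x) within {0<..} \<times> UNIV)"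
      by (rule order_tendstoD) simp
    then obtain e where e: "e > 0" "\<And>s y. s > 0 \<Longrightarrow> (s, y) \<noteq> (t, x) \<Longrightarrow> dist (s, y) (t, x) < e \<Longrightarrow> L2_norm_sq M (\<lambda>\<omega>. I s y \<omega> - I t x \<omega>) < 1"
      unfolding eventually_at by fastforce
    \<comment> \<open>The filter \<open>at\<close> excludes its own point, so continuity is silent
      about x' = x.\<close>
    have "?n x' \<le> 2 * ?n x + 2" if x': "\<bar>x' - x\<bar> < e" for x'
    proof (cases "x' = x")
      case True
      have "0 \<le> ?n x" by simp
      then show ?thesis unfolding True by linarith
    next
      case False
      have "dist (t, x') (t, x) < e" using x' by (simp add: dist_Pair_Pair dist_real_def)
      then have lt: "L2_norm_sq M (\<lambda>\<omega>. I t x' \<omega> - I t x \<omega>) < 1" using e(2)[OF t, of x'] False by simp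
      note w = walsh_square_integrable(1,2)[OF walsh[OF t, of x]] and w' = walsh_square_integrable(1,2)[OF walsh[OF t, of x']]
      have "ennreal (?n x') = L2_norm_sq M (\<lambda>\<omega>. I t x \<omega> + (I t x' \<omega> - I t x \<omega>))"
        using L2_norm_sq_integral[OF w'(2)] by simp
      also have "\<dots> \<le> ennreal (1 + 1) * L2_norm_sq M (I t x) + ennreal (1 + 1/1) * L2_norm_sq M (\<lambda>\<omega>. I t x' \<omega> - I t x \<omega>)"
        by (rule L2_norm_sq_add_le) (use w(1) w'(1) in auto)
      also have "\<dots> \<le> ennreal (1 + 1) * ennreal (?n x) + ennreal (1 + 1/1) * 1"
        using lt by (intro add_mono mult_left_mono order_refl) (auto simp: L2_norm_sq_integral[OF w(2)])
      also have "\<dots> = ennreal (2 * ?n x + 2)"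
        by (simp add: ennreal_mult)
      finally show ?thesis by (subst (asm) ennreal_le_iff) (auto intro: add_nonneg_nonneg)
    qed
    then show ?thesis using e(1) by blast
  qed
  then obtain e where e: "\<And>x. e x > 0" "\<And>x x'. \<bar>x' - x\<bar> < e x \<Longrightarrow> ?n x' \<le> 2 * ?n x + 2" by metis
  have "{-a..a} \<subseteq> (\<Union>x\<in>{-a..a}. ball x (e x))" using e(1) by force
  then obtain C where C: "C \<subseteq> {-a..a}" "finite C" "{-a..a} \<subseteq> (\<Union>x\<in>C. ball x (e x))"
    using compactE_image[OF compact_Icc, of "{-a..a}" "\<lambda>x. ball x (e x)"] by (metis open_ball)
  show ?thesis
  proof (intro exI conjI allI impI)
    \<comment> \<open>The sum over the centers of the finite cover replaces a maximum, which would
      be undefined for the empty cover that occurs when a < 0.\<close>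
    show "0 \<le> (\<Sum>x\<in>C. 2 * ?n x + 2)" by (intro sum_nonneg add_nonneg_nonneg) auto
    fix x' assume "\<bar>x'\<bar> \<le> a"
    then have "x' \<in> {-a..a}" by auto
    then obtain x where x: "x \<in> C" "\<bar>x' - x\<bar> < e x" using C(3) by (auto simp: dist_real_def abs_minus_commute)
    have "?n x' \<le> 2 * ?n x + 2" by (rule e(2)[OF x(2)])
    also have "\<dots> \<le> (\<Sum>x\<in>C. 2 * ?n x + 2)"
      using x(1) C(2) by (intro member_le_sum) (auto intro: add_nonneg_nonneg)
    finally show "(\<integral>\<omega>. (noise_part t x' \<omega>)\<^sup>2 \<partial>M) \<le> (\<Sum>x\<in>C. 2 * ?n x + 2)"
      by (simp add: noise_part_integrable2(3)[OF t])
  qed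
qed

section \<open>The mass of the forcing near time 0\<close>

abbreviation N :: "((real \<times> real) \<times> 'w) measure" where "N \<equiv> spacetime \<Otimes>\<^sub>M M"

text \<open>The integrand of the convolution in condition (iii) at the point (1, 0), before the
  expectation is taken and parametrized by the time of \<open>u\<close> rather than by that of the
  kernel.\<close>

definition weight :: "(real \<times> real) \<times> 'w \<Rightarrow> real" where
  "weight p = (heat_kernel \<nu> (1 - fst (fst p)) (snd (fst p)))\<^sup>2 * (source p)\<^sup>2"

definition initial_mass :: "real \<Rightarrow> ennreal" where
  "initial_mass t = (\<integral>\<^sup>+p. indicator {0..t} (fst (fst p)) * ennreal (weight p) \<partial>N)"

lemma weight_measurable [measurable]: "weight \<in> borel_measurable N"
  unfolding weight_def[abs_def] by measurable

text \<open>In the convolution the kernel sits at (s, y) and \<open>u\<close> at (1 - s, -y). The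
  reflections of time and space exchange these roles, the kernel being even in space, and Tonelli
  merges the expectation into one integral over space-time and probability space.\<close>

lemma initial_mass_finite: "initial_mass 1 < \<infinity>"
proof -
  let ?S = "{0<..} \<times> (UNIV :: real set)"
  have S: "?S \<inter> space lborel \<in> sets (lborel :: (real \<times> real) measure)"
    unfolding sets_lborel borel_prod[symmetric] by (simp add: pair_measureI)
  define g where "g q = (\<integral>\<^sup>+\<omega>. ennreal ((source (q, \<omega>))\<^sup>2) \<partial>M)" for q
  have gm: "g \<in> borel_measurable spacetime" unfolding g_def[abs_def] by measurable
  \<comment> \<open>The second moment of the source is known to be measurable on positive times
    only. Extended by 0, it is a measurable function on the plane, to which the substitutions and
    Tonelli for \<open>lborel\<close> apply.\<close>
  define g' where "g' q = g q * indicator ?S q" for q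
  have g'm [measurable]: "g' \<in> borel_measurable (borel \<Otimes>\<^sub>M borel)"
    using gm unfolding spacetime_def g'_def[abs_def] borel_measurable_restrict_space_iff_ennreal[OF S] by (simp add: borel_prod)
  have g_eq: "g' (s, y) = L2_norm_sq M (\<lambda>\<omega>. \<rho> (u s y \<omega>))" if "s > 0" for s y
    using that by (simp add: g'_def g_def source_def L2_norm_sq_def)
  let ?h = "\<lambda>s y. ennreal ((heat_kernel \<nu> s y)\<^sup>2)"
  have "spacetime_conv ?h (\<lambda>s y. L2_norm_sq M (\<lambda>\<omega>. \<rho> (u s y \<omega>))) 1 0 =
      (\<integral>\<^sup>+s. (\<integral>\<^sup>+y. ?h s y * g' (1 - s, 0 - y) \<partial>lborel) * indicator {0..1} s \<partial>lborel)"
    unfolding spacetime_conv_def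
  proof (rule nn_integral_cong_AE)
    \<comment> \<open>The time s = 1 is discarded: there \<open>u\<close> is evaluated at time 0,
      where its value is unconstrained.\<close>
    show "AE s in lborel. (\<integral>\<^sup>+y. ?h s y * L2_norm_sq M (\<lambda>\<omega>. \<rho> (u (1 - s) (0 - y) \<omega>)) \<partial>lborel) * indicator {0..1} s
      = (\<integral>\<^sup>+y. ?h s y * g' (1 - s, 0 - y) \<partial>lborel) * indicator {0..1} s"
      using AE_lborel_singleton[of 1]
    proof eventually_elim
      case (elim s)
      then show ?case using g_eq[of "1 - s"] by (cases "s \<in> {0..1}") auto
    qed
  qed
  also have "\<dots> = (\<integral>\<^sup>+s. (\<integral>\<^sup>+y. ?h s y * g' (1 - s, y) \<partial>lborel) * indicator {0..1} s \<partial>lborel)"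
  proof (rule nn_integral_cong)
    fix s
    have "(\<integral>\<^sup>+y. ?h s y * g' (1 - s, 0 - y) \<partial>lborel) = ennreal \<bar>- 1\<bar> * (\<integral>\<^sup>+y. ?h s (0 + - 1 * y) * g' (1 - s, 0 - (0 + - 1 * y)) \<partial>lborel)"
      by (rule nn_integral_real_affine) auto
    then show "(\<integral>\<^sup>+y. ?h s y * g' (1 - s, 0 - y) \<partial>lborel) * indicator {0..1} s = (\<integral>\<^sup>+y. ?h s y * g' (1 - s, y) \<partial>lborel) * indicator {0..1} s"
      by simp
  qed
  also have "\<dots> = ennreal \<bar>- 1\<bar> * (\<integral>\<^sup>+s. (\<integral>\<^sup>+y. ?h (1 + - 1 * s) y * g' (1 - (1 + - 1 * s), y) \<partial>lborel) * indicator {0..1} (1 + - 1 * s) \<partial>lborel)"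
    by (rule nn_integral_real_affine) auto
  also have "\<dots> = (\<integral>\<^sup>+s. (\<integral>\<^sup>+y. indicator {0..1} s * (?h (1 - s) y * g' (s, y)) \<partial>lborel) \<partial>lborel)"
    by (simp add: nn_integral_cmult indicator_def mult.commute conj_commute cong: nn_integral_cong)
  also have "\<dots> = (\<integral>\<^sup>+q. indicator {0..1} (fst q) * (?h (1 - fst q) (snd q) * g' q) \<partial>(lborel \<Otimes>\<^sub>M lborel))"
    by (subst lborel.nn_integral_fst[symmetric]) auto
  also have "\<dots> = (\<integral>\<^sup>+q. (indicator {0..1} (fst q) * ?h (1 - fst q) (snd q) * g q) * indicator ?S q \<partial>lborel)"
    unfolding lborel_prod g'_def by (simp add: mult.assoc)
  also have "\<dots> = (\<integral>\<^sup>+q. indicator {0..1} (fst q) * ?h (1 - fst q) (snd q) * g q \<partial>spacetime)"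
    unfolding spacetime_def by (rule nn_integral_restrict_space[OF S, symmetric])
  also have "\<dots> = (\<integral>\<^sup>+q. (\<integral>\<^sup>+\<omega>. indicator {0..1} (fst q) * ennreal (weight (q, \<omega>)) \<partial>M) \<partial>spacetime)"
  proof (rule nn_integral_cong)
    fix q assume [simp]: "q \<in> space spacetime"
    have [measurable]: "(\<lambda>\<omega>. source (q, \<omega>)) \<in> borel_measurable M" by measurable
    show "indicator {0..1} (fst q) * ?h (1 - fst q) (snd q) * g q = (\<integral>\<^sup>+\<omega>. indicator {0..1} (fst q) * ennreal (weight (q, \<omega>)) \<partial>M)"
      unfolding g_def weight_def fst_conv snd_conv
      by (subst ennreal_mult) (auto simp: nn_integral_cmult mult.assoc)
  qed
  also have "\<dots> = initial_mass 1"
    unfolding initial_mass_def by (subst nn_integral_fst[symmetric]) auto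
  finally show ?thesis using conv_fin[of 1 0] by simp
qed

lemma initial_mass_tendsto:
  assumes t: "\<And>n. t n < 1" "t \<longlonglongrightarrow> 0"
  shows "(\<lambda>n. initial_mass (t n)) \<longlonglongrightarrow> 0"
proof -
  have "(\<lambda>n. initial_mass (t n)) \<longlonglongrightarrow> (\<integral>\<^sup>+p. 0 \<partial>N)"
    unfolding initial_mass_def
  proof (rule nn_integral_dominated_convergence[where w="\<lambda>p. indicator {0..1} (fst (fst p)) * ennreal (weight p)"])
    show "(\<integral>\<^sup>+p. indicator {0..1} (fst (fst p)) * ennreal (weight p) \<partial>N) < \<infinity>"
      using initial_mass_finite by (simp add: initial_mass_def)
    show "AE p in N. indicator {0..t n} (fst (fst p)) * ennreal (weight p) \<le> indicator {0..1} (fst (fst p)) * ennreal (weight p)" for n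
      using t(1)[of n] by (intro AE_I2 mult_right_mono) (auto simp: indicator_def)
    show "AE p in N. (\<lambda>n. indicator {0..t n} (fst (fst p)) * ennreal (weight p)) \<longlonglongrightarrow> 0"
    proof (rule AE_I2)
      fix p assume "p \<in> space N"
      \<comment> \<open>Space-time contains positive times only, so every point eventually leaves
        the strip up to time \<open>t n\<close>.\<close>
      then have "0 < fst (fst p)" by (auto simp: space_pair_measure spacetime_def space_restrict_space)
      then have "eventually (\<lambda>n. t n < fst (fst p)) sequentially" by (rule order_tendstoD(2)[OF t(2)])
      then have "eventually (\<lambda>n. indicator {0..t n} (fst (fst p)) * ennreal (weight p) = 0) sequentially"
        by eventually_elim simp
      then show "(\<lambda>n. indicator {0..t n} (fst (fst p)) * ennreal (weight p)) \<longlonglongrightarrow> 0"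
        by (rule tendsto_eventually)
    qed
  qed measurable
  then show ?thesis by simp
qed

lemma noise_part_jointly_measurable:
  assumes "t > 0"
  shows "(\<lambda>(x, \<omega>). noise_part t x \<omega>) \<in> borel_measurable (lborel \<Otimes>\<^sub>M M)"
proof -
  \<comment> \<open>The measurability statement does not involve \<phi>; the zero function meets its
    hypotheses.\<close>
  have "(\<lambda>x. signed_integral \<mu> (\<lambda>y. heat_kernel \<nu> t (x - y))) \<in> borel_measurable borel"
    by (rule heat_flow_signed_measure(1)[OF nu mu, of "\<lambda>_. 0" 0 0]) auto
  then have "(\<lambda>p. signed_integral \<mu> (\<lambda>y. heat_kernel \<nu> t (fst p - y))) \<in> borel_measurable (lborel \<Otimes>\<^sub>M M)"
    by (intro measurable_compose[OF measurable_fst]) simp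
  with u_section_measurable[OF assms] show ?thesis
    unfolding noise_part_def case_prod_unfold by (rule borel_measurable_diff)
qed

section \<open>Estimates for a fixed test function\<close>

context
  fixes \<phi> :: "real \<Rightarrow> real" and K a :: real
  assumes cont: "continuous_on UNIV \<phi>" and K: "\<And>x. \<bar>\<phi> x\<bar> \<le> K" and a: "\<And>x. \<phi> x \<noteq> 0 \<Longrightarrow> \<bar>x\<bar> \<le> a"
begin

lemma phi_measurable [measurable]: "\<phi> \<in> borel_measurable borel"
  by (rule borel_measurable_continuous_onI[OF cont])

lemma K_nonneg: "K \<ge> 0"
  using K[of 0] by simp

lemma phi_integrable: "(\<integral>\<^sup>+x. ennreal \<bar>\<phi> x\<bar> \<partial>lborel) < \<infinity>"
proof -
  have "(\<integral>\<^sup>+x. ennreal \<bar>\<phi> x\<bar> \<partial>lborel) \<le> (\<integral>\<^sup>+x. ennreal K * indicator {-a..a} x \<partial>lborel)"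
  proof (rule nn_integral_mono)
    fix x
    have "\<phi> x \<noteq> 0 \<Longrightarrow> x \<in> {-a..a}" using a[of x] by auto
    then show "ennreal \<bar>\<phi> x\<bar> \<le> ennreal K * indicator {-a..a} x"
      using K[of x] by (cases "\<phi> x = 0") (auto simp: ennreal_leI)
  qed
  also have "\<dots> = ennreal K * emeasure lborel {-a..a}" by (rule nn_integral_cmult_indicator) simp
  also have "\<dots> < \<infinity>" by (simp add: ennreal_mult_less_top emeasure_lborel_Icc_eq)
  finally show ?thesis .
qed

text \<open>With \<open>B\<close> a bound of the second moment on the support, first moments are at
  most 1 + B by |z| \<le> 1 + z^2, and mixed moments at most 2B \<le> (1 + B)^2. One majorant
  |\<phi>| (1 + B) thus serves for integrability and, as a product, for
  \<open>second_moment_integral_le\<close>.\<close>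

lemma noise_part_bounds:
  assumes t: "t > 0"
  shows "\<exists>B\<ge>0. (\<forall>x. (\<integral>\<^sup>+\<omega>. ennreal \<bar>noise_part t x \<omega> * \<phi> x\<bar> \<partial>M) \<le> ennreal (\<bar>\<phi> x\<bar> * (1 + B))) \<and>
    (\<forall>x x'. (\<integral>\<^sup>+\<omega>. ennreal \<bar>(noise_part t x \<omega> * \<phi> x) * (noise_part t x' \<omega> * \<phi> x')\<bar> \<partial>M) \<le>
      ennreal (\<bar>\<phi> x\<bar> * (1 + B)) * ennreal (\<bar>\<phi> x'\<bar> * (1 + B)))"
proof -
  obtain B where B: "B \<ge> 0" "\<And>x. \<bar>x\<bar> \<le> a \<Longrightarrow> (\<integral>\<omega>. (noise_part t x \<omega>)\<^sup>2 \<partial>M) \<le> B"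
    using noise_part_locally_bounded[OF t, of a] by blast
  note np = noise_part_integrable2(1,2)[OF t]
  have i1: "integrable M (noise_part t x)" for x by (rule expectation_abs_le_sqrt(1)[OF np])
  show ?thesis
  proof (intro exI conjI allI)
    show "B \<ge> 0" by fact
    show "(\<integral>\<^sup>+\<omega>. ennreal \<bar>noise_part t x \<omega> * \<phi> x\<bar> \<partial>M) \<le> ennreal (\<bar>\<phi> x\<bar> * (1 + B))" for x
    proof (cases "\<phi> x = 0")
      case False
      have "(\<integral>\<^sup>+\<omega>. ennreal \<bar>noise_part t x \<omega> * \<phi> x\<bar> \<partial>M) = ennreal (\<integral>\<omega>. \<bar>noise_part t x \<omega> * \<phi> x\<bar> \<partial>M)"
        using i1[of x] by (intro nn_integral_eq_integral) auto
      also have "(\<integral>\<omega>. \<bar>noise_part t x \<omega> * \<phi> x\<bar> \<partial>M) = \<bar>\<phi> x\<bar> * (\<integral>\<omega>. \<bar>noise_part t x \<omega>\<bar> \<partial>M)"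
        by (simp add: abs_mult mult.commute)
      also have "ennreal \<dots> \<le> ennreal (\<bar>\<phi> x\<bar> * (\<integral>\<omega>. 1 + (noise_part t x \<omega>)\<^sup>2 \<partial>M))"
      proof (intro ennreal_leI mult_left_mono integral_mono)
        have "\<bar>z\<bar> \<le> 1 + z\<^sup>2" for z :: real
          using zero_le_power2[of "\<bar>z\<bar> - 1"] unfolding power2_diff by simp
        then show "\<bar>noise_part t x \<omega>\<bar> \<le> 1 + (noise_part t x \<omega>)\<^sup>2" for \<omega> .
      qed (use i1[of x] np(2)[of x] in auto)
      also have "\<dots> \<le> ennreal (\<bar>\<phi> x\<bar> * (1 + B))"
        using np(2)[of x] B(2)[OF a[OF False]] by (intro ennreal_leI mult_left_mono) (auto simp: prob_space)
      finally show ?thesis .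
    qed simp
    fix x x'
    show "(\<integral>\<^sup>+\<omega>. ennreal \<bar>(noise_part t x \<omega> * \<phi> x) * (noise_part t x' \<omega> * \<phi> x')\<bar> \<partial>M) \<le>
      ennreal (\<bar>\<phi> x\<bar> * (1 + B)) * ennreal (\<bar>\<phi> x'\<bar> * (1 + B))"
    proof (cases "\<phi> x = 0 \<or> \<phi> x' = 0")
      case False
      have i: "integrable M (\<lambda>\<omega>. noise_part t x \<omega> * noise_part t x' \<omega>)"
        by (intro integrable_mult_L2 np)
      have "(\<integral>\<^sup>+\<omega>. ennreal \<bar>(noise_part t x \<omega> * \<phi> x) * (noise_part t x' \<omega> * \<phi> x')\<bar> \<partial>M) =
        (\<integral>\<^sup>+\<omega>. ennreal (\<bar>\<phi> x\<bar> * \<bar>\<phi> x'\<bar> * \<bar>noise_part t x \<omega> * noise_part t x' \<omega>\<bar>) \<partial>M)"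
        by (intro nn_integral_cong) (simp add: abs_mult mult_ac)
      also have "\<dots> = ennreal (\<integral>\<omega>. \<bar>\<phi> x\<bar> * \<bar>\<phi> x'\<bar> * \<bar>noise_part t x \<omega> * noise_part t x' \<omega>\<bar> \<partial>M)"
        using i by (intro nn_integral_eq_integral) auto
      also have "\<dots> \<le> ennreal (\<integral>\<omega>. \<bar>\<phi> x\<bar> * \<bar>\<phi> x'\<bar> * ((noise_part t x \<omega>)\<^sup>2 + (noise_part t x' \<omega>)\<^sup>2) \<partial>M)"
      proof (intro ennreal_leI integral_mono mult_left_mono)
        show "\<bar>noise_part t x \<omega> * noise_part t x' \<omega>\<bar> \<le> (noise_part t x \<omega>)\<^sup>2 + (noise_part t x' \<omega>)\<^sup>2" for \<omega>
          by (rule abs_mult_le_sum_squares)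
      qed (use i np(2) in auto)
      also have "\<dots> = ennreal (\<bar>\<phi> x\<bar> * \<bar>\<phi> x'\<bar> * ((\<integral>\<omega>. (noise_part t x \<omega>)\<^sup>2 \<partial>M) + (\<integral>\<omega>. (noise_part t x' \<omega>)\<^sup>2 \<partial>M)))"
        using np(2) by simp
      also have "\<dots> \<le> ennreal (\<bar>\<phi> x\<bar> * \<bar>\<phi> x'\<bar> * ((1 + B) * (1 + B)))"
      proof (intro ennreal_leI mult_left_mono)
        have "(\<integral>\<omega>. (noise_part t x \<omega>)\<^sup>2 \<partial>M) + (\<integral>\<omega>. (noise_part t x' \<omega>)\<^sup>2 \<partial>M) \<le> B + B"
          using False by (intro add_mono B a) auto
        also have "\<dots> \<le> (1 + B) * (1 + B)" using B(1) by (simp add: algebra_simps)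
        finally show "(\<integral>\<omega>. (noise_part t x \<omega>)\<^sup>2 \<partial>M) + (\<integral>\<omega>. (noise_part t x' \<omega>)\<^sup>2 \<partial>M) \<le> (1 + B) * (1 + B)" .
      qed auto
      also have "\<dots> = ennreal (\<bar>\<phi> x\<bar> * (1 + B)) * ennreal (\<bar>\<phi> x'\<bar> * (1 + B))"
        using B(1) by (simp add: mult_ac flip: ennreal_mult)
      finally show ?thesis .
    qed auto
  qed
qed

lemma noise_part_product_integrable:
  assumes t: "t > 0"
  shows "integrable (lborel \<Otimes>\<^sub>M M) (\<lambda>(x, \<omega>). noise_part t x \<omega> * \<phi> x)"
proof (rule integrableI_bounded)
  have m: "(\<lambda>p. noise_part t (fst p) (snd p)) \<in> borel_measurable (lborel \<Otimes>\<^sub>M M)"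
    using noise_part_jointly_measurable[OF t] by (simp add: case_prod_unfold)
  then show m': "(\<lambda>(x, \<omega>). noise_part t x \<omega> * \<phi> x) \<in> borel_measurable (lborel \<Otimes>\<^sub>M M)"
    unfolding case_prod_unfold by measurable
  obtain B where B: "B \<ge> 0"
    "\<And>x. (\<integral>\<^sup>+\<omega>. ennreal \<bar>noise_part t x \<omega> * \<phi> x\<bar> \<partial>M) \<le> ennreal (\<bar>\<phi> x\<bar> * (1 + B))"
    "\<And>x x'. (\<integral>\<^sup>+\<omega>. ennreal \<bar>(noise_part t x \<omega> * \<phi> x) * (noise_part t x' \<omega> * \<phi> x')\<bar> \<partial>M) \<le>
      ennreal (\<bar>\<phi> x\<bar> * (1 + B)) * ennreal (\<bar>\<phi> x'\<bar> * (1 + B))"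
    using noise_part_bounds[OF t] by blast
  have "(\<integral>\<^sup>+p. ennreal (norm (case p of (x, \<omega>) \<Rightarrow> noise_part t x \<omega> * \<phi> x)) \<partial>(lborel \<Otimes>\<^sub>M M)) =
    (\<integral>\<^sup>+x. (\<integral>\<^sup>+\<omega>. ennreal \<bar>noise_part t x \<omega> * \<phi> x\<bar> \<partial>M) \<partial>lborel)"
    using m' by (subst nn_integral_fst[symmetric]) auto
  also have "\<dots> \<le> (\<integral>\<^sup>+x. ennreal (1 + B) * ennreal \<bar>\<phi> x\<bar> \<partial>lborel)"
  proof (rule nn_integral_mono)
    fix x
    have "ennreal (\<bar>\<phi> x\<bar> * (1 + B)) = ennreal (1 + B) * ennreal \<bar>\<phi> x\<bar>"
      using B(1) by (subst ennreal_mult[symmetric]) (auto simp: mult.commute)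
    then show "(\<integral>\<^sup>+\<omega>. ennreal \<bar>noise_part t x \<omega> * \<phi> x\<bar> \<partial>M) \<le> ennreal (1 + B) * ennreal \<bar>\<phi> x\<bar>"
      using B(2)[of x] by (simp only:)
  qed
  also have "\<dots> = ennreal (1 + B) * (\<integral>\<^sup>+x. ennreal \<bar>\<phi> x\<bar> \<partial>lborel)"
    by (rule nn_integral_cmult) measurable
  also have "\<dots> < \<infinity>" using phi_integrable by (simp add: ennreal_mult_less_top)
  finally show "(\<integral>\<^sup>+p. ennreal (norm (case p of (x, \<omega>) \<Rightarrow> noise_part t x \<omega> * \<phi> x)) \<partial>(lborel \<Otimes>\<^sub>M M)) < \<infinity>" .
qed

text \<open>The prefactor of the Gaussian majorant at time 1/8 is squared because the smoothed test
  function enters twice; \<open>2 * pi * \<nu>\<close> is the constant of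
  \<open>exp_le_heat_kernel_sq\<close>.\<close>

definition smoothing_const :: real where
  "smoothing_const = (localized_const \<nu> a K (1/8))\<^sup>2 * (2 * pi * \<nu>)"

lemma noise_part_second_moment:
  assumes t: "0 < t" "t \<le> 1/8"
  shows "L2_norm_sq M (\<lambda>\<omega>. \<integral>x. noise_part t x \<omega> * \<phi> x \<partial>lborel) \<le> ennreal smoothing_const * initial_mass t"
proof -
  interpret PN: pair_sigma_finite spacetime M by (rule pair_sigma_finite_spacetime)
  interpret LN: pair_sigma_finite lborel N by standard
  define A where "A x p = ennreal (\<bar>\<phi> x\<bar> * kernel t x (fst p))" for x and p :: "(real \<times> real) \<times> 'w"
  have km: "(\<lambda>q. kernel t (fst q) (fst (snd q))) \<in> borel_measurable (lborel \<Otimes>\<^sub>M N)"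
    using kernel_measurable[of t] by (simp add: case_prod_unfold)
  have Am [measurable]: "(\<lambda>(x, p). A x p) \<in> borel_measurable (lborel \<Otimes>\<^sub>M N)"
    unfolding A_def case_prod_unfold using km by measurable
  have Ax [measurable]: "A x \<in> borel_measurable N" for x
    using measurable_Pair2[OF Am, of x] by simp
  have Ap [measurable]: "(\<lambda>x. A x p) \<in> borel_measurable lborel" if "p \<in> space N" for p
    using measurable_Pair1[OF Am that] by simp
  \<comment> \<open>At p = ((s, y), \<omega>) with s \<le> t this is the smoothed test function, the
    convolution of |\<phi>| with the heat kernel at time t - s, evaluated at
    \<open>y\<close>.\<close>
  define G where "G p = (\<integral>\<^sup>+x. A x p \<partial>lborel)" for p
  have Gm [measurable]: "G \<in> borel_measurable N"
    unfolding G_def[abs_def]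
    by (intro lborel.borel_measurable_nn_integral) (use measurable_pair_swap[OF Am] in simp)
  let ?q = "\<lambda>p. ennreal ((source p)\<^sup>2)"
  obtain B where B: "B \<ge> 0"
    "\<And>x. (\<integral>\<^sup>+\<omega>. ennreal \<bar>noise_part t x \<omega> * \<phi> x\<bar> \<partial>M) \<le> ennreal (\<bar>\<phi> x\<bar> * (1 + B))"
    "\<And>x x'. (\<integral>\<^sup>+\<omega>. ennreal \<bar>(noise_part t x \<omega> * \<phi> x) * (noise_part t x' \<omega> * \<phi> x')\<bar> \<partial>M) \<le>
      ennreal (\<bar>\<phi> x\<bar> * (1 + B)) * ennreal (\<bar>\<phi> x'\<bar> * (1 + B))"
    using noise_part_bounds[OF t(1)] by blast
  have "L2_norm_sq M (\<lambda>\<omega>. \<integral>x. noise_part t x \<omega> * \<phi> x \<partial>lborel) \<le>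
    (\<integral>\<^sup>+x. (\<integral>\<^sup>+x'. ennreal \<bar>\<integral>\<omega>. (noise_part t x \<omega> * \<phi> x) * (noise_part t x' \<omega> * \<phi> x') \<partial>M\<bar> \<partial>lborel) \<partial>lborel)"
    unfolding L2_norm_sq_def
  proof (rule second_moment_integral_le[OF lborel.sigma_finite_measure_axioms sigma_finite_measure_axioms])
    show "(\<lambda>(x, \<omega>). noise_part t x \<omega> * \<phi> x) \<in> borel_measurable (lborel \<Otimes>\<^sub>M M)"
      using noise_part_product_integrable[OF t(1)] by auto
    show "(\<integral>\<^sup>+x. ennreal (\<bar>\<phi> x\<bar> * (1 + B)) \<partial>lborel) < \<infinity>"
    proof -
      have "(\<integral>\<^sup>+x. ennreal (\<bar>\<phi> x\<bar> * (1 + B)) \<partial>lborel) = (\<integral>\<^sup>+x. ennreal \<bar>\<phi> x\<bar> * ennreal (1 + B) \<partial>lborel)"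
        using B(1) by (simp add: ennreal_mult)
      also have "\<dots> = (\<integral>\<^sup>+x. ennreal \<bar>\<phi> x\<bar> \<partial>lborel) * ennreal (1 + B)"
        by (rule nn_integral_multc) measurable
      also have "\<dots> < \<infinity>" using phi_integrable by (simp add: ennreal_mult_less_top)
      finally show ?thesis .
    qed
  qed (use B(3) in simp_all)
  also have "\<dots> \<le> (\<integral>\<^sup>+x. (\<integral>\<^sup>+x'. (\<integral>\<^sup>+p. A x p * A x' p * ?q p \<partial>N) \<partial>lborel) \<partial>lborel)"
  proof (intro nn_integral_mono)
    fix x x'
    have "\<bar>\<integral>\<omega>. (noise_part t x \<omega> * \<phi> x) * (noise_part t x' \<omega> * \<phi> x') \<partial>M\<bar> = \<bar>\<phi> x\<bar> * \<bar>\<phi> x'\<bar> * \<bar>\<integral>\<omega>. noise_part t x \<omega> * noise_part t x' \<omega> \<partial>M\<bar>"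
    proof -
      have "(\<integral>\<omega>. (noise_part t x \<omega> * \<phi> x) * (noise_part t x' \<omega> * \<phi> x') \<partial>M) = (\<integral>\<omega>. (\<phi> x * \<phi> x') * (noise_part t x \<omega> * noise_part t x' \<omega>) \<partial>M)"
        by (simp add: mult_ac)
      then show ?thesis by (simp add: abs_mult)
    qed
    then have "ennreal \<bar>\<integral>\<omega>. (noise_part t x \<omega> * \<phi> x) * (noise_part t x' \<omega> * \<phi> x') \<partial>M\<bar> =
      ennreal (\<bar>\<phi> x\<bar> * \<bar>\<phi> x'\<bar>) * ennreal \<bar>\<integral>\<omega>. noise_part t x \<omega> * noise_part t x' \<omega> \<partial>M\<bar>"
      by (simp add: ennreal_mult)
    also have "\<dots> \<le> ennreal (\<bar>\<phi> x\<bar> * \<bar>\<phi> x'\<bar>) * (\<integral>\<^sup>+p. ennreal (kernel t x (fst p) * kernel t x' (fst p) * (source p)\<^sup>2) \<partial>N)"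
      by (intro mult_left_mono noise_part_covariance[OF t(1)]) simp
    also have "\<dots> = (\<integral>\<^sup>+p. ennreal (\<bar>\<phi> x\<bar> * \<bar>\<phi> x'\<bar>) * ennreal (kernel t x (fst p) * kernel t x' (fst p) * (source p)\<^sup>2) \<partial>N)"
    proof (rule nn_integral_cmult[symmetric])
      have "(\<lambda>p. kernel t z (fst p)) \<in> borel_measurable N" for z
        using measurable_Pair2[OF kernel_measurable, of z] by simp
      then show "(\<lambda>p. ennreal (kernel t x (fst p) * kernel t x' (fst p) * (source p)\<^sup>2)) \<in> borel_measurable N"
        by measurable
    qed
    also have "\<dots> = (\<integral>\<^sup>+p. A x p * A x' p * ?q p \<partial>N)"
      by (intro nn_integral_cong) (simp add: A_def kernel_nonneg mult_ac flip: ennreal_mult)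
    finally show "ennreal \<bar>\<integral>\<omega>. (noise_part t x \<omega> * \<phi> x) * (noise_part t x' \<omega> * \<phi> x') \<partial>M\<bar> \<le> (\<integral>\<^sup>+p. A x p * A x' p * ?q p \<partial>N)" .
  qed
  \<comment> \<open>Tonelli moves both integrals over x and x' inside; for fixed \<open>p\<close>
    the integrand factorizes, and each of them produces one factor \<open>G p\<close>.\<close>
  also have "\<dots> = (\<integral>\<^sup>+x. (\<integral>\<^sup>+p. (\<integral>\<^sup>+x'. A x p * A x' p * ?q p \<partial>lborel) \<partial>N) \<partial>lborel)"
    by (intro nn_integral_cong LN.Fubini'[symmetric]) measurable
  also have "\<dots> = (\<integral>\<^sup>+x. (\<integral>\<^sup>+p. A x p * (G p * ?q p) \<partial>N) \<partial>lborel)"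
  proof (intro nn_integral_cong)
    fix x p assume p: "p \<in> space N"
    note [measurable] = Ap[OF p]
    have "(\<integral>\<^sup>+x'. A x p * A x' p * ?q p \<partial>lborel) = (\<integral>\<^sup>+x'. A x p * ?q p * A x' p \<partial>lborel)" by (simp add: mult_ac)
    also have "\<dots> = A x p * ?q p * G p" unfolding G_def by (rule nn_integral_cmult) measurable
    finally show "(\<integral>\<^sup>+x'. A x p * A x' p * ?q p \<partial>lborel) = A x p * (G p * ?q p)" by (simp add: mult_ac)
  qed
  also have "\<dots> = (\<integral>\<^sup>+p. (\<integral>\<^sup>+x. A x p * (G p * ?q p) \<partial>lborel) \<partial>N)"
    by (rule LN.Fubini'[symmetric]) measurable
  also have "\<dots> = (\<integral>\<^sup>+p. G p * (G p * ?q p) \<partial>N)"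
  proof (intro nn_integral_cong)
    fix p assume p: "p \<in> space N"
    note [measurable] = Ap[OF p]
    show "(\<integral>\<^sup>+x. A x p * (G p * ?q p) \<partial>lborel) = G p * (G p * ?q p)"
      unfolding G_def[of p] by (rule nn_integral_multc) measurable
  qed
  also have "\<dots> \<le> (\<integral>\<^sup>+p. ennreal smoothing_const * (indicator {0..t} (fst (fst p)) * ennreal (weight p)) \<partial>N)"
  proof (rule nn_integral_mono)
    fix p :: "(real \<times> real) \<times> 'w"
    obtain s y \<omega> where p: "p = ((s, y), \<omega>)" by (metis surj_pair)
    let ?c = "localized_const \<nu> a K (1/8)"
    show "G p * (G p * ?q p) \<le> ennreal smoothing_const * (indicator {0..t} (fst (fst p)) * ennreal (weight p))"
    proof (cases "s \<in> {0..t}")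
      case True
      have c: "?c \<ge> 0" using K_nonneg by (simp add: localized_const_def)
      have "G p = (\<integral>\<^sup>+x. ennreal (\<bar>\<phi> x\<bar> * heat_kernel \<nu> (t - s) (x - y)) \<partial>lborel)"
        using True by (simp add: G_def A_def p kernel_def)
      \<comment> \<open>The majorant is taken at time 1/8 and not at \<open>t\<close>, so that it is
        the same for all t \<le> 1/8 and its exponent is - y^2 / \<nu>.\<close>
      also have "\<dots> \<le> ennreal (?c * exp (- y\<^sup>2 / (8 * \<nu> * (1/8))))"
        using True t nu K a by (intro heat_flow_localized) auto
      finally have G: "G p \<le> ennreal (?c * exp (- y\<^sup>2 / \<nu>))" by simp
      have "G p * (G p * ?q p) \<le> ennreal (?c * exp (- y\<^sup>2 / \<nu>)) * (ennreal (?c * exp (- y\<^sup>2 / \<nu>)) * ?q p)"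
        by (intro mult_mono G mult_right_mono) auto
      also have "\<dots> = ennreal (?c\<^sup>2 * (exp (- y\<^sup>2 / \<nu>))\<^sup>2 * (source p)\<^sup>2)"
      proof -
        have "ennreal w * (ennreal w * ennreal z) = ennreal (w\<^sup>2 * z)" if "0 \<le> w" "0 \<le> z" for w z
          using that by (simp add: power2_eq_square mult.assoc flip: ennreal_mult)
        from this[of "?c * exp (- y\<^sup>2 / \<nu>)" "(source p)\<^sup>2"] show ?thesis
          using c by (simp add: power_mult_distrib)
      qed
      also have "\<dots> \<le> ennreal (?c\<^sup>2 * (2 * pi * \<nu> * (heat_kernel \<nu> (1 - s) y)\<^sup>2) * (source p)\<^sup>2)"
        using True t nu by (intro ennreal_leI mult_right_mono mult_left_mono exp_le_heat_kernel_sq) auto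
      also have "\<dots> = ennreal smoothing_const * ennreal (weight p)"
        using nu by (simp add: smoothing_const_def weight_def p mult_ac flip: ennreal_mult)
      finally show ?thesis using True by (simp add: p)
    next
      case False
      then have "G p = 0" by (simp add: G_def A_def p kernel_def)
      then show ?thesis by simp
    qed
  qed
  also have "\<dots> = ennreal smoothing_const * initial_mass t"
    unfolding initial_mass_def by (rule nn_integral_cmult) measurable
  finally show ?thesis .
qed

section \<open>Convergence of the tested solution\<close>

abbreviation heat_part :: "real \<Rightarrow> real \<Rightarrow> real" where
  "heat_part t x \<equiv> signed_integral \<mu> (\<lambda>y. heat_kernel \<nu> t (x - y))"

lemma heat_part_integrable: "t > 0 \<Longrightarrow> integrable lborel (\<lambda>x. heat_part t x * \<phi> x)"
  by (rule heat_flow_signed_measure(2)[OF nu mu cont]) (use K a in auto)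

text \<open>Integrability is recorded along with the value: without it the pairing could be the
  conventional value 0 of a divergent integral.\<close>

lemma solution_pairing_AE:
  assumes t: "t > 0"
  shows "AE \<omega> in M. integrable lborel (\<lambda>x. u t x \<omega> * \<phi> x) \<and>
    (\<integral>x. u t x \<omega> * \<phi> x \<partial>lborel) = (\<integral>x. noise_part t x \<omega> * \<phi> x \<partial>lborel) + (\<integral>x. heat_part t x * \<phi> x \<partial>lborel)"
proof -
  interpret LM: pair_sigma_finite lborel M by standard
  have "AE \<omega> in M. integrable lborel (\<lambda>x. noise_part t x \<omega> * \<phi> x)"
    using LM.AE_integrable_snd[OF noise_part_product_integrable[OF t]] by simp
  then show ?thesis
  proof eventually_elim
    case (elim \<omega>)
    have eq: "u t x \<omega> * \<phi> x = noise_part t x \<omega> * \<phi> x + heat_part t x * \<phi> x" for x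
      by (simp add: noise_part_def algebra_simps)
    show ?case unfolding eq using elim heat_part_integrable[OF t] by simp
  qed
qed

lemma solution_pairing_measurable:
  assumes t: "t > 0"
  shows "(\<lambda>\<omega>. \<integral>x. u t x \<omega> * \<phi> x \<partial>lborel) \<in> borel_measurable M"
proof -
  have "(\<lambda>p. u t (snd p) (fst p)) \<in> borel_measurable (M \<Otimes>\<^sub>M lborel)"
    using measurable_pair_swap[OF u_section_measurable[OF t]] by (simp add: case_prod_unfold)
  then have "(\<lambda>(\<omega>, x). u t x \<omega> * \<phi> x) \<in> borel_measurable (M \<Otimes>\<^sub>M lborel)"
    unfolding case_prod_unfold by measurable
  then show ?thesis by (rule lborel.borel_measurable_lebesgue_integral)
qed

text \<open>The constant \<open>c\<close> is free: c = 0 yields membership in the space of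
  square-integrable variables, and c equal to the pairing with the initial measure yields the
  limit.\<close>

lemma solution_pairing_distance:
  assumes t: "0 < t" "t \<le> 1/8"
  shows "L2_norm_sq M (\<lambda>\<omega>. (\<integral>x. u t x \<omega> * \<phi> x \<partial>lborel) - c) \<le>
    ennreal 2 * (ennreal smoothing_const * initial_mass t) + ennreal 2 * ennreal (((\<integral>x. heat_part t x * \<phi> x \<partial>lborel) - c)\<^sup>2)"
proof -
  let ?Z = "\<lambda>\<omega>. \<integral>x. noise_part t x \<omega> * \<phi> x \<partial>lborel" and ?m = "(\<integral>x. heat_part t x * \<phi> x \<partial>lborel) - c"
  have Zm: "?Z \<in> borel_measurable M"
  proof (rule lborel.borel_measurable_lebesgue_integral)
    show "(\<lambda>(\<omega>, x). noise_part t x \<omega> * \<phi> x) \<in> borel_measurable (M \<Otimes>\<^sub>M lborel)"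
      using measurable_pair_swap[OF borel_measurable_integrable[OF noise_part_product_integrable[OF t(1)]]]
      by (simp add: case_prod_unfold)
  qed
  have "L2_norm_sq M (\<lambda>\<omega>. (\<integral>x. u t x \<omega> * \<phi> x \<partial>lborel) - c) = L2_norm_sq M (\<lambda>\<omega>. ?Z \<omega> + ?m)"
    unfolding L2_norm_sq_def
  proof (rule nn_integral_cong_AE)
    show "AE \<omega> in M. ennreal (((\<integral>x. u t x \<omega> * \<phi> x \<partial>lborel) - c)\<^sup>2) = ennreal ((?Z \<omega> + ?m)\<^sup>2)"
      using solution_pairing_AE[OF t(1)] by eventually_elim (simp add: add_diff_eq)
  qed
  also have "\<dots> \<le> ennreal (1 + 1) * L2_norm_sq M ?Z + ennreal (1 + 1/1) * L2_norm_sq M (\<lambda>_. ?m)"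
    by (rule L2_norm_sq_add_le) (use Zm in auto)
  also have "\<dots> = ennreal 2 * L2_norm_sq M ?Z + ennreal 2 * ennreal (?m\<^sup>2)"
    by (simp add: L2_norm_sq_def emeasure_space_1)
  also have "\<dots> \<le> ennreal 2 * (ennreal smoothing_const * initial_mass t) + ennreal 2 * ennreal (?m\<^sup>2)"
    by (intro add_right_mono mult_left_mono noise_part_second_moment t) simp
  finally show ?thesis .
qed

lemma solution_pairing_tendsto:
  "tendsto_L2 M (\<lambda>t \<omega>. \<integral>x. u t x \<omega> * \<phi> x \<partial>lborel) (\<lambda>\<omega>. signed_integral \<mu> \<phi>) (at_right 0)"
  unfolding tendsto_L2_def
proof (intro conjI)
  let ?X = "\<lambda>t \<omega>. \<integral>x. u t x \<omega> * \<phi> x \<partial>lborel" and ?c = "signed_integral \<mu> \<phi>"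
  show "(\<lambda>\<omega>. ?c) \<in> L2_space M"
    by (simp add: L2_space_def L2_norm_sq_def emeasure_space_1)
  have "?X t \<in> L2_space M" if t: "0 < t" "t < 1/8" for t
  proof -
    have "initial_mass t \<le> initial_mass 1"
      unfolding initial_mass_def using t by (intro nn_integral_mono mult_right_mono) (auto simp: indicator_def)
    then have "initial_mass t < \<infinity>" using initial_mass_finite by (rule le_less_trans)
    then have "ennreal 2 * (ennreal smoothing_const * initial_mass t) + ennreal 2 * ennreal (((\<integral>x. heat_part t x * \<phi> x \<partial>lborel) - 0)\<^sup>2) < \<infinity>"
      by (simp add: ennreal_mult_less_top)
    with solution_pairing_distance[of t 0] t have "L2_norm_sq M (\<lambda>\<omega>. ?X t \<omega> - 0) < \<infinity>"
      by (meson le_less_trans less_imp_le)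
    then show ?thesis using solution_pairing_measurable[OF t(1)] by (simp add: L2_space_def)
  qed
  then show "eventually (\<lambda>t. ?X t \<in> L2_space M) (at_right 0)"
    unfolding eventually_at_right_field by (intro exI[of _ "1/8"]) auto
  \<comment> \<open>Both limits rest on dominated convergence along sequences, so the one-sided
    limit is tested on sequences that stay in the range of times below 1/8.\<close>
  show "((\<lambda>t. L2_norm_sq M (\<lambda>\<omega>. ?X t \<omega> - ?c)) \<longlongrightarrow> 0) (at_right 0)"
  proof (rule tendsto_at_right_sequentially[of 0 "1/8"])
    fix t :: "nat \<Rightarrow> real" assume t: "\<And>n. 0 < t n" "\<And>n. t n < 1/8" "t \<longlonglongrightarrow> 0"
    let ?r = "\<lambda>n. ennreal 2 * (ennreal smoothing_const * initial_mass (t n)) + ennreal 2 * ennreal (((\<integral>x. heat_part (t n) x * \<phi> x \<partial>lborel) - ?c)\<^sup>2)"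
    have "t n < 1" for n using t(2)[of n] by simp
    then have "(\<lambda>n. initial_mass (t n)) \<longlonglongrightarrow> 0" by (rule initial_mass_tendsto) (rule t)
    moreover have "(\<lambda>n. \<integral>x. heat_part (t n) x * \<phi> x \<partial>lborel) \<longlonglongrightarrow> ?c"
      by (rule heat_flow_signed_measure(3)[OF nu mu cont _ _ t(1,3)]) (use K a in auto)
    ultimately have "?r \<longlonglongrightarrow> ennreal 2 * (ennreal smoothing_const * 0) + ennreal 2 * ennreal ((?c - ?c)\<^sup>2)"
      by (intro tendsto_add ennreal_tendsto_cmult tendsto_ennrealI tendsto_intros) auto
    then have r: "?r \<longlonglongrightarrow> 0" by simp
    show "(\<lambda>n. L2_norm_sq M (\<lambda>\<omega>. ?X (t n) \<omega> - ?c)) \<longlonglongrightarrow> 0"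
    proof (rule tendsto_sandwich[OF _ _ tendsto_const r])
      show "eventually (\<lambda>n. L2_norm_sq M (\<lambda>\<omega>. ?X (t n) \<omega> - ?c) \<le> ?r n) sequentially"
        using t by (intro always_eventually allI solution_pairing_distance less_imp_le)
    qed simp
  qed simp
qed

end

end

theorem proposition3p4:
  fixes M :: "'w measure"
    and W :: "real \<Rightarrow> real set \<Rightarrow> 'w \<Rightarrow> real"
    and \<nu> :: real and \<rho> :: "real \<Rightarrow> real" and \<mu> :: "real set \<Rightarrow> real"
    and u :: "real \<Rightarrow> real \<Rightarrow> 'w \<Rightarrow> real" and \<phi> :: "real \<Rightarrow> real"
  assumes "prob_space M" and "complete_measure M"
    and "space_time_white_noise M W"
    and "\<nu> > 0"
    and "\<exists>L. L-lipschitz_on UNIV \<rho>"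
    and "\<mu> \<in> M_H"
    and "random_field_solution M W \<nu> \<rho> \<mu> u"
    and "\<phi> \<in> test_functions"
  shows "(\<forall>t>0. AE \<omega> in M. integrable lborel (\<lambda>x. u t x \<omega> * \<phi> x)) \<and>
    tendsto_L2 M (\<lambda>t \<omega>. \<integral>x. u t x \<omega> * \<phi> x \<partial>lborel) (\<lambda>\<omega>. signed_integral \<mu> \<phi>) (at_right 0)"
proof -
  interpret prob_space M by fact
  obtain I where I: "\<And>t x. t > 0 \<Longrightarrow> has_walsh_integral M W
              (\<lambda>s y \<omega>. indicator {0..t} s * heat_kernel \<nu> (t - s) (x - y) * \<rho> (u s y \<omega>)) (I t x)"
    "\<And>t x. t > 0 \<Longrightarrow> tendsto_L2 M (\<lambda>(s, y). I s y) (I t x) (at (t, x) within {0<..} \<times> UNIV)"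
    "\<And>t x. t > 0 \<Longrightarrow> AE \<omega> in M. u t x \<omega> = signed_integral \<mu> (\<lambda>y. heat_kernel \<nu> t (x - y)) + I t x \<omega>"
    using assms(7) unfolding random_field_solution_def by blast
  have rho: "\<rho> \<in> borel_measurable borel"
    using assms(5) by (auto intro: borel_measurable_continuous_onI lipschitz_on_continuous_on)
  interpret heat_equation_solution M W \<nu> \<rho> \<mu> u I
    by unfold_locales (use assms I rho in \<open>auto simp: random_field_solution_def\<close>)
  obtain K a where \<phi>: "continuous_on UNIV \<phi>" "\<And>x. \<bar>\<phi> x\<bar> \<le> K" "\<And>x. \<phi> x \<noteq> 0 \<Longrightarrow> \<bar>x\<bar> \<le> a"
    using test_function_facts[OF assms(8)] by metis
  show ?thesis
    using solution_pairing_AE[OF \<phi>] solution_pairing_tendsto[OF \<phi>] by (auto elim!: eventually_mono)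
qed

end
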